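(* For a precartesian bicategory $\mathbf{B}$, the data $(\otimes,\widetilde\otimes,\otimes^\circ)$ constitute a lax functor $\mathbf{B}\times\mathbf{B}\to\mathbf{B}$.
   Context: Conventions. All bicategories are normal (unit constraints $1R\cong R$, $R1\cong R$ are identities); associativity constraints are suppressed. A lax functor is a morphism of bicategories. A map is an arrow $f$ with a right adjoint $f^*$; $\mathbf{M}=\mathrm{Map}\,\mathbf{B}$ is the locally full subbicategory of $\mathbf{B}$ with all objects and with the maps as arrows. $\mathbf{B}$ is precartesian if (i) $\mathbf{M}$ has finite products in the bilimit sense: for all $X,Y$ there are an object $X\times Y$ and maps $p_{X,Y}:X\times Y\to X$, $r_{X,Y}:X\times Y\to Y$ such that $\mathbf{M}(Z,X\times Y)\to\mathbf{M}(Z,X)\times\mathbf{M}(Z,Y)$ is an equivalence of categories for every $Z$, and there is an object $I$ with $\mathbf{M}(Z,I)\to\mathbf{1}$ an equivalence for every $Z$; (ii) each category $\mathbf{B}(X,Y)$ has finite products, written $R\wedge S$ with projections $\pi:R\wedge S\to R$, $\rho:R\wedge S\to S$. The data. On objects, $X\otimes Y=X\times Y$. On arrows $R:X\to A$, $S:Y\to B$: $R\otimes S=p_{A,B}^*Rp_{X,Y}\wedge r_{A,B}^*Sr_{X,Y}:X\otimes Y\to A\otimes B$; on 2-cells $\alpha\otimes\beta=(p^*\alpha p)\wedge(r^*\beta r)$. Let $\tilde p_{R,S}:p_{A,B}(R\otimes S)\to Rp_{X,Y}$ be the composite of $p_{A,B}\pi$ with $\epsilon Rp_{X,Y}$, $\epsilon$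 the counit of $p_{A,B}\dashv p_{A,B}^*$, and define $\tilde r_{R,S}:r_{A,B}(R\otimes S)\to Sr_{X,Y}$ similarly from $\rho$. Arrows of $\mathbf{B}$ under these projections have the following uniqueness property, which defines the constraints: $\otimes^\circ:1_{X\otimes Y}\to 1_X\otimes 1_Y$ is the unique 2-cell such that $\tilde p_{1_X,1_Y}\cdot(p_{X,Y}\otimes^\circ)$ is the identity of $p_{X,Y}$ and $\tilde r_{1_X,1_Y}\cdot(r_{X,Y}\otimes^\circ)$ is the identity of $r_{X,Y}$; and for further arrows $T:A\to L$, $U:B\to M$, $\widetilde\otimes:(T\otimes U)(R\otimes S)\to TR\otimes US$ is the unique 2-cell with $\tilde p_{TR,US}\cdot(p_{L,M}\widetilde\otimes)=(T\tilde p_{R,S})\cdot(\tilde p_{T,U}(R\otimes S))$ and $\tilde r_{TR,US}\cdot(r_{L,M}\widetilde\otimes)=(U\tilde r_{R,S})\cdot(\tilde r_{T,U}(R\otimes S))$. *)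

theory Defs
  imports Main
begin

section \<open>Categories with explicit carriers\<close>

record ('o, 'm) cat =
  Ob :: "'o set"
  Mor :: "'m set"
  Dom :: "'m \<Rightarrow> 'o"
  Cod :: "'m \<Rightarrow> 'o"
  Id :: "'o \<Rightarrow> 'm"
  Comp :: "'m \<Rightarrow> 'm \<Rightarrow> 'm"  (infixr "\<bullet>\<index>" 70)

definition Hom :: "('o, 'm) cat \<Rightarrow> 'o \<Rightarrow> 'o \<Rightarrow> 'm set" where
  "Hom C a b = {f \<in> Mor C. Dom C f = a \<and> Cod C f = b}"

locale category =
  fixes C :: "('o, 'm) cat" (structure)
  assumes Dom_in: "f \<in> Mor C \<Longrightarrow> Dom C f \<in> Ob C"
    and Cod_in: "f \<in> Mor C \<Longrightarrow> Cod C f \<in> Ob C"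
    and Id_in: "a \<in> Ob C \<Longrightarrow> Id C a \<in> Hom C a a"
    and Comp_in: "\<lbrakk>f \<in> Hom C a b; g \<in> Hom C b c\<rbrakk> \<Longrightarrow> g \<bullet> f \<in> Hom C a c"
    and Id_left: "f \<in> Hom C a b \<Longrightarrow> Id C b \<bullet> f = f"
    and Id_right: "f \<in> Hom C a b \<Longrightarrow> f \<bullet> Id C a = f"
    and Comp_assoc: "\<lbrakk>f \<in> Hom C a b; g \<in> Hom C b c; h \<in> Hom C c d\<rbrakk>
      \<Longrightarrow> (h \<bullet> g) \<bullet> f = h \<bullet> (g \<bullet> f)"

definition inverses :: "('o, 'm) cat \<Rightarrow> 'm \<Rightarrow> 'm \<Rightarrow> bool" where
  "inverses C f g \<longleftrightarrow> f \<in> Hom C (Dom C f) (Cod C f) \<and> g \<in> Hom C (Cod C f) (Dom C f) \<and>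
     g \<bullet>\<^bsub>C\<^esub> f = Id C (Dom C f) \<and> f \<bullet>\<^bsub>C\<^esub> g = Id C (Cod C f)"

definition is_iso :: "('o, 'm) cat \<Rightarrow> 'm \<Rightarrow> bool" where
  "is_iso C f \<longleftrightarrow> (\<exists>g. inverses C f g)"

definition prod_cat :: "('o, 'm) cat \<Rightarrow> ('p, 'n) cat \<Rightarrow> ('o \<times> 'p, 'm \<times> 'n) cat" where
  "prod_cat C D =
    \<lparr>Ob = Ob C \<times> Ob D, Mor = Mor C \<times> Mor D,
     Dom = map_prod (Dom C) (Dom D), Cod = map_prod (Cod C) (Cod D),
     Id = map_prod (Id C) (Id D),
     Comp = (\<lambda>(g, g') (f, f'). (g \<bullet>\<^bsub>C\<^esub> f, g' \<bullet>\<^bsub>D\<^esub> f'))\<rparr>"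

definition one_cat :: "(unit, unit) cat" where
  "one_cat = \<lparr>Ob = UNIV, Mor = UNIV, Dom = (\<lambda>_. ()), Cod = (\<lambda>_. ()),
     Id = (\<lambda>_. ()), Comp = (\<lambda>_ _. ())\<rparr>"

locale cat_functor = C: category C + D: category D
  for C :: "('o, 'm) cat" and D :: "('p, 'n) cat" +
  fixes Fo :: "'o \<Rightarrow> 'p" and Fm :: "'m \<Rightarrow> 'n"
  assumes Fo_in: "a \<in> Ob C \<Longrightarrow> Fo a \<in> Ob D"
    and Fm_in: "f \<in> Hom C a b \<Longrightarrow> Fm f \<in> Hom D (Fo a) (Fo b)"
    and Fm_Id: "a \<in> Ob C \<Longrightarrow> Fm (Id C a) = Id D (Fo a)"
    and Fm_Comp: "\<lbrakk>f \<in> Hom C a b; g \<in> Hom C b c\<rbrakk>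
      \<Longrightarrow> Fm (g \<bullet>\<^bsub>C\<^esub> f) = Fm g \<bullet>\<^bsub>D\<^esub> Fm f"

locale nat_trans = F: cat_functor C D Fo Fm + G: cat_functor C D Go Gm
  for C :: "('o, 'm) cat" and D :: "('p, 'n) cat" and Fo Fm Go Gm +
  fixes \<tau> :: "'o \<Rightarrow> 'n"
  assumes component_in: "a \<in> Ob C \<Longrightarrow> \<tau> a \<in> Hom D (Fo a) (Go a)"
    and natural: "f \<in> Hom C a b \<Longrightarrow> \<tau> b \<bullet>\<^bsub>D\<^esub> Fm f = Gm f \<bullet>\<^bsub>D\<^esub> \<tau> a"

locale nat_iso = nat_trans +
  assumes component_iso: "a \<in> Ob C \<Longrightarrow> is_iso D (\<tau> a)"

definition equivalence_of_cats ::
    "('o, 'm) cat \<Rightarrow> ('p, 'n) cat \<Rightarrow> ('o \<Rightarrow> 'p) \<Rightarrow> ('m \<Rightarrow> 'n) \<Rightarrow> bool" where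
  "equivalence_of_cats C D Fo Fm \<longleftrightarrow>
     cat_functor C D Fo Fm \<and>
     (\<exists>Go Gm \<eta> \<epsilon>. cat_functor D C Go Gm \<and>
        nat_iso C C (\<lambda>a. a) (\<lambda>f. f) (Go \<circ> Fo) (Gm \<circ> Fm) \<eta> \<and>
        nat_iso D D (Fo \<circ> Go) (Fm \<circ> Gm) (\<lambda>b. b) (\<lambda>g. g) \<epsilon>)"

definition is_product :: "('o, 'm) cat \<Rightarrow> 'o \<Rightarrow> 'o \<Rightarrow> 'o \<Rightarrow> 'm \<Rightarrow> 'm \<Rightarrow> bool" where
  "is_product C a b P p q \<longleftrightarrow> P \<in> Ob C \<and> p \<in> Hom C P a \<and> q \<in> Hom C P b \<and>
     (\<forall>c\<in>Ob C. \<forall>f\<in>Hom C c a. \<forall>g\<in>Hom C c b.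
        \<exists>!h. h \<in> Hom C c P \<and> p \<bullet>\<^bsub>C\<^esub> h = f \<and> q \<bullet>\<^bsub>C\<^esub> h = g)"

definition is_terminal :: "('o, 'm) cat \<Rightarrow> 'o \<Rightarrow> bool" where
  "is_terminal C t \<longleftrightarrow> t \<in> Ob C \<and> (\<forall>c\<in>Ob C. \<exists>!h. h \<in> Hom C c t)"

definition has_finite_products :: "('o, 'm) cat \<Rightarrow> bool" where
  "has_finite_products C \<longleftrightarrow>
     (\<forall>a\<in>Ob C. \<forall>b\<in>Ob C. \<exists>P p q. is_product C a b P p q) \<and> (\<exists>t. is_terminal C t)"

section \<open>Normal bicategories\<close>

text \<open>
  The composite of \<open>R : X \<rightarrow> Y\<close> and \<open>S : Y \<rightarrow> Z\<close> is \<open>S \<odot> R\<close>;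
  \<open>\<cdot>\<close> is vertical and \<open>\<star>\<close> horizontal composition of 2-cells.
  There are no fields for the unit constraints, since in a normal bicategory these are
  identities.
\<close>

record ('o, 'a, 'c) bicat =
  Obj :: "'o set"
  Arr :: "'a set"
  Src :: "'a \<Rightarrow> 'o"
  Tgt :: "'a \<Rightarrow> 'o"
  Cell :: "'c set"
  Cdom :: "'c \<Rightarrow> 'a"
  Ccod :: "'c \<Rightarrow> 'a"
  One :: "'o \<Rightarrow> 'a"
  ArrComp :: "'a \<Rightarrow> 'a \<Rightarrow> 'a"  (infixr "\<odot>\<index>" 75)
  CellId :: "'a \<Rightarrow> 'c"
  VComp :: "'c \<Rightarrow> 'c \<Rightarrow> 'c"  (infixr "\<cdot>\<index>" 65)
  HComp :: "'c \<Rightarrow> 'c \<Rightarrow> 'c"  (infixr "\<star>\<index>" 75)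
  Assoc :: "'a \<Rightarrow> 'a \<Rightarrow> 'a \<Rightarrow> 'c"

definition Arrs :: "('o, 'a, 'c) bicat \<Rightarrow> 'o \<Rightarrow> 'o \<Rightarrow> 'a set" where
  "Arrs B X Y = {R \<in> Arr B. Src B R = X \<and> Tgt B R = Y}"

definition Cells :: "('o, 'a, 'c) bicat \<Rightarrow> 'a \<Rightarrow> 'a \<Rightarrow> 'c set" where
  "Cells B R S = {\<alpha> \<in> Cell B. Cdom B \<alpha> = R \<and> Ccod B \<alpha> = S}"

definition full_hom :: "('o, 'a, 'c) bicat \<Rightarrow> 'a set \<Rightarrow> ('a, 'c) cat" where
  "full_hom B A =
    \<lparr>Ob = A, Mor = {\<alpha> \<in> Cell B. Cdom B \<alpha> \<in> A \<and> Ccod B \<alpha> \<in> A},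
     Dom = Cdom B, Cod = Ccod B, Id = CellId B, Comp = VComp B\<rparr>"

definition hom_cat :: "('o, 'a, 'c) bicat \<Rightarrow> 'o \<Rightarrow> 'o \<Rightarrow> ('a, 'c) cat" where
  "hom_cat B X Y = full_hom B (Arrs B X Y)"

abbreviation lwhisker :: "('o, 'a, 'c) bicat \<Rightarrow> 'a \<Rightarrow> 'c \<Rightarrow> 'c" where
  "lwhisker B R \<alpha> \<equiv> CellId B R \<star>\<^bsub>B\<^esub> \<alpha>"

abbreviation rwhisker :: "('o, 'a, 'c) bicat \<Rightarrow> 'c \<Rightarrow> 'a \<Rightarrow> 'c" where
  "rwhisker B \<alpha> R \<equiv> \<alpha> \<star>\<^bsub>B\<^esub> CellId B R"

definition AssocInv :: "('o, 'a, 'c) bicat \<Rightarrow> 'a \<Rightarrow> 'a \<Rightarrow> 'a \<Rightarrow> 'c" where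
  "AssocInv B T S R =
     (THE \<gamma>. inverses (hom_cat B (Src B R) (Tgt B T)) (Assoc B T S R) \<gamma>)"

text \<open>
  \<open>Assoc_unit\<close> is the triangle axiom: both unit constraints occurring in it are identities.
  \<open>One_HComp\<close> and \<open>HComp_One\<close> are the naturality of the unit constraints.
\<close>

locale normal_bicategory =
  fixes B :: "('o, 'a, 'c) bicat" (structure)
  assumes Src_in: "R \<in> Arr B \<Longrightarrow> Src B R \<in> Obj B"
    and Tgt_in: "R \<in> Arr B \<Longrightarrow> Tgt B R \<in> Obj B"
    and Cdom_in: "\<alpha> \<in> Cell B \<Longrightarrow> Cdom B \<alpha> \<in> Arr B"
    and Ccod_in: "\<alpha> \<in> Cell B \<Longrightarrow> Ccod B \<alpha> \<in> Arr B"
    and Src_parallel: "\<alpha> \<in> Cell B \<Longrightarrow> Src B (Cdom B \<alpha>) = Src B (Ccod B \<alpha>)"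
    and Tgt_parallel: "\<alpha> \<in> Cell B \<Longrightarrow> Tgt B (Cdom B \<alpha>) = Tgt B (Ccod B \<alpha>)"
    and hom_category: "\<lbrakk>X \<in> Obj B; Y \<in> Obj B\<rbrakk> \<Longrightarrow> category (hom_cat B X Y)"
    and One_in: "X \<in> Obj B \<Longrightarrow> One B X \<in> Arrs B X X"
    and comp_functor: "\<lbrakk>X \<in> Obj B; Y \<in> Obj B; Z \<in> Obj B\<rbrakk> \<Longrightarrow>
      cat_functor (prod_cat (hom_cat B Y Z) (hom_cat B X Y)) (hom_cat B X Z)
        (\<lambda>(S, R). S \<odot> R) (\<lambda>(\<beta>, \<alpha>). \<beta> \<star> \<alpha>)"
    and Assoc_nat_iso: "\<lbrakk>X \<in> Obj B; Y \<in> Obj B; Z \<in> Obj B; W \<in> Obj B\<rbrakk> \<Longrightarrow>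
      nat_iso (prod_cat (hom_cat B Z W) (prod_cat (hom_cat B Y Z) (hom_cat B X Y))) (hom_cat B X W)
        (\<lambda>(T, S, R). (T \<odot> S) \<odot> R) (\<lambda>(\<gamma>, \<beta>, \<alpha>). (\<gamma> \<star> \<beta>) \<star> \<alpha>)
        (\<lambda>(T, S, R). T \<odot> (S \<odot> R)) (\<lambda>(\<gamma>, \<beta>, \<alpha>). \<gamma> \<star> (\<beta> \<star> \<alpha>))
        (\<lambda>(T, S, R). Assoc B T S R)"
    and pentagon: "\<lbrakk>R \<in> Arrs B X Y; S \<in> Arrs B Y Z; T \<in> Arrs B Z V; U \<in> Arrs B V W\<rbrakk> \<Longrightarrow>
      Assoc B U T (S \<odot> R) \<cdot> Assoc B (U \<odot> T) S R =
      lwhisker B U (Assoc B T S R) \<cdot> Assoc B U (T \<odot> S) R \<cdot> rwhisker B (Assoc B U T S) R"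
    and One_ArrComp: "R \<in> Arrs B X Y \<Longrightarrow> One B Y \<odot> R = R"
    and ArrComp_One: "R \<in> Arrs B X Y \<Longrightarrow> R \<odot> One B X = R"
    and One_HComp: "\<lbrakk>R \<in> Arrs B X Y; \<alpha> \<in> Cells B R S\<rbrakk> \<Longrightarrow> CellId B (One B Y) \<star> \<alpha> = \<alpha>"
    and HComp_One: "\<lbrakk>R \<in> Arrs B X Y; \<alpha> \<in> Cells B R S\<rbrakk> \<Longrightarrow> \<alpha> \<star> CellId B (One B X) = \<alpha>"
    and Assoc_unit: "\<lbrakk>R \<in> Arrs B X Y; S \<in> Arrs B Y Z\<rbrakk> \<Longrightarrow>
      Assoc B S (One B Y) R = CellId B (S \<odot> R)"

definition prod_bicat ::
    "('o, 'a, 'c) bicat \<Rightarrow> ('p, 'b, 'd) bicat \<Rightarrow> ('o \<times> 'p, 'a \<times> 'b, 'c \<times> 'd) bicat" where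
  "prod_bicat B C =
    \<lparr>Obj = Obj B \<times> Obj C, Arr = Arr B \<times> Arr C,
     Src = map_prod (Src B) (Src C), Tgt = map_prod (Tgt B) (Tgt C),
     Cell = Cell B \<times> Cell C,
     Cdom = map_prod (Cdom B) (Cdom C), Ccod = map_prod (Ccod B) (Ccod C),
     One = map_prod (One B) (One C),
     ArrComp = (\<lambda>(S, S') (R, R'). (S \<odot>\<^bsub>B\<^esub> R, S' \<odot>\<^bsub>C\<^esub> R')),
     CellId = map_prod (CellId B) (CellId C),
     VComp = (\<lambda>(\<beta>, \<beta>') (\<alpha>, \<alpha>'). (\<beta> \<cdot>\<^bsub>B\<^esub> \<alpha>, \<beta>' \<cdot>\<^bsub>C\<^esub> \<alpha>')),
     HComp = (\<lambda>(\<beta>, \<beta>') (\<alpha>, \<alpha>'). (\<beta> \<star>\<^bsub>B\<^esub> \<alpha>, \<beta>' \<star>\<^bsub>C\<^esub> \<alpha>')),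
     Assoc = (\<lambda>(T, T') (S, S') (R, R'). (Assoc B T S R, Assoc C T' S' R'))\<rparr>"

section \<open>Lax functors\<close>

record ('o, 'a, 'c, 'p, 'b, 'd) lax_data =
  on_obj :: "'o \<Rightarrow> 'p"
  on_arr :: "'a \<Rightarrow> 'b"
  on_cell :: "'c \<Rightarrow> 'd"
  lax_comp :: "'a \<Rightarrow> 'a \<Rightarrow> 'd"
  lax_unit :: "'o \<Rightarrow> 'd"

locale lax_functor = B: normal_bicategory B + C: normal_bicategory C
  for B :: "('o, 'a, 'c) bicat" and C :: "('p, 'b, 'd) bicat" +
  fixes F :: "('o, 'a, 'c, 'p, 'b, 'd) lax_data"
  assumes on_obj_in: "X \<in> Obj B \<Longrightarrow> on_obj F X \<in> Obj C"
    and hom_functor: "\<lbrakk>X \<in> Obj B; Y \<in> Obj B\<rbrakk> \<Longrightarrow>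
      cat_functor (hom_cat B X Y) (hom_cat C (on_obj F X) (on_obj F Y)) (on_arr F) (on_cell F)"
    and lax_comp_natural: "\<lbrakk>X \<in> Obj B; Y \<in> Obj B; Z \<in> Obj B\<rbrakk> \<Longrightarrow>
      nat_trans (prod_cat (hom_cat B Y Z) (hom_cat B X Y))
        (hom_cat C (on_obj F X) (on_obj F Z))
        (\<lambda>(S, R). on_arr F S \<odot>\<^bsub>C\<^esub> on_arr F R) (\<lambda>(\<beta>, \<alpha>). on_cell F \<beta> \<star>\<^bsub>C\<^esub> on_cell F \<alpha>)
        (\<lambda>(S, R). on_arr F (S \<odot>\<^bsub>B\<^esub> R)) (\<lambda>(\<beta>, \<alpha>). on_cell F (\<beta> \<star>\<^bsub>B\<^esub> \<alpha>))
        (\<lambda>(S, R). lax_comp F S R)"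
    and lax_unit_in: "X \<in> Obj B \<Longrightarrow>
      lax_unit F X \<in> Cells C (One C (on_obj F X)) (on_arr F (One B X))"
    and lax_associative: "\<lbrakk>R \<in> Arrs B X Y; S \<in> Arrs B Y Z; T \<in> Arrs B Z W\<rbrakk> \<Longrightarrow>
      on_cell F (Assoc B T S R) \<cdot>\<^bsub>C\<^esub> lax_comp F (T \<odot>\<^bsub>B\<^esub> S) R
        \<cdot>\<^bsub>C\<^esub> rwhisker C (lax_comp F T S) (on_arr F R) =
      lax_comp F T (S \<odot>\<^bsub>B\<^esub> R) \<cdot>\<^bsub>C\<^esub> lwhisker C (on_arr F T) (lax_comp F S R)
        \<cdot>\<^bsub>C\<^esub> Assoc C (on_arr F T) (on_arr F S) (on_arr F R)"
    and lax_unit_left: "R \<in> Arrs B X Y \<Longrightarrow>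
      lax_comp F (One B Y) R \<cdot>\<^bsub>C\<^esub> rwhisker C (lax_unit F Y) (on_arr F R)
      = CellId C (on_arr F R)"
    and lax_unit_right: "R \<in> Arrs B X Y \<Longrightarrow>
      lax_comp F R (One B X) \<cdot>\<^bsub>C\<^esub> lwhisker C (on_arr F R) (lax_unit F X)
      = CellId C (on_arr F R)"

section \<open>Maps and precartesian bicategories\<close>

definition adjunction ::
    "('o, 'a, 'c) bicat \<Rightarrow> 'a \<Rightarrow> 'a \<Rightarrow> 'c \<Rightarrow> 'c \<Rightarrow> bool" where
  "adjunction B f g \<eta> \<epsilon> \<longleftrightarrow>
     f \<in> Arr B \<and> g \<in> Arrs B (Tgt B f) (Src B f) \<and>
     \<eta> \<in> Cells B (One B (Src B f)) (g \<odot>\<^bsub>B\<^esub> f) \<and>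
     \<epsilon> \<in> Cells B (f \<odot>\<^bsub>B\<^esub> g) (One B (Tgt B f)) \<and>
     rwhisker B \<epsilon> f \<cdot>\<^bsub>B\<^esub> AssocInv B f g f \<cdot>\<^bsub>B\<^esub> lwhisker B f \<eta> = CellId B f \<and>
     lwhisker B g \<epsilon> \<cdot>\<^bsub>B\<^esub> Assoc B g f g \<cdot>\<^bsub>B\<^esub> rwhisker B \<eta> g = CellId B g"

definition is_map :: "('o, 'a, 'c) bicat \<Rightarrow> 'a \<Rightarrow> bool" where
  "is_map B f \<longleftrightarrow> (\<exists>g \<eta> \<epsilon>. adjunction B f g \<eta> \<epsilon>)"

text \<open>The hom-category \<open>\<^bold>M(X, Y)\<close>, where \<open>\<^bold>M = Map \<^bold>B\<close>.\<close>

definition map_cat :: "('o, 'a, 'c) bicat \<Rightarrow> 'o \<Rightarrow> 'o \<Rightarrow> ('a, 'c) cat" where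
  "map_cat B X Y = full_hom B {f \<in> Arrs B X Y. is_map B f}"

definition is_map_product ::
    "('o, 'a, 'c) bicat \<Rightarrow> 'o \<Rightarrow> 'o \<Rightarrow> 'o \<Rightarrow> 'a \<Rightarrow> 'a \<Rightarrow> bool" where
  "is_map_product B X Y P p r \<longleftrightarrow>
     P \<in> Obj B \<and> p \<in> Arrs B P X \<and> is_map B p \<and> r \<in> Arrs B P Y \<and> is_map B r \<and>
     (\<forall>Z\<in>Obj B. equivalence_of_cats (map_cat B Z P) (prod_cat (map_cat B Z X) (map_cat B Z Y))
        (\<lambda>f. (p \<odot>\<^bsub>B\<^esub> f, r \<odot>\<^bsub>B\<^esub> f)) (\<lambda>\<alpha>. (lwhisker B p \<alpha>, lwhisker B r \<alpha>)))"

definition is_map_terminal :: "('o, 'a, 'c) bicat \<Rightarrow> 'o \<Rightarrow> bool" where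
  "is_map_terminal B I \<longleftrightarrow> I \<in> Obj B \<and>
     (\<forall>Z\<in>Obj B. equivalence_of_cats (map_cat B Z I) one_cat (\<lambda>_. ()) (\<lambda>_. ()))"

locale precartesian = normal_bicategory +
  assumes map_products: "\<lbrakk>X \<in> Obj B; Y \<in> Obj B\<rbrakk> \<Longrightarrow> \<exists>P p r. is_map_product B X Y P p r"
    and map_terminal: "\<exists>I. is_map_terminal B I"
    and local_products: "\<lbrakk>X \<in> Obj B; Y \<in> Obj B\<rbrakk> \<Longrightarrow> has_finite_products (hom_cat B X Y)"

text \<open>
  A choice of the universal structure: \<open>Prod X Y\<close> with projections \<open>p_arr X Y\<close>, \<open>r_arr X Y\<close>;
  for each map \<open>f\<close> a right adjoint \<open>radj f\<close> with unit and counit; for parallel arrows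
  \<open>R\<close>, \<open>S\<close> a product \<open>wedge R S\<close> with projections \<open>wpi R S\<close>, \<open>wrho R S\<close>.
\<close>

record ('o, 'a, 'c) choices =
  Prod :: "'o \<Rightarrow> 'o \<Rightarrow> 'o"
  p_arr :: "'o \<Rightarrow> 'o \<Rightarrow> 'a"
  r_arr :: "'o \<Rightarrow> 'o \<Rightarrow> 'a"
  radj :: "'a \<Rightarrow> 'a"
  runit :: "'a \<Rightarrow> 'c"
  rcounit :: "'a \<Rightarrow> 'c"
  wedge :: "'a \<Rightarrow> 'a \<Rightarrow> 'a"
  wpi :: "'a \<Rightarrow> 'a \<Rightarrow> 'c"
  wrho :: "'a \<Rightarrow> 'a \<Rightarrow> 'c"

locale precartesian_choices =
  fixes B :: "('o, 'a, 'c) bicat" and K :: "('o, 'a, 'c) choices"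
  assumes chosen_product: "\<lbrakk>X \<in> Obj B; Y \<in> Obj B\<rbrakk> \<Longrightarrow>
      is_map_product B X Y (Prod K X Y) (p_arr K X Y) (r_arr K X Y)"
    and chosen_adjoint: "is_map B f \<Longrightarrow> adjunction B f (radj K f) (runit K f) (rcounit K f)"
    and chosen_wedge: "\<lbrakk>R \<in> Arrs B X Y; S \<in> Arrs B X Y\<rbrakk> \<Longrightarrow>
      is_product (hom_cat B X Y) R S (wedge K R S) (wpi K R S) (wrho K R S)"

section \<open>The tensor product\<close>

definition wedge_cell ::
    "('o, 'a, 'c) bicat \<Rightarrow> ('o, 'a, 'c) choices \<Rightarrow> 'c \<Rightarrow> 'c \<Rightarrow> 'c" where
  "wedge_cell B K \<alpha> \<beta> =
    (let R = Cdom B \<alpha>; R' = Ccod B \<alpha>; S = Cdom B \<beta>; S' = Ccod B \<beta> in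
     THE \<gamma>. \<gamma> \<in> Cells B (wedge K R S) (wedge K R' S') \<and>
       wpi K R' S' \<cdot>\<^bsub>B\<^esub> \<gamma> = \<alpha> \<cdot>\<^bsub>B\<^esub> wpi K R S \<and>
       wrho K R' S' \<cdot>\<^bsub>B\<^esub> \<gamma> = \<beta> \<cdot>\<^bsub>B\<^esub> wrho K R S)"

text \<open>
  For \<open>R : X \<rightarrow> A\<close> and \<open>S : Y \<rightarrow> D\<close>, \<open>tensor_fst R S\<close> is \<open>p\<^sup>*Rp\<close> and \<open>tensor_snd R S\<close> is
  \<open>r\<^sup>*Sr\<close>, both bracketed to the right.
\<close>

definition tensor_fst ::
    "('o, 'a, 'c) bicat \<Rightarrow> ('o, 'a, 'c) choices \<Rightarrow> 'a \<Rightarrow> 'a \<Rightarrow> 'a" where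
  "tensor_fst B K R S =
     radj K (p_arr K (Tgt B R) (Tgt B S)) \<odot>\<^bsub>B\<^esub> (R \<odot>\<^bsub>B\<^esub> p_arr K (Src B R) (Src B S))"

definition tensor_snd ::
    "('o, 'a, 'c) bicat \<Rightarrow> ('o, 'a, 'c) choices \<Rightarrow> 'a \<Rightarrow> 'a \<Rightarrow> 'a" where
  "tensor_snd B K R S =
     radj K (r_arr K (Tgt B R) (Tgt B S)) \<odot>\<^bsub>B\<^esub> (S \<odot>\<^bsub>B\<^esub> r_arr K (Src B R) (Src B S))"

definition tensor_arr ::
    "('o, 'a, 'c) bicat \<Rightarrow> ('o, 'a, 'c) choices \<Rightarrow> 'a \<Rightarrow> 'a \<Rightarrow> 'a" where
  "tensor_arr B K R S = wedge K (tensor_fst B K R S) (tensor_snd B K R S)"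

definition tensor_cell ::
    "('o, 'a, 'c) bicat \<Rightarrow> ('o, 'a, 'c) choices \<Rightarrow> 'c \<Rightarrow> 'c \<Rightarrow> 'c" where
  "tensor_cell B K \<alpha> \<beta> =
    (let X = Src B (Cdom B \<alpha>); A = Tgt B (Cdom B \<alpha>);
         Y = Src B (Cdom B \<beta>); D = Tgt B (Cdom B \<beta>) in
     wedge_cell B K
       (lwhisker B (radj K (p_arr K A D)) (rwhisker B \<alpha> (p_arr K X Y)))
       (lwhisker B (radj K (r_arr K A D)) (rwhisker B \<beta> (r_arr K X Y))))"

text \<open>
  The codomain of the whiskered counit is \<open>1(Rp)\<close>, which equals \<open>Rp\<close> by normality.
\<close>

definition p_tilde ::
    "('o, 'a, 'c) bicat \<Rightarrow> ('o, 'a, 'c) choices \<Rightarrow> 'a \<Rightarrow> 'a \<Rightarrow> 'c" where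
  "p_tilde B K R S =
    (let p = p_arr K (Tgt B R) (Tgt B S); Rp = R \<odot>\<^bsub>B\<^esub> p_arr K (Src B R) (Src B S) in
     rwhisker B (rcounit K p) Rp \<cdot>\<^bsub>B\<^esub> AssocInv B p (radj K p) Rp
       \<cdot>\<^bsub>B\<^esub> lwhisker B p (wpi K (tensor_fst B K R S) (tensor_snd B K R S)))"

definition r_tilde ::
    "('o, 'a, 'c) bicat \<Rightarrow> ('o, 'a, 'c) choices \<Rightarrow> 'a \<Rightarrow> 'a \<Rightarrow> 'c" where
  "r_tilde B K R S =
    (let r = r_arr K (Tgt B R) (Tgt B S); Sr = S \<odot>\<^bsub>B\<^esub> r_arr K (Src B R) (Src B S) in
     rwhisker B (rcounit K r) Sr \<cdot>\<^bsub>B\<^esub> AssocInv B r (radj K r) Sr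
       \<cdot>\<^bsub>B\<^esub> lwhisker B r (wrho K (tensor_fst B K R S) (tensor_snd B K R S)))"

definition tensor_unit ::
    "('o, 'a, 'c) bicat \<Rightarrow> ('o, 'a, 'c) choices \<Rightarrow> 'o \<Rightarrow> 'o \<Rightarrow> 'c" where
  "tensor_unit B K X Y =
    (THE \<gamma>. \<gamma> \<in> Cells B (One B (Prod K X Y)) (tensor_arr B K (One B X) (One B Y)) \<and>
       p_tilde B K (One B X) (One B Y) \<cdot>\<^bsub>B\<^esub> lwhisker B (p_arr K X Y) \<gamma> = CellId B (p_arr K X Y) \<and>
       r_tilde B K (One B X) (One B Y) \<cdot>\<^bsub>B\<^esub> lwhisker B (r_arr K X Y) \<gamma> = CellId B (r_arr K X Y))"

text \<open>
  The associativity constraints make the composites below well-typed, e.g. the one for \<open>p\<close> is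
  \<open>p((T\<otimes>U)(R\<otimes>S)) \<cong> (p(T\<otimes>U))(R\<otimes>S) \<rightarrow> (Tp)(R\<otimes>S) \<cong> T(p(R\<otimes>S)) \<rightarrow> T(Rp) \<cong> (TR)p\<close>.
\<close>

definition tensor_comp ::
    "('o, 'a, 'c) bicat \<Rightarrow> ('o, 'a, 'c) choices \<Rightarrow> 'a \<Rightarrow> 'a \<Rightarrow> 'a \<Rightarrow> 'a \<Rightarrow> 'c" where
  "tensor_comp B K T U R S =
    (let X = Src B R; Y = Src B S; A = Src B T; D = Src B U; L = Tgt B T; M = Tgt B U;
         TU = tensor_arr B K T U; RS = tensor_arr B K R S;
         TR = T \<odot>\<^bsub>B\<^esub> R; US = U \<odot>\<^bsub>B\<^esub> S in
     THE \<gamma>. \<gamma> \<in> Cells B (TU \<odot>\<^bsub>B\<^esub> RS) (tensor_arr B K TR US) \<and>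
       p_tilde B K TR US \<cdot>\<^bsub>B\<^esub> lwhisker B (p_arr K L M) \<gamma> =
         AssocInv B T R (p_arr K X Y)
         \<cdot>\<^bsub>B\<^esub> lwhisker B T (p_tilde B K R S)
         \<cdot>\<^bsub>B\<^esub> Assoc B T (p_arr K A D) RS
         \<cdot>\<^bsub>B\<^esub> rwhisker B (p_tilde B K T U) RS
         \<cdot>\<^bsub>B\<^esub> AssocInv B (p_arr K L M) TU RS \<and>
       r_tilde B K TR US \<cdot>\<^bsub>B\<^esub> lwhisker B (r_arr K L M) \<gamma> =
         AssocInv B U S (r_arr K X Y)
         \<cdot>\<^bsub>B\<^esub> lwhisker B U (r_tilde B K R S)
         \<cdot>\<^bsub>B\<^esub> Assoc B U (r_arr K A D) RS
         \<cdot>\<^bsub>B\<^esub> rwhisker B (r_tilde B K T U) RS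
         \<cdot>\<^bsub>B\<^esub> AssocInv B (r_arr K L M) TU RS)"

definition tensor ::
    "('o, 'a, 'c) bicat \<Rightarrow> ('o, 'a, 'c) choices
      \<Rightarrow> ('o \<times> 'o, 'a \<times> 'a, 'c \<times> 'c, 'o, 'a, 'c) lax_data" where
  "tensor B K =
    \<lparr>on_obj = (\<lambda>(X, Y). Prod K X Y),
     on_arr = (\<lambda>(R, S). tensor_arr B K R S),
     on_cell = (\<lambda>(\<alpha>, \<beta>). tensor_cell B K \<alpha> \<beta>),
     lax_comp = (\<lambda>(T, U) (R, S). tensor_comp B K T U R S),
     lax_unit = (\<lambda>(X, Y). tensor_unit B K X Y)\<rparr>"

end

theory Submission
  imports Defs
begin

text \<open>
  A 2-cell \<open>\<gamma> : Q \<rightarrow> R\<otimes>S\<close> corresponds, by the universal property of \<open>\<and>\<close> and transposition along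
  \<open>p \<stileturn> p\<^sup>*\<close> and \<open>r \<stileturn> r\<^sup>*\<close>, to the pair of cells \<open>pQ \<rightarrow> Rp\<close>, \<open>rQ \<rightarrow> Sr\<close> obtained by composing
  \<open>p\<gamma>\<close> and \<open>r\<gamma>\<close> with the squares \<open>p~\<close> and \<open>r~\<close>. Under this correspondence the unit constraint
  becomes the identity square and the composition constraint becomes the pasting of squares. The
  lax functor axioms thus reduce to the facts that pasting of squares is natural, unital, and
  associative up to the associators of the bicategory.
\<close>

section \<open>Normal bicategories\<close>

text \<open>The associators of the bicategory stay explicit, and this shapes the argument. A pasting
  of squares begins and ends with an inverse associator, whereas the pentagon and naturality are
  given for associators themselves; the inverses are therefore cancelled or conjugated away before
  coherence is applied. Normality provides the triangle with a unit in the middle position; the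
  identities for a unit at either end, on which the unit laws of pasting rest, have to be derived
  from the pentagon. The arrows p and r play identical roles. Transposition is thus developed for an
  arbitrary adjunction and pasting for arbitrary arrows, and both are instantiated once with p and
  once with r. The two halves of the correspondence have different tasks: its surjectivity creates
  the constraints from prescribed squares, and its injectivity proves every equation between cells
  into a tensor product.\<close>

lemma Hom_hom_cat_iff:
  "\<alpha> \<in> Hom (hom_cat B X Y) R S \<longleftrightarrow>
     \<alpha> \<in> Cell B \<and> Cdom B \<alpha> = R \<and> Ccod B \<alpha> = S \<and> R \<in> Arrs B X Y \<and> S \<in> Arrs B X Y"
  by (auto simp: Hom_def hom_cat_def full_hom_def)

lemma hom_cat_simps [simp]:
  "Ob (hom_cat B X Y) = Arrs B X Y" "Dom (hom_cat B X Y) = Cdom B" "Cod (hom_cat B X Y) = Ccod B"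
  "Id (hom_cat B X Y) = CellId B" "Comp (hom_cat B X Y) = VComp B"
  by (auto simp: hom_cat_def full_hom_def)

lemma prod_cat_simps [simp]:
  "Ob (prod_cat C D) = Ob C \<times> Ob D"
  "Id (prod_cat C D) = map_prod (Id C) (Id D)"
  "Comp (prod_cat C D) (g, g') (f, f') = (g \<bullet>\<^bsub>C\<^esub> f, g' \<bullet>\<^bsub>D\<^esub> f')"
  by (auto simp: prod_cat_def)

lemma Hom_prod_cat_iff [simp]:
  "(f, f') \<in> Hom (prod_cat C D) (a, a') (b, b') \<longleftrightarrow> f \<in> Hom C a b \<and> f' \<in> Hom D a' b'"
  by (auto simp: Hom_def prod_cat_def)

text \<open>This makes the definite description in \<open>AssocInv\<close> meaningful: an invertible
  associator has exactly one inverse to pick.\<close>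

lemma (in category) inverses_unique:
  assumes "inverses C f g" "inverses C f h"
  shows "g = h"
proof -
  have f: "f \<in> Hom C (Dom C f) (Cod C f)" and g: "g \<in> Hom C (Cod C f) (Dom C f)"
    and h: "h \<in> Hom C (Cod C f) (Dom C f)"
    and gf: "g \<bullet> f = Id C (Dom C f)" and fh: "f \<bullet> h = Id C (Cod C f)"
    using assms by (auto simp: inverses_def)
  have "g = g \<bullet> (f \<bullet> h)"
    using Id_right[OF g] fh by simp
  also have "\<dots> = (g \<bullet> f) \<bullet> h"
    using Comp_assoc[OF h f g] by simp
  also have "\<dots> = h"
    using Id_left[OF h] gf by simp
  finally show ?thesis .
qed

section \<open>Boundaries and composition of 2-cells\<close>

context normal_bicategory
begin

lemma Arr_Src_in [simp]: "R \<in> Arr B \<Longrightarrow> Src B R \<in> Obj B"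
  and Arr_Tgt_in [simp]: "R \<in> Arr B \<Longrightarrow> Tgt B R \<in> Obj B"
  and Cell_Cdom_in [simp]: "\<alpha> \<in> Cell B \<Longrightarrow> Cdom B \<alpha> \<in> Arr B"
  and Cell_Ccod_in [simp]: "\<alpha> \<in> Cell B \<Longrightarrow> Ccod B \<alpha> \<in> Arr B"
  by (auto intro: Src_in Tgt_in Cdom_in Ccod_in)

text \<open>The orientation fixes a normal form for endpoints: those of a cell are always expressed
  through its domain arrow.\<close>

lemma Src_Ccod [simp]: "\<alpha> \<in> Cell B \<Longrightarrow> Src B (Ccod B \<alpha>) = Src B (Cdom B \<alpha>)"
  and Tgt_Ccod [simp]: "\<alpha> \<in> Cell B \<Longrightarrow> Tgt B (Ccod B \<alpha>) = Tgt B (Cdom B \<alpha>)"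
  by (simp_all add: Src_parallel Tgt_parallel)

lemma One_simps [simp]:
  assumes "X \<in> Obj B"
  shows "One B X \<in> Arr B" "Src B (One B X) = X" "Tgt B (One B X) = X"
  using One_in[OF assms] by (auto simp: Arrs_def)

text \<open>Every cell is placed in the hom-category of its own endpoints. The axioms, which speak
  of fixed objects X and Y, thereby become laws whose premises only compare boundaries of
  cells.\<close>

lemma Cell_Hom:
  assumes "\<alpha> \<in> Cell B"
  shows "\<alpha> \<in> Hom (hom_cat B (Src B (Cdom B \<alpha>)) (Tgt B (Cdom B \<alpha>))) (Cdom B \<alpha>) (Ccod B \<alpha>)"
  using assms by (auto simp: Hom_hom_cat_iff Arrs_def)

lemma CellId_simps [simp]:
  assumes "R \<in> Arr B"
  shows "CellId B R \<in> Cell B" "Cdom B (CellId B R) = R" "Ccod B (CellId B R) = R"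
proof -
  interpret category "hom_cat B (Src B R) (Tgt B R)"
    using assms by (simp add: hom_category)
  have "CellId B R \<in> Hom (hom_cat B (Src B R) (Tgt B R)) R R"
    using assms Id_in[of R] by (simp add: Arrs_def)
  then show "CellId B R \<in> Cell B" "Cdom B (CellId B R) = R" "Ccod B (CellId B R) = R"
    by (auto simp: Hom_hom_cat_iff)
qed

lemma VComp_simps [simp]:
  assumes "\<alpha> \<in> Cell B" "\<beta> \<in> Cell B" "Cdom B \<beta> = Ccod B \<alpha>"
  shows "\<beta> \<cdot> \<alpha> \<in> Cell B" "Cdom B (\<beta> \<cdot> \<alpha>) = Cdom B \<alpha>" "Ccod B (\<beta> \<cdot> \<alpha>) = Ccod B \<beta>"
proof -
  interpret category "hom_cat B (Src B (Cdom B \<alpha>)) (Tgt B (Cdom B \<alpha>))"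
    using assms by (simp add: hom_category)
  have "\<beta> \<cdot> \<alpha> \<in> Hom (hom_cat B (Src B (Cdom B \<alpha>)) (Tgt B (Cdom B \<alpha>))) (Cdom B \<alpha>) (Ccod B \<beta>)"
    using assms Comp_in[OF Cell_Hom[OF assms(1)], of \<beta>] Cell_Hom[OF assms(2)] by simp
  then show "\<beta> \<cdot> \<alpha> \<in> Cell B" "Cdom B (\<beta> \<cdot> \<alpha>) = Cdom B \<alpha>" "Ccod B (\<beta> \<cdot> \<alpha>) = Ccod B \<beta>"
    by (auto simp: Hom_hom_cat_iff)
qed

text \<open>The arrow R is a variable tied to the boundary by an equation, since by normality the
  same arrow occurs in several forms, such as R and 1R.\<close>

lemma VComp_CellId_left [simp]:
  assumes "\<alpha> \<in> Cell B" "R = Ccod B \<alpha>"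
  shows "CellId B R \<cdot> \<alpha> = \<alpha>"
proof -
  interpret category "hom_cat B (Src B (Cdom B \<alpha>)) (Tgt B (Cdom B \<alpha>))"
    using assms by (simp add: hom_category)
  show ?thesis
    using Id_left[OF Cell_Hom[OF assms(1)]] assms(2) by simp
qed

lemma VComp_CellId_right [simp]:
  assumes "\<alpha> \<in> Cell B" "R = Cdom B \<alpha>"
  shows "\<alpha> \<cdot> CellId B R = \<alpha>"
proof -
  interpret category "hom_cat B (Src B (Cdom B \<alpha>)) (Tgt B (Cdom B \<alpha>))"
    using assms by (simp add: hom_category)
  show ?thesis
    using Id_right[OF Cell_Hom[OF assms(1)]] assms(2) by simp
qed

lemma VComp_assoc:
  assumes "\<alpha> \<in> Cell B" "\<beta> \<in> Cell B" "\<gamma> \<in> Cell B" "Cdom B \<beta> = Ccod B \<alpha>" "Cdom B \<gamma> = Ccod B \<beta>"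
  shows "(\<gamma> \<cdot> \<beta>) \<cdot> \<alpha> = \<gamma> \<cdot> (\<beta> \<cdot> \<alpha>)"
proof -
  interpret category "hom_cat B (Src B (Cdom B \<alpha>)) (Tgt B (Cdom B \<alpha>))"
    using assms by (simp add: hom_category)
  show ?thesis
    using Comp_assoc[OF Cell_Hom[OF assms(1)], of \<beta> "Ccod B \<beta>" \<gamma> "Ccod B \<gamma>"]
      Cell_Hom[OF assms(2)] Cell_Hom[OF assms(3)] assms by simp
qed

lemma ArrComp_simps [simp]:
  assumes "R \<in> Arr B" "S \<in> Arr B" "Src B S = Tgt B R"
  shows "S \<odot> R \<in> Arr B" "Src B (S \<odot> R) = Src B R" "Tgt B (S \<odot> R) = Tgt B S"
proof -
  interpret cat_functor "prod_cat (hom_cat B (Tgt B R) (Tgt B S)) (hom_cat B (Src B R) (Tgt B R))"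
    "hom_cat B (Src B R) (Tgt B S)" "\<lambda>(S, R). S \<odot> R" "\<lambda>(\<beta>, \<alpha>). \<beta> \<star> \<alpha>"
    using assms by (simp add: comp_functor)
  show "S \<odot> R \<in> Arr B" "Src B (S \<odot> R) = Src B R" "Tgt B (S \<odot> R) = Tgt B S"
    using Fo_in[of "(S, R)"] assms by (auto simp: Arrs_def)
qed

lemma HComp_simps [simp]:
  assumes "\<alpha> \<in> Cell B" "\<beta> \<in> Cell B" "Src B (Cdom B \<beta>) = Tgt B (Cdom B \<alpha>)"
  shows "\<beta> \<star> \<alpha> \<in> Cell B" "Cdom B (\<beta> \<star> \<alpha>) = Cdom B \<beta> \<odot> Cdom B \<alpha>"
    "Ccod B (\<beta> \<star> \<alpha>) = Ccod B \<beta> \<odot> Ccod B \<alpha>"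
proof -
  let ?X = "Src B (Cdom B \<alpha>)" and ?Y = "Tgt B (Cdom B \<alpha>)" and ?Z = "Tgt B (Cdom B \<beta>)"
  interpret cat_functor "prod_cat (hom_cat B ?Y ?Z) (hom_cat B ?X ?Y)"
    "hom_cat B ?X ?Z" "\<lambda>(S, R). S \<odot> R" "\<lambda>(\<beta>, \<alpha>). \<beta> \<star> \<alpha>"
    using assms by (simp add: comp_functor)
  have "(\<beta>, \<alpha>) \<in> Hom (prod_cat (hom_cat B ?Y ?Z) (hom_cat B ?X ?Y))
      (Cdom B \<beta>, Cdom B \<alpha>) (Ccod B \<beta>, Ccod B \<alpha>)"
    using Cell_Hom[OF assms(1)] Cell_Hom[OF assms(2)] assms(3) by simp
  from Fm_in[OF this]
  show "\<beta> \<star> \<alpha> \<in> Cell B" "Cdom B (\<beta> \<star> \<alpha>) = Cdom B \<beta> \<odot> Cdom B \<alpha>"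
    "Ccod B (\<beta> \<star> \<alpha>) = Ccod B \<beta> \<odot> Ccod B \<alpha>"
    by (auto simp: Hom_hom_cat_iff)
qed

lemma HComp_CellId [simp]:
  assumes "R \<in> Arr B" "S \<in> Arr B" "Src B S = Tgt B R"
  shows "CellId B S \<star> CellId B R = CellId B (S \<odot> R)"
proof -
  interpret cat_functor "prod_cat (hom_cat B (Tgt B R) (Tgt B S)) (hom_cat B (Src B R) (Tgt B R))"
    "hom_cat B (Src B R) (Tgt B S)" "\<lambda>(S, R). S \<odot> R" "\<lambda>(\<beta>, \<alpha>). \<beta> \<star> \<alpha>"
    using assms by (simp add: comp_functor)
  show ?thesis
    using Fm_Id[of "(S, R)"] assms by (simp add: Arrs_def)
qed

lemma interchange:
  assumes "\<alpha> \<in> Cell B" "\<alpha>' \<in> Cell B" "\<beta> \<in> Cell B" "\<beta>' \<in> Cell B"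
    "Cdom B \<alpha>' = Ccod B \<alpha>" "Cdom B \<beta>' = Ccod B \<beta>" "Src B (Cdom B \<beta>) = Tgt B (Cdom B \<alpha>)"
  shows "(\<beta>' \<cdot> \<beta>) \<star> (\<alpha>' \<cdot> \<alpha>) = (\<beta>' \<star> \<alpha>') \<cdot> (\<beta> \<star> \<alpha>)"
proof -
  let ?X = "Src B (Cdom B \<alpha>)" and ?Y = "Tgt B (Cdom B \<alpha>)" and ?Z = "Tgt B (Cdom B \<beta>)"
  interpret cat_functor "prod_cat (hom_cat B ?Y ?Z) (hom_cat B ?X ?Y)"
    "hom_cat B ?X ?Z" "\<lambda>(S, R). S \<odot> R" "\<lambda>(\<beta>, \<alpha>). \<beta> \<star> \<alpha>"
    using assms by (simp add: comp_functor)
  have 1: "(\<beta>, \<alpha>) \<in> Hom (prod_cat (hom_cat B ?Y ?Z) (hom_cat B ?X ?Y))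
      (Cdom B \<beta>, Cdom B \<alpha>) (Ccod B \<beta>, Ccod B \<alpha>)"
    using Cell_Hom[OF assms(1)] Cell_Hom[OF assms(3)] assms(7) by simp
  have 2: "(\<beta>', \<alpha>') \<in> Hom (prod_cat (hom_cat B ?Y ?Z) (hom_cat B ?X ?Y))
      (Ccod B \<beta>, Ccod B \<alpha>) (Ccod B \<beta>', Ccod B \<alpha>')"
    using Cell_Hom[OF assms(2)] Cell_Hom[OF assms(4)] assms by simp
  show ?thesis
    using Fm_Comp[OF 1 2] by simp
qed

lemma lwhisker_VComp:
  assumes "R \<in> Arr B" "\<alpha> \<in> Cell B" "\<alpha>' \<in> Cell B" "Cdom B \<alpha>' = Ccod B \<alpha>"
    "Src B R = Tgt B (Cdom B \<alpha>)"
  shows "CellId B R \<star> (\<alpha>' \<cdot> \<alpha>) = (CellId B R \<star> \<alpha>') \<cdot> (CellId B R \<star> \<alpha>)"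
  using interchange[of \<alpha> \<alpha>' "CellId B R" "CellId B R"] assms by simp

lemma rwhisker_VComp:
  assumes "R \<in> Arr B" "\<alpha> \<in> Cell B" "\<alpha>' \<in> Cell B" "Cdom B \<alpha>' = Ccod B \<alpha>"
    "Src B (Cdom B \<alpha>) = Tgt B R"
  shows "(\<alpha>' \<cdot> \<alpha>) \<star> CellId B R = (\<alpha>' \<star> CellId B R) \<cdot> (\<alpha> \<star> CellId B R)"
  using interchange[of "CellId B R" "CellId B R" \<alpha> \<alpha>'] assms by simp

text \<open>Both sides are factorisations of \<open>\<beta> \<star> \<alpha>\<close>, obtained by
  interchange after inserting identities on either side.\<close>

lemma whisker_exchange:
  assumes "\<alpha> \<in> Cell B" "\<beta> \<in> Cell B" "Src B (Cdom B \<beta>) = Tgt B (Cdom B \<alpha>)"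
    "R = Cdom B \<alpha>" "R' = Ccod B \<alpha>" "S = Cdom B \<beta>" "S' = Ccod B \<beta>"
  shows "(\<beta> \<star> CellId B R') \<cdot> (CellId B S \<star> \<alpha>) = (CellId B S' \<star> \<alpha>) \<cdot> (\<beta> \<star> CellId B R)"
proof -
  have "(\<beta> \<star> CellId B R') \<cdot> (CellId B S \<star> \<alpha>) = \<beta> \<star> \<alpha>"
    using assms by (subst interchange[symmetric]) simp_all
  also have "\<dots> = (CellId B S' \<star> \<alpha>) \<cdot> (\<beta> \<star> CellId B R)"
    using assms by (subst interchange[symmetric]) simp_all
  finally show ?thesis .
qed

section \<open>Associators and their inverses\<close>

lemma Assoc_cell:
  assumes "R \<in> Arr B" "S \<in> Arr B" "T \<in> Arr B" "Src B T = Tgt B S" "Src B S = Tgt B R"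
  shows "Assoc B T S R \<in> Hom (hom_cat B (Src B R) (Tgt B T)) ((T \<odot> S) \<odot> R) (T \<odot> (S \<odot> R))"
    and "is_iso (hom_cat B (Src B R) (Tgt B T)) (Assoc B T S R)"
proof -
  interpret nat_iso "prod_cat (hom_cat B (Tgt B S) (Tgt B T))
      (prod_cat (hom_cat B (Tgt B R) (Tgt B S)) (hom_cat B (Src B R) (Tgt B R)))"
    "hom_cat B (Src B R) (Tgt B T)"
    "\<lambda>(T, S, R). (T \<odot> S) \<odot> R" "\<lambda>(\<gamma>, \<beta>, \<alpha>). (\<gamma> \<star> \<beta>) \<star> \<alpha>"
    "\<lambda>(T, S, R). T \<odot> (S \<odot> R)" "\<lambda>(\<gamma>, \<beta>, \<alpha>). \<gamma> \<star> (\<beta> \<star> \<alpha>)"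
    "\<lambda>(T, S, R). Assoc B T S R"
    using assms by (simp add: Assoc_nat_iso)
  show "Assoc B T S R \<in> Hom (hom_cat B (Src B R) (Tgt B T)) ((T \<odot> S) \<odot> R) (T \<odot> (S \<odot> R))"
    using component_in[of "(T, S, R)"] assms by (simp add: Arrs_def)
  show "is_iso (hom_cat B (Src B R) (Tgt B T)) (Assoc B T S R)"
    using component_iso[of "(T, S, R)"] assms by (simp add: Arrs_def)
qed

lemma Assoc_simps [simp]:
  assumes "R \<in> Arr B" "S \<in> Arr B" "T \<in> Arr B" "Src B T = Tgt B S" "Src B S = Tgt B R"
  shows "Assoc B T S R \<in> Cell B" "Cdom B (Assoc B T S R) = (T \<odot> S) \<odot> R"
    "Ccod B (Assoc B T S R) = T \<odot> (S \<odot> R)"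
  using Assoc_cell(1)[OF assms] unfolding Hom_hom_cat_iff by blast+

lemma Assoc_natural:
  assumes "\<alpha> \<in> Cell B" "\<beta> \<in> Cell B" "\<gamma> \<in> Cell B"
    "Src B (Cdom B \<gamma>) = Tgt B (Cdom B \<beta>)" "Src B (Cdom B \<beta>) = Tgt B (Cdom B \<alpha>)"
    "T = Cdom B \<gamma>" "T' = Ccod B \<gamma>" "S = Cdom B \<beta>" "S' = Ccod B \<beta>" "R = Cdom B \<alpha>" "R' = Ccod B \<alpha>"
  shows "Assoc B T' S' R' \<cdot> ((\<gamma> \<star> \<beta>) \<star> \<alpha>) = (\<gamma> \<star> (\<beta> \<star> \<alpha>)) \<cdot> Assoc B T S R"
proof -
  let ?X = "Src B (Cdom B \<alpha>)" and ?Y = "Tgt B (Cdom B \<alpha>)"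
    and ?Z = "Tgt B (Cdom B \<beta>)" and ?W = "Tgt B (Cdom B \<gamma>)"
  interpret nat_iso "prod_cat (hom_cat B ?Z ?W) (prod_cat (hom_cat B ?Y ?Z) (hom_cat B ?X ?Y))"
    "hom_cat B ?X ?W"
    "\<lambda>(T, S, R). (T \<odot> S) \<odot> R" "\<lambda>(\<gamma>, \<beta>, \<alpha>). (\<gamma> \<star> \<beta>) \<star> \<alpha>"
    "\<lambda>(T, S, R). T \<odot> (S \<odot> R)" "\<lambda>(\<gamma>, \<beta>, \<alpha>). \<gamma> \<star> (\<beta> \<star> \<alpha>)"
    "\<lambda>(T, S, R). Assoc B T S R"
    using assms(1-3) by (simp add: Assoc_nat_iso)
  have "(\<gamma>, \<beta>, \<alpha>) \<in> Hom (prod_cat (hom_cat B ?Z ?W)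
      (prod_cat (hom_cat B ?Y ?Z) (hom_cat B ?X ?Y)))
      (Cdom B \<gamma>, Cdom B \<beta>, Cdom B \<alpha>) (Ccod B \<gamma>, Ccod B \<beta>, Ccod B \<alpha>)"
    using assms(1-5) by (simp add: Hom_hom_cat_iff Arrs_def)
  from natural[OF this] show ?thesis
    using assms(6-11) by simp
qed

lemma AssocInv_inverses:
  assumes "R \<in> Arr B" "S \<in> Arr B" "T \<in> Arr B" "Src B T = Tgt B S" "Src B S = Tgt B R"
  shows "inverses (hom_cat B (Src B R) (Tgt B T)) (Assoc B T S R) (AssocInv B T S R)"
proof -
  interpret category "hom_cat B (Src B R) (Tgt B T)"
    using assms by (simp add: hom_category)
  show ?thesis
    using Assoc_cell(2)[OF assms] inverses_unique unfolding AssocInv_def is_iso_def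
    by (metis the_equality)
qed

lemma AssocInv_simps [simp]:
  assumes "R \<in> Arr B" "S \<in> Arr B" "T \<in> Arr B" "Src B T = Tgt B S" "Src B S = Tgt B R"
  shows "AssocInv B T S R \<in> Cell B" "Cdom B (AssocInv B T S R) = T \<odot> (S \<odot> R)"
    "Ccod B (AssocInv B T S R) = (T \<odot> S) \<odot> R"
    "AssocInv B T S R \<cdot> Assoc B T S R = CellId B ((T \<odot> S) \<odot> R)"
    "Assoc B T S R \<cdot> AssocInv B T S R = CellId B (T \<odot> (S \<odot> R))"
  using AssocInv_inverses[OF assms] assms by (auto simp: inverses_def Hom_hom_cat_iff)

text \<open>In a composite bracketed to the right, an associator and its inverse are never a
  composite by themselves but are followed by a tail \<open>\<alpha>\<close>; these are the inverse
  laws in that position.\<close>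

lemma AssocInv_cancel [simp]:
  assumes "R \<in> Arr B" "S \<in> Arr B" "T \<in> Arr B" "Src B T = Tgt B S" "Src B S = Tgt B R"
    "\<alpha> \<in> Cell B"
  shows "Ccod B \<alpha> = (T \<odot> S) \<odot> R \<Longrightarrow> AssocInv B T S R \<cdot> Assoc B T S R \<cdot> \<alpha> = \<alpha>"
    "Ccod B \<alpha> = T \<odot> (S \<odot> R) \<Longrightarrow> Assoc B T S R \<cdot> AssocInv B T S R \<cdot> \<alpha> = \<alpha>"
  using VComp_assoc[of \<alpha> "Assoc B T S R" "AssocInv B T S R"]
    VComp_assoc[of \<alpha> "AssocInv B T S R" "Assoc B T S R"] assms by simp_all

text \<open>Associators are invertible, hence monic. This is what turns the idempotence of an
  associator into an identity, and naturality of associators into naturality of their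
  inverses.\<close>

lemma Assoc_left_cancel:
  assumes "R \<in> Arr B" "S \<in> Arr B" "T \<in> Arr B" "Src B T = Tgt B S" "Src B S = Tgt B R"
    "\<alpha> \<in> Cell B" "\<beta> \<in> Cell B" "Ccod B \<alpha> = (T \<odot> S) \<odot> R" "Ccod B \<beta> = (T \<odot> S) \<odot> R"
    "Assoc B T S R \<cdot> \<alpha> = Assoc B T S R \<cdot> \<beta>"
  shows "\<alpha> = \<beta>"
  using AssocInv_cancel(1)[OF assms(1-6,8)] AssocInv_cancel(1)[OF assms(1-5,7,9)] assms(10) by metis

section \<open>Units and the coherence of associators with units\<close>

lemma ArrComp_One_simps [simp]:
  assumes "R \<in> Arr B"
  shows "Y = Tgt B R \<Longrightarrow> One B Y \<odot> R = R" "X = Src B R \<Longrightarrow> R \<odot> One B X = R"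
  using assms One_ArrComp[of R] ArrComp_One[of R] by (auto simp: Arrs_def)

lemma HComp_One_simps [simp]:
  assumes "\<alpha> \<in> Cell B"
  shows "Y = Tgt B (Cdom B \<alpha>) \<Longrightarrow> CellId B (One B Y) \<star> \<alpha> = \<alpha>"
    "X = Src B (Cdom B \<alpha>) \<Longrightarrow> \<alpha> \<star> CellId B (One B X) = \<alpha>"
  using assms One_HComp[of "Cdom B \<alpha>" _ _ \<alpha>] HComp_One[of "Cdom B \<alpha>" _ _ \<alpha>]
  by (auto simp: Arrs_def Cells_def)

lemma pentagon':
  assumes "R \<in> Arr B" "S \<in> Arr B" "T \<in> Arr B" "U \<in> Arr B"
    "Src B U = Tgt B T" "Src B T = Tgt B S" "Src B S = Tgt B R"
  shows "Assoc B U T (S \<odot> R) \<cdot> Assoc B (U \<odot> T) S R =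
      (CellId B U \<star> Assoc B T S R) \<cdot> Assoc B U (T \<odot> S) R \<cdot> (Assoc B U T S \<star> CellId B R)"
  using pentagon[of R "Src B R" "Src B S" S "Src B T" T "Src B U" U "Tgt B U"] assms
  by (simp add: Arrs_def)

lemma Assoc_One_middle [simp]:
  assumes "R \<in> Arr B" "S \<in> Arr B" "Src B S = Tgt B R" "Y = Tgt B R"
  shows "Assoc B S (One B Y) R = CellId B (S \<odot> R)"
  using Assoc_unit[of R "Src B R" Y S] assms by (simp add: Arrs_def)

text \<open>
  Both remaining unit coherences come from the pentagon with two adjacent units: the associator
  in question becomes idempotent, and it is invertible.
\<close>

lemma Assoc_One_left [simp]:
  assumes "R \<in> Arr B" "S \<in> Arr B" "Src B S = Tgt B R" "Y = Tgt B S"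
  shows "Assoc B (One B Y) S R = CellId B (S \<odot> R)"
proof -
  have "Assoc B (One B Y) S R \<cdot> CellId B (S \<odot> R)
      = Assoc B (One B Y) (One B Y) (S \<odot> R) \<cdot> Assoc B (One B Y \<odot> One B Y) S R"
    using assms by simp
  also have "\<dots> = Assoc B (One B Y) S R \<cdot> Assoc B (One B Y) S R"
    by (subst pentagon') (use assms in simp_all)
  finally have "Assoc B (One B Y) S R \<cdot> CellId B (S \<odot> R)
      = Assoc B (One B Y) S R \<cdot> Assoc B (One B Y) S R" .
  then have "CellId B (S \<odot> R) = Assoc B (One B Y) S R"
    using assms by (intro Assoc_left_cancel[of R S "One B Y" "CellId B (S \<odot> R)" "Assoc B (One B Y) S R"]) simp_all
  then show ?thesis ..
qed

lemma Assoc_One_right [simp]: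
  assumes "R \<in> Arr B" "S \<in> Arr B" "Src B S = Tgt B R" "X = Src B R"
  shows "Assoc B S R (One B X) = CellId B (S \<odot> R)"
proof -
  have "Assoc B S R (One B X) \<cdot> CellId B (S \<odot> R)
      = Assoc B S R (One B X \<odot> One B X) \<cdot> Assoc B (S \<odot> R) (One B X) (One B X)"
    using assms by simp
  also have "\<dots> = Assoc B S R (One B X) \<cdot> Assoc B S R (One B X)"
    by (subst pentagon') (use assms in simp_all)
  finally have "Assoc B S R (One B X) \<cdot> CellId B (S \<odot> R)
      = Assoc B S R (One B X) \<cdot> Assoc B S R (One B X)" .
  then have "CellId B (S \<odot> R) = Assoc B S R (One B X)"
    using assms by (intro Assoc_left_cancel[of "One B X" R S "CellId B (S \<odot> R)" "Assoc B S R (One B X)"]) simp_all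
  then show ?thesis ..
qed

lemma AssocInv_One [simp]:
  assumes "R \<in> Arr B" "S \<in> Arr B" "Src B S = Tgt B R"
  shows "Y = Tgt B R \<Longrightarrow> AssocInv B S (One B Y) R = CellId B (S \<odot> R)"
    "Y = Tgt B S \<Longrightarrow> AssocInv B (One B Y) S R = CellId B (S \<odot> R)"
    "Y = Src B R \<Longrightarrow> AssocInv B S R (One B Y) = CellId B (S \<odot> R)"
proof -
  have *: "AssocInv B T S R = CellId B (T \<odot> (S \<odot> R))"
    if "R \<in> Arr B" "S \<in> Arr B" "T \<in> Arr B" "Src B T = Tgt B S" "Src B S = Tgt B R"
      "Assoc B T S R = CellId B (T \<odot> (S \<odot> R))" for R S T
  proof -
    have "CellId B (T \<odot> (S \<odot> R)) \<cdot> AssocInv B T S R = CellId B (T \<odot> (S \<odot> R))"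
      using that AssocInv_simps(5)[of R S T] by metis
    \<comment> \<open>The inverse lands in \<open>(T \<odot> S) \<odot> R\<close>. An associator
      that is an identity cell has equal domain and codomain, so the two bracketings coincide and
      the unit law applies.\<close>
    moreover have "CellId B (T \<odot> (S \<odot> R)) \<cdot> AssocInv B T S R = AssocInv B T S R"
      using that Assoc_simps(2,3)[of R S T] by (intro VComp_CellId_left) auto
    ultimately show ?thesis by simp
  qed
  show "Y = Tgt B R \<Longrightarrow> AssocInv B S (One B Y) R = CellId B (S \<odot> R)"
    using assms by (subst *) simp_all
  show "Y = Tgt B S \<Longrightarrow> AssocInv B (One B Y) S R = CellId B (S \<odot> R)"
    using assms by (subst *) simp_all
  show "Y = Src B R \<Longrightarrow> AssocInv B S R (One B Y) = CellId B (S \<odot> R)"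
    using assms by (subst *) simp_all
qed

text \<open>After composing with the associator at the primed arrows, which is monic, the claim
  becomes naturality of the associator itself.\<close>

lemma AssocInv_natural:
  assumes "\<alpha> \<in> Cell B" "\<beta> \<in> Cell B" "\<gamma> \<in> Cell B"
    "Src B (Cdom B \<gamma>) = Tgt B (Cdom B \<beta>)" "Src B (Cdom B \<beta>) = Tgt B (Cdom B \<alpha>)"
    "T = Cdom B \<gamma>" "T' = Ccod B \<gamma>" "S = Cdom B \<beta>" "S' = Ccod B \<beta>" "R = Cdom B \<alpha>" "R' = Ccod B \<alpha>"
  shows "AssocInv B T' S' R' \<cdot> (\<gamma> \<star> (\<beta> \<star> \<alpha>)) = ((\<gamma> \<star> \<beta>) \<star> \<alpha>) \<cdot> AssocInv B T S R"
proof (rule Assoc_left_cancel[of R' S' T'])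
  \<comment> \<open>Naturality brings the right-hand side of the goal to this composite, in which
    the associator meets its inverse.\<close>
  have "(\<gamma> \<star> \<beta> \<star> \<alpha>) \<cdot> Assoc B T S R \<cdot> AssocInv B T S R = \<gamma> \<star> \<beta> \<star> \<alpha>"
    unfolding assms(6-11) using assms(1-5) by simp
  then show "Assoc B T' S' R' \<cdot> AssocInv B T' S' R' \<cdot> (\<gamma> \<star> \<beta> \<star> \<alpha>) =
      Assoc B T' S' R' \<cdot> ((\<gamma> \<star> \<beta>) \<star> \<alpha>) \<cdot> AssocInv B T S R"
    unfolding assms(6-11) using assms(1-5)
    by (simp add: VComp_assoc[symmetric] Assoc_natural del: AssocInv_simps(4,5))
      (simp add: VComp_assoc)
qed (unfold assms(6-11), use assms(1-5) in simp_all)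

text \<open>The separate conclusions serve as typing facts: later proofs declare them for all arrows
  in play, which settles the side conditions on sources and targets.\<close>

lemma ArrsD:
  assumes "R \<in> Arrs B X Y"
  shows "R \<in> Arr B" "Src B R = X" "Tgt B R = Y" "X \<in> Obj B" "Y \<in> Obj B"
  using assms by (auto simp: Arrs_def)

lemma CellsD:
  assumes "\<alpha> \<in> Cells B R S"
  shows "\<alpha> \<in> Cell B" "Cdom B \<alpha> = R" "Ccod B \<alpha> = S"
  using assms by (auto simp: Cells_def)

end

section \<open>Transposition along an adjunction\<close>

text \<open>For \<open>\<gamma>\<close> from Q to gZ this is the composite of fQ -> f(gZ), the
  rebracketing to (fg)Z, and the counit to Z. The cells \<open>p_tilde\<close> and
  \<open>r_tilde\<close> are defined by exactly this formula applied to the two product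
  projections.\<close>

definition adj_transpose ::
    "('o, 'a, 'c) bicat \<Rightarrow> 'a \<Rightarrow> 'a \<Rightarrow> 'c \<Rightarrow> 'a \<Rightarrow> 'c \<Rightarrow> 'c" where
  "adj_transpose B f g \<epsilon> Z \<gamma> =
     rwhisker B \<epsilon> Z \<cdot>\<^bsub>B\<^esub> AssocInv B f g Z \<cdot>\<^bsub>B\<^esub> lwhisker B f \<gamma>"

locale adjoint_pair = normal_bicategory +
  fixes f g \<eta> \<epsilon> X Y
  assumes f: "f \<in> Arrs B X Y" and adj: "adjunction B f g \<eta> \<epsilon>"
begin

lemma adj_simps [simp]:
  "f \<in> Arr B" "Src B f = X" "Tgt B f = Y" "g \<in> Arr B" "Src B g = Y" "Tgt B g = X"
  "X \<in> Obj B" "Y \<in> Obj B"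
  "\<eta> \<in> Cell B" "Cdom B \<eta> = One B X" "Ccod B \<eta> = g \<odot> f"
  "\<epsilon> \<in> Cell B" "Cdom B \<epsilon> = f \<odot> g" "Ccod B \<epsilon> = One B Y"
  using adj ArrsD[OF f] by (auto simp: adjunction_def Arrs_def Cells_def)

lemma triangle_f: "(\<epsilon> \<star> CellId B f) \<cdot> AssocInv B f g f \<cdot> (CellId B f \<star> \<eta>) = CellId B f"
  and triangle_g: "(CellId B g \<star> \<epsilon>) \<cdot> Assoc B g f g \<cdot> (\<eta> \<star> CellId B g) = CellId B g"
  using adj by (auto simp: adjunction_def)

text \<open>The triangle identity for g is whiskered with Z. Naturality of the associator frees
  \<open>\<epsilon>\<close> and \<open>\<eta>\<close> from the outer bracket, and the pentagon
  replaces the whiskered associator of g, f, g by associators that treat gZ and fg as single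
  arrows.\<close>

lemma triangle_g_whiskered:
  assumes [simp]: "Z \<in> Arr B" "Tgt B Z = Y"
  shows "(CellId B g \<star> (\<epsilon> \<star> CellId B Z)) \<cdot> (CellId B g \<star> AssocInv B f g Z)
    \<cdot> Assoc B g f (g \<odot> Z) \<cdot> (\<eta> \<star> CellId B (g \<odot> Z)) = CellId B (g \<odot> Z)"
proof -
  have t: "((CellId B g \<star> \<epsilon>) \<star> CellId B Z) \<cdot> (Assoc B g f g \<star> CellId B Z)
      \<cdot> ((\<eta> \<star> CellId B g) \<star> CellId B Z) = CellId B (g \<odot> Z)"
    using arg_cong[OF triangle_g, of "\<lambda>x. x \<star> CellId B Z"] by (simp add: rwhisker_VComp)
  have n1: "(CellId B g \<star> \<epsilon>) \<star> CellId B Z = (CellId B g \<star> (\<epsilon> \<star> CellId B Z)) \<cdot> Assoc B g (f \<odot> g) Z"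
    using Assoc_natural[of "CellId B Z" \<epsilon> "CellId B g"] by simp
  have n2: "Assoc B (g \<odot> f) g Z \<cdot> ((\<eta> \<star> CellId B g) \<star> CellId B Z) = \<eta> \<star> CellId B (g \<odot> Z)"
    using Assoc_natural[of "CellId B Z" "CellId B g" \<eta>] by simp
  have inv: "(CellId B g \<star> AssocInv B f g Z) \<cdot> (CellId B g \<star> Assoc B f g Z)
      = CellId B (g \<odot> (f \<odot> g) \<odot> Z)"
    by (simp flip: lwhisker_VComp)
  \<comment> \<open>\<open>n2\<close> splits off one more associator, so that the two now meeting
    form the short side of the pentagon for g, f, g, Z.\<close>
  have "Assoc B g f (g \<odot> Z) \<cdot> (\<eta> \<star> CellId B (g \<odot> Z))
      = (Assoc B g f (g \<odot> Z) \<cdot> Assoc B (g \<odot> f) g Z) \<cdot> ((\<eta> \<star> CellId B g) \<star> CellId B Z)"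
    by (simp add: VComp_assoc n2)
  also have "\<dots> = (CellId B g \<star> Assoc B f g Z) \<cdot> Assoc B g (f \<odot> g) Z
      \<cdot> (Assoc B g f g \<star> CellId B Z) \<cdot> ((\<eta> \<star> CellId B g) \<star> CellId B Z)"
    by (subst pentagon') (simp_all add: VComp_assoc)
  finally have "(CellId B g \<star> AssocInv B f g Z) \<cdot> Assoc B g f (g \<odot> Z) \<cdot> (\<eta> \<star> CellId B (g \<odot> Z))
      = ((CellId B g \<star> AssocInv B f g Z) \<cdot> (CellId B g \<star> Assoc B f g Z)) \<cdot> Assoc B g (f \<odot> g) Z
      \<cdot> (Assoc B g f g \<star> CellId B Z) \<cdot> ((\<eta> \<star> CellId B g) \<star> CellId B Z)"
    by (simp add: VComp_assoc)
  then have "(CellId B g \<star> AssocInv B f g Z) \<cdot> Assoc B g f (g \<odot> Z) \<cdot> (\<eta> \<star> CellId B (g \<odot> Z))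
      = Assoc B g (f \<odot> g) Z
      \<cdot> (Assoc B g f g \<star> CellId B Z) \<cdot> ((\<eta> \<star> CellId B g) \<star> CellId B Z)"
    unfolding inv by simp
  then show ?thesis
    using t unfolding n1 by (simp add: VComp_assoc)
qed

text \<open>The counterpart for f, whiskered with Q. This triangle contains an inverse associator,
  so the pentagon has to be solved for inverses before it fits.\<close>

lemma triangle_f_whiskered:
  assumes [simp]: "Q \<in> Arr B" "Tgt B Q = X"
  shows "(\<epsilon> \<star> CellId B (f \<odot> Q)) \<cdot> AssocInv B f g (f \<odot> Q) \<cdot> (CellId B f \<star> Assoc B g f Q)
    \<cdot> (CellId B f \<star> (\<eta> \<star> CellId B Q)) = CellId B (f \<odot> Q)"
proof -
  have t: "((\<epsilon> \<star> CellId B f) \<star> CellId B Q) \<cdot> (AssocInv B f g f \<star> CellId B Q)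
      \<cdot> ((CellId B f \<star> \<eta>) \<star> CellId B Q) = CellId B (f \<odot> Q)"
    using arg_cong[OF triangle_f, of "\<lambda>x. x \<star> CellId B Q"] by (simp add: rwhisker_VComp)
  have n1: "(\<epsilon> \<star> CellId B f) \<star> CellId B Q = (\<epsilon> \<star> CellId B (f \<odot> Q)) \<cdot> Assoc B (f \<odot> g) f Q"
    using Assoc_natural[of "CellId B Q" "CellId B f" \<epsilon>] by simp
  have n2: "Assoc B f (g \<odot> f) Q \<cdot> ((CellId B f \<star> \<eta>) \<star> CellId B Q) = CellId B f \<star> (\<eta> \<star> CellId B Q)"
    using Assoc_natural[of "CellId B Q" \<eta> "CellId B f"] by simp
  have inv: "(Assoc B f g f \<star> CellId B Q) \<cdot> (AssocInv B f g f \<star> CellId B Q)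
      = CellId B ((f \<odot> g \<odot> f) \<odot> Q)"
    by (simp flip: rwhisker_VComp)
  \<comment> \<open>The pentagon for f, g, f, Q is composed on the right with the inverse of its
    last factor; afterwards the first associator is moved to the other side as
    \<open>AssocInv B f g (f \<odot> Q)\<close>.\<close>
  have "Assoc B f g (f \<odot> Q) \<cdot> Assoc B (f \<odot> g) f Q \<cdot> (AssocInv B f g f \<star> CellId B Q)
      = (Assoc B f g (f \<odot> Q) \<cdot> Assoc B (f \<odot> g) f Q) \<cdot> (AssocInv B f g f \<star> CellId B Q)"
    by (simp add: VComp_assoc)
  also have "\<dots> = (CellId B f \<star> Assoc B g f Q) \<cdot> Assoc B f (g \<odot> f) Q
      \<cdot> (Assoc B f g f \<star> CellId B Q) \<cdot> (AssocInv B f g f \<star> CellId B Q)"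
    by (subst pentagon') (simp_all add: VComp_assoc)
  finally have "Assoc B f g (f \<odot> Q) \<cdot> Assoc B (f \<odot> g) f Q \<cdot> (AssocInv B f g f \<star> CellId B Q)
      = (CellId B f \<star> Assoc B g f Q) \<cdot> Assoc B f (g \<odot> f) Q"
    unfolding inv by simp
  then have "AssocInv B f g (f \<odot> Q) \<cdot> (CellId B f \<star> Assoc B g f Q) \<cdot> Assoc B f (g \<odot> f) Q
      = Assoc B (f \<odot> g) f Q \<cdot> (AssocInv B f g f \<star> CellId B Q)"
    by (simp flip: \<open>_ = (CellId B f \<star> Assoc B g f Q) \<cdot> Assoc B f (g \<odot> f) Q\<close>)
  from arg_cong[OF this, of "\<lambda>x. x \<cdot> ((CellId B f \<star> \<eta>) \<star> CellId B Q)"]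
  have "AssocInv B f g (f \<odot> Q) \<cdot> (CellId B f \<star> Assoc B g f Q) \<cdot> (CellId B f \<star> (\<eta> \<star> CellId B Q))
      = Assoc B (f \<odot> g) f Q \<cdot> (AssocInv B f g f \<star> CellId B Q) \<cdot> ((CellId B f \<star> \<eta>) \<star> CellId B Q)"
    by (simp add: VComp_assoc n2)
  then show ?thesis
    using t unfolding n1 by (simp add: VComp_assoc)
qed

section \<open>Transposition as a natural bijection\<close>

lemma transpose_simps [simp]:
  assumes "Z \<in> Arr B" "Tgt B Z = Y" "\<gamma> \<in> Cell B" "Ccod B \<gamma> = g \<odot> Z"
    "Tgt B (Cdom B \<gamma>) = X"
  shows "adj_transpose B f g \<epsilon> Z \<gamma> \<in> Cell B" "Cdom B (adj_transpose B f g \<epsilon> Z \<gamma>) = f \<odot> Cdom B \<gamma>"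
    "Ccod B (adj_transpose B f g \<epsilon> Z \<gamma>) = Z"
  using assms by (simp_all add: adj_transpose_def)

text \<open>Naturality in the domain. It is the reason why whiskering \<open>\<gamma>\<close> with p
  and composing with \<open>p_tilde\<close> amounts to transposing the first component of
  \<open>\<gamma>\<close>.\<close>

lemma transpose_VComp:
  assumes "Z \<in> Arr B" "Tgt B Z = Y" "\<gamma> \<in> Cell B" "Ccod B \<gamma> = g \<odot> Z"
    "Tgt B (Cdom B \<gamma>) = X" "\<delta> \<in> Cell B" "Ccod B \<delta> = Cdom B \<gamma>" "Tgt B (Cdom B \<delta>) = X"
  shows "adj_transpose B f g \<epsilon> Z (\<gamma> \<cdot> \<delta>) = adj_transpose B f g \<epsilon> Z \<gamma> \<cdot> (CellId B f \<star> \<delta>)"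
  using assms by (simp add: adj_transpose_def lwhisker_VComp VComp_assoc)

text \<open>Naturality in Z: the inverse associator carries \<open>\<zeta>\<close> out of the
  bracket, and interchange carries it past the counit. Whiskering by g on the untransposed side thus
  becomes plain composition.\<close>

lemma transpose_natural:
  assumes [simp]: "\<zeta> \<in> Cell B" "Tgt B (Cdom B \<zeta>) = Y" "\<gamma> \<in> Cell B"
    "Ccod B \<gamma> = g \<odot> Cdom B \<zeta>" "Tgt B (Cdom B \<gamma>) = X"
  shows "adj_transpose B f g \<epsilon> (Ccod B \<zeta>) ((CellId B g \<star> \<zeta>) \<cdot> \<gamma>)
    = \<zeta> \<cdot> adj_transpose B f g \<epsilon> (Cdom B \<zeta>) \<gamma>"
proof -
  have "AssocInv B f g (Ccod B \<zeta>) \<cdot> (CellId B f \<star> CellId B g \<star> \<zeta>) \<cdot> (CellId B f \<star> \<gamma>)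
     = (AssocInv B f g (Ccod B \<zeta>) \<cdot> (CellId B f \<star> CellId B g \<star> \<zeta>)) \<cdot> (CellId B f \<star> \<gamma>)"
    by (simp add: VComp_assoc)
  also have "\<dots> = (CellId B (f \<odot> g) \<star> \<zeta>) \<cdot> AssocInv B f g (Cdom B \<zeta>) \<cdot> (CellId B f \<star> \<gamma>)"
    by (subst AssocInv_natural[of \<zeta> "CellId B g" "CellId B f" f f g g "Cdom B \<zeta>"])
      (simp_all add: VComp_assoc)
  finally have "adj_transpose B f g \<epsilon> (Ccod B \<zeta>) ((CellId B g \<star> \<zeta>) \<cdot> \<gamma>)
      = ((\<epsilon> \<star> CellId B (Ccod B \<zeta>)) \<cdot> (CellId B (f \<odot> g) \<star> \<zeta>))
        \<cdot> AssocInv B f g (Cdom B \<zeta>) \<cdot> (CellId B f \<star> \<gamma>)"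
    by (simp add: adj_transpose_def lwhisker_VComp VComp_assoc)
  \<comment> \<open>The counit ends at a unit arrow, and whiskering \<open>\<zeta>\<close> with a
    unit returns \<open>\<zeta>\<close> itself.\<close>
  also have "(\<epsilon> \<star> CellId B (Ccod B \<zeta>)) \<cdot> (CellId B (f \<odot> g) \<star> \<zeta>) = \<zeta> \<cdot> (\<epsilon> \<star> CellId B (Cdom B \<zeta>))"
    by (subst whisker_exchange[of \<zeta> \<epsilon> "Cdom B \<zeta>" _ _ "One B Y"]) simp_all
  finally show ?thesis
    by (simp add: adj_transpose_def VComp_assoc)
qed

text \<open>Naturality of the associator and interchange with \<open>\<eta>\<close> move
  \<open>\<gamma>\<close> to the far right; the composite left in front of it is the whiskered
  triangle for g.\<close>

lemma transpose_retraction: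
  assumes [simp]: "Z \<in> Arr B" "Tgt B Z = Y" "\<gamma> \<in> Cell B" "Ccod B \<gamma> = g \<odot> Z"
    "Cdom B \<gamma> = Q" "Q \<in> Arr B" "Tgt B Q = X"
  shows "(CellId B g \<star> adj_transpose B f g \<epsilon> Z \<gamma>) \<cdot> Assoc B g f Q \<cdot> (\<eta> \<star> CellId B Q) = \<gamma>"
proof -
  have "(CellId B g \<star> (CellId B f \<star> \<gamma>)) \<cdot> Assoc B g f Q = Assoc B g f (g \<odot> Z) \<cdot> (CellId B (g \<odot> f) \<star> \<gamma>)"
    by (subst Assoc_natural[of \<gamma> "CellId B f" "CellId B g" g g f f Q "g \<odot> Z", symmetric]) simp_all
  from arg_cong[OF this, of "\<lambda>x. x \<cdot> (\<eta> \<star> CellId B Q)"]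
  have "(CellId B g \<star> (CellId B f \<star> \<gamma>)) \<cdot> Assoc B g f Q \<cdot> (\<eta> \<star> CellId B Q)
      = Assoc B g f (g \<odot> Z) \<cdot> (CellId B (g \<odot> f) \<star> \<gamma>) \<cdot> (\<eta> \<star> CellId B Q)"
    by (simp add: VComp_assoc)
  also have "(CellId B (g \<odot> f) \<star> \<gamma>) \<cdot> (\<eta> \<star> CellId B Q) = (\<eta> \<star> CellId B (g \<odot> Z)) \<cdot> \<gamma>"
    by (subst whisker_exchange[of \<gamma> \<eta> Q "g \<odot> Z" "One B X" "g \<odot> f", symmetric]) simp_all
  finally have "(CellId B g \<star> adj_transpose B f g \<epsilon> Z \<gamma>) \<cdot> Assoc B g f Q \<cdot> (\<eta> \<star> CellId B Q)
     = ((CellId B g \<star> (\<epsilon> \<star> CellId B Z)) \<cdot> (CellId B g \<star> AssocInv B f g Z)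
    \<cdot> Assoc B g f (g \<odot> Z) \<cdot> (\<eta> \<star> CellId B (g \<odot> Z))) \<cdot> \<gamma>"
    by (simp add: adj_transpose_def lwhisker_VComp VComp_assoc)
  also have "\<dots> = \<gamma>"
    by (subst triangle_g_whiskered) simp_all
  finally show ?thesis .
qed

text \<open>By naturality in the codomain it is enough to transpose the whiskered unit at Q, and
  that gives an identity by the whiskered triangle for f.\<close>

lemma transpose_section:
  assumes [simp]: "\<delta> \<in> Cell B" "Cdom B \<delta> = f \<odot> Q" "Q \<in> Arr B" "Tgt B Q = X"
  shows "adj_transpose B f g \<epsilon> (Ccod B \<delta>) ((CellId B g \<star> \<delta>) \<cdot> Assoc B g f Q \<cdot> (\<eta> \<star> CellId B Q)) = \<delta>"
proof -
  have "adj_transpose B f g \<epsilon> (f \<odot> Q) (Assoc B g f Q \<cdot> (\<eta> \<star> CellId B Q)) = CellId B (f \<odot> Q)"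
    using triangle_f_whiskered[of Q] by (simp add: adj_transpose_def lwhisker_VComp)
  then show ?thesis
    using transpose_natural[of \<delta> "Assoc B g f Q \<cdot> (\<eta> \<star> CellId B Q)"] by simp
qed

lemma transpose_bij:
  assumes Z: "Z \<in> Arrs B V Y" and Q: "Q \<in> Arrs B V X"
  shows "bij_betw (adj_transpose B f g \<epsilon> Z) (Cells B Q (g \<odot> Z)) (Cells B (f \<odot> Q) Z)"
proof (rule bij_betw_byWitness[where f' =
      "\<lambda>\<delta>. (CellId B g \<star> \<delta>) \<cdot> Assoc B g f Q \<cdot> (\<eta> \<star> CellId B Q)"])
  show "\<forall>\<gamma>\<in>Cells B Q (g \<odot> Z).
      (CellId B g \<star> adj_transpose B f g \<epsilon> Z \<gamma>) \<cdot> Assoc B g f Q \<cdot> (\<eta> \<star> CellId B Q) = \<gamma>"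
    using ArrsD[OF Z] ArrsD[OF Q] by (auto simp: Cells_def intro!: transpose_retraction)
  show "\<forall>\<delta>\<in>Cells B (f \<odot> Q) Z.
      adj_transpose B f g \<epsilon> Z ((CellId B g \<star> \<delta>) \<cdot> Assoc B g f Q \<cdot> (\<eta> \<star> CellId B Q)) = \<delta>"
    using ArrsD[OF Q] transpose_section by (auto simp: Cells_def)
qed (use ArrsD[OF Z] ArrsD[OF Q] in \<open>auto simp: Cells_def\<close>)

end

section \<open>Pasting of squares\<close>

text \<open>
  The pasting of \<open>x : qR' \<rightarrow> Rp\<close> and \<open>y : rS' \<rightarrow> Sq\<close> to a cell \<open>r(S'R') \<rightarrow> (SR)p\<close>.
\<close>

definition paste ::
    "('o, 'a, 'c) bicat \<Rightarrow> 'a \<Rightarrow> 'a \<Rightarrow> 'a \<Rightarrow> 'a \<Rightarrow> 'a \<Rightarrow> 'a \<Rightarrow> 'a \<Rightarrow> 'c \<Rightarrow> 'c \<Rightarrow> 'c" where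
  "paste B p q r R' R S' S y x =
     AssocInv B S R p \<cdot>\<^bsub>B\<^esub> lwhisker B S x \<cdot>\<^bsub>B\<^esub> Assoc B S q R'
       \<cdot>\<^bsub>B\<^esub> rwhisker B y R' \<cdot>\<^bsub>B\<^esub> AssocInv B r S' R'"

context normal_bicategory
begin

lemma paste_in:
  assumes "p \<in> Arrs B X' X" "q \<in> Arrs B Y' Y" "r \<in> Arrs B Z' Z"
    "R' \<in> Arrs B X' Y'" "R \<in> Arrs B X Y" "S' \<in> Arrs B Y' Z'" "S \<in> Arrs B Y Z"
    "x \<in> Cells B (q \<odot> R') (R \<odot> p)" "y \<in> Cells B (r \<odot> S') (S \<odot> q)"
  shows "paste B p q r R' R S' S y x \<in> Cells B (r \<odot> (S' \<odot> R')) ((S \<odot> R) \<odot> p)"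
proof -
  note [simp] = assms(1-7)[THEN ArrsD(1)] assms(1-7)[THEN ArrsD(2)] assms(1-7)[THEN ArrsD(3)]
    assms(8,9)[THEN CellsD(1)] assms(8,9)[THEN CellsD(2)] assms(8,9)[THEN CellsD(3)]
  show ?thesis
    by (simp add: Cells_def paste_def)
qed

text \<open>Each of the three associators in the pasting has a unit among its arguments and is an
  identity; what remains is x whiskered with a unit.\<close>

lemma paste_unit_left:
  assumes "p \<in> Arrs B X' X" "q \<in> Arrs B Y' Y" "R' \<in> Arrs B X' Y'" "R \<in> Arrs B X Y"
    "x \<in> Cells B (q \<odot> R') (R \<odot> p)"
  shows "paste B p q q R' R (One B Y') (One B Y) (CellId B q) x = x"
proof -
  note [simp] = assms(1-4)[THEN ArrsD(1)] assms(1-4)[THEN ArrsD(2)] assms(1-4)[THEN ArrsD(3)]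
    assms(1-4)[THEN ArrsD(4)] assms(1-4)[THEN ArrsD(5)]
    assms(5)[THEN CellsD(1)] assms(5)[THEN CellsD(2)] assms(5)[THEN CellsD(3)]
  show ?thesis
    by (simp add: paste_def)
qed

lemma paste_unit_right:
  assumes "p \<in> Arrs B X' X" "r \<in> Arrs B Z' Z" "S' \<in> Arrs B X' Z'" "S \<in> Arrs B X Z"
    "y \<in> Cells B (r \<odot> S') (S \<odot> p)"
  shows "paste B p p r (One B X') (One B X) S' S y (CellId B p) = y"
proof -
  note [simp] = assms(1-4)[THEN ArrsD(1)] assms(1-4)[THEN ArrsD(2)] assms(1-4)[THEN ArrsD(3)]
    assms(1-4)[THEN ArrsD(4)] assms(1-4)[THEN ArrsD(5)]
    assms(5)[THEN CellsD(1)] assms(5)[THEN CellsD(2)] assms(5)[THEN CellsD(3)]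
  show ?thesis
    by (simp add: paste_def)
qed

text \<open>Pasting is natural in the arrows on the domain side. The cell \<open>\<psi>\<close>
  meets y directly, whereas \<open>\<phi>\<close> has to cross y by interchange and then the middle
  associator before it reaches x.\<close>

lemma paste_precomp:
  assumes "p \<in> Arrs B X' X" "q \<in> Arrs B Y' Y" "r \<in> Arrs B Z' Z"
    "R' \<in> Arrs B X' Y'" "R \<in> Arrs B X Y" "S' \<in> Arrs B Y' Z'" "S \<in> Arrs B Y Z"
    "R'' \<in> Arrs B X' Y'" "S'' \<in> Arrs B Y' Z'"
    "x \<in> Cells B (q \<odot> R') (R \<odot> p)" "y \<in> Cells B (r \<odot> S') (S \<odot> q)"
    "\<phi> \<in> Cells B R'' R'" "\<psi> \<in> Cells B S'' S'"
  shows "paste B p q r R' R S' S y x \<cdot> (CellId B r \<star> (\<psi> \<star> \<phi>)) =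
    paste B p q r R'' R S'' S (y \<cdot> (CellId B r \<star> \<psi>)) (x \<cdot> (CellId B q \<star> \<phi>))"
proof -
  note [simp] = assms(1-9)[THEN ArrsD(1)] assms(1-9)[THEN ArrsD(2)] assms(1-9)[THEN ArrsD(3)]
    assms(10-13)[THEN CellsD(1)] assms(10-13)[THEN CellsD(2)] assms(10-13)[THEN CellsD(3)]
  let ?z = "y \<cdot> (CellId B r \<star> \<psi>)"
  have 1: "AssocInv B r S' R' \<cdot> (CellId B r \<star> (\<psi> \<star> \<phi>)) =
      ((CellId B r \<star> \<psi>) \<star> \<phi>) \<cdot> AssocInv B r S'' R''"
    by (rule AssocInv_natural) simp_all
  have 2: "(y \<star> CellId B R') \<cdot> ((CellId B r \<star> \<psi>) \<star> \<phi>) = ?z \<star> \<phi>"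
    by (subst interchange[symmetric]) simp_all
  have 3: "?z \<star> \<phi> = (CellId B (S \<odot> q) \<star> \<phi>) \<cdot> (?z \<star> CellId B R'')"
    by (subst interchange[symmetric]) simp_all
  have 4: "Assoc B S q R' \<cdot> (CellId B (S \<odot> q) \<star> \<phi>) = (CellId B S \<star> (CellId B q \<star> \<phi>)) \<cdot> Assoc B S q R''"
    using Assoc_natural[of \<phi> "CellId B q" "CellId B S", OF _ _ _ _ _ refl refl refl refl refl refl]
    by simp
  have "paste B p q r R' R S' S y x \<cdot> (CellId B r \<star> (\<psi> \<star> \<phi>)) =
      AssocInv B S R p \<cdot> (CellId B S \<star> x) \<cdot> Assoc B S q R' \<cdot> (y \<star> CellId B R')
      \<cdot> (AssocInv B r S' R' \<cdot> (CellId B r \<star> (\<psi> \<star> \<phi>)))"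
    by (simp add: paste_def VComp_assoc)
  also have "\<dots> = AssocInv B S R p \<cdot> (CellId B S \<star> x) \<cdot> Assoc B S q R'
      \<cdot> ((y \<star> CellId B R') \<cdot> ((CellId B r \<star> \<psi>) \<star> \<phi>)) \<cdot> AssocInv B r S'' R''"
    unfolding 1 by (simp add: VComp_assoc)
  also have "\<dots> = AssocInv B S R p \<cdot> (CellId B S \<star> x)
      \<cdot> (Assoc B S q R' \<cdot> (CellId B (S \<odot> q) \<star> \<phi>)) \<cdot> (?z \<star> CellId B R'') \<cdot> AssocInv B r S'' R''"
    unfolding 2 3 by (simp add: VComp_assoc)
  also have "\<dots> = paste B p q r R'' R S'' S ?z (x \<cdot> (CellId B q \<star> \<phi>))"
    unfolding 4 by (simp add: paste_def VComp_assoc lwhisker_VComp)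
  finally show ?thesis .
qed

text \<open>The dual naturality, on the codomain side: now \<open>\<phi>\<close> meets x directly,
  and \<open>\<psi>\<close> crosses x and the middle associator to reach y.\<close>

lemma paste_postcomp:
  assumes "p \<in> Arrs B X' X" "q \<in> Arrs B Y' Y" "r \<in> Arrs B Z' Z"
    "R' \<in> Arrs B X' Y'" "R \<in> Arrs B X Y" "S' \<in> Arrs B Y' Z'" "S \<in> Arrs B Y Z"
    "R'' \<in> Arrs B X Y" "S'' \<in> Arrs B Y Z"
    "x \<in> Cells B (q \<odot> R') (R \<odot> p)" "y \<in> Cells B (r \<odot> S') (S \<odot> q)"
    "\<phi> \<in> Cells B R R''" "\<psi> \<in> Cells B S S''"
  shows "((\<psi> \<star> \<phi>) \<star> CellId B p) \<cdot> paste B p q r R' R S' S y x =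
    paste B p q r R' R'' S' S'' ((\<psi> \<star> CellId B q) \<cdot> y) ((\<phi> \<star> CellId B p) \<cdot> x)"
proof -
  note [simp] = assms(1-9)[THEN ArrsD(1)] assms(1-9)[THEN ArrsD(2)] assms(1-9)[THEN ArrsD(3)]
    assms(10-13)[THEN CellsD(1)] assms(10-13)[THEN CellsD(2)] assms(10-13)[THEN CellsD(3)]
  let ?z = "(\<phi> \<star> CellId B p) \<cdot> x"
  have 1: "((\<psi> \<star> \<phi>) \<star> CellId B p) \<cdot> AssocInv B S R p =
      AssocInv B S'' R'' p \<cdot> (\<psi> \<star> (\<phi> \<star> CellId B p))"
    by (rule AssocInv_natural[symmetric]) simp_all
  have 2: "(\<psi> \<star> (\<phi> \<star> CellId B p)) \<cdot> (CellId B S \<star> x) = \<psi> \<star> ?z"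
    by (subst interchange[symmetric]) simp_all
  have 3: "\<psi> \<star> ?z = (CellId B S'' \<star> ?z) \<cdot> (\<psi> \<star> CellId B (q \<odot> R'))"
    by (subst interchange[symmetric]) simp_all
  have 4: "(\<psi> \<star> CellId B (q \<odot> R')) \<cdot> Assoc B S q R' = Assoc B S'' q R' \<cdot> ((\<psi> \<star> CellId B q) \<star> CellId B R')"
    using Assoc_natural[of "CellId B R'" "CellId B q" \<psi>, OF _ _ _ _ _ refl refl refl refl refl refl]
    by simp
  have "((\<psi> \<star> \<phi>) \<star> CellId B p) \<cdot> paste B p q r R' R S' S y x =
      (((\<psi> \<star> \<phi>) \<star> CellId B p) \<cdot> AssocInv B S R p) \<cdot> (CellId B S \<star> x) \<cdot> Assoc B S q R'
      \<cdot> (y \<star> CellId B R') \<cdot> AssocInv B r S' R'"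
    by (simp add: paste_def VComp_assoc)
  also have "\<dots> = AssocInv B S'' R'' p \<cdot> ((\<psi> \<star> (\<phi> \<star> CellId B p)) \<cdot> (CellId B S \<star> x)) \<cdot> Assoc B S q R'
      \<cdot> (y \<star> CellId B R') \<cdot> AssocInv B r S' R'"
    unfolding 1 by (simp add: VComp_assoc)
  also have "\<dots> = AssocInv B S'' R'' p \<cdot> (CellId B S'' \<star> ?z)
      \<cdot> ((\<psi> \<star> CellId B (q \<odot> R')) \<cdot> Assoc B S q R') \<cdot> (y \<star> CellId B R') \<cdot> AssocInv B r S' R'"
    unfolding 2 3 by (simp add: VComp_assoc)
  also have "\<dots> = paste B p q r R' R'' S' S'' ((\<psi> \<star> CellId B q) \<cdot> y) ?z"
    unfolding 4 by (simp add: paste_def VComp_assoc rwhisker_VComp)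
  finally show ?thesis .
qed

text \<open>The outer associators cancel the two inverses built into \<open>paste\<close>. What is
  left contains forward associators only, the form to which the pentagon applies.\<close>

lemma paste_Assoc:
  assumes "p \<in> Arrs B X' X" "q \<in> Arrs B Y' Y" "r \<in> Arrs B Z' Z"
    "R' \<in> Arrs B X' Y'" "R \<in> Arrs B X Y" "S' \<in> Arrs B Y' Z'" "S \<in> Arrs B Y Z"
    "x \<in> Cells B (q \<odot> R') (R \<odot> p)" "y \<in> Cells B (r \<odot> S') (S \<odot> q)"
  shows "Assoc B S R p \<cdot> paste B p q r R' R S' S y x \<cdot> Assoc B r S' R' =
    (CellId B S \<star> x) \<cdot> Assoc B S q R' \<cdot> (y \<star> CellId B R')"
proof -
  note [simp] = assms(1-7)[THEN ArrsD(1)] assms(1-7)[THEN ArrsD(2)] assms(1-7)[THEN ArrsD(3)]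
    assms(8,9)[THEN CellsD(1)] assms(8,9)[THEN CellsD(2)] assms(8,9)[THEN CellsD(3)]
  show ?thesis
    by (simp add: paste_def VComp_assoc)
qed

text \<open>
  Conjugating both sides by associators removes all inverses, after which each side reduces, by
  one pentagon and naturality, to the same composite.
\<close>

lemma paste_assoc:
  assumes "p0 \<in> Arrs B X' X" "p1 \<in> Arrs B Y' Y" "p2 \<in> Arrs B Z' Z" "p3 \<in> Arrs B W' W"
    "R' \<in> Arrs B X' Y'" "R \<in> Arrs B X Y" "S' \<in> Arrs B Y' Z'" "S \<in> Arrs B Y Z"
    "T' \<in> Arrs B Z' W'" "T \<in> Arrs B Z W"
    "x \<in> Cells B (p1 \<odot> R') (R \<odot> p0)" "y \<in> Cells B (p2 \<odot> S') (S \<odot> p1)"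
    "z \<in> Cells B (p3 \<odot> T') (T \<odot> p2)"
  shows "(Assoc B T S R \<star> CellId B p0) \<cdot>
      paste B p0 p1 p3 R' R (T' \<odot> S') (T \<odot> S) (paste B p1 p2 p3 S' S T' T z y) x =
    paste B p0 p2 p3 (S' \<odot> R') (S \<odot> R) T' T z (paste B p0 p1 p2 R' R S' S y x) \<cdot>
      (CellId B p3 \<star> Assoc B T' S' R')"
    (is "?L = ?R")
proof -
  note [simp] = assms(1-10)[THEN ArrsD(1)] assms(1-10)[THEN ArrsD(2)] assms(1-10)[THEN ArrsD(3)]
    assms(11-13)[THEN CellsD(1)] assms(11-13)[THEN CellsD(2)] assms(11-13)[THEN CellsD(3)]
  let ?u = "paste B p1 p2 p3 S' S T' T z y" and ?w = "paste B p0 p1 p2 R' R S' S y x"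
  have u: "?u \<in> Cells B (p3 \<odot> (T' \<odot> S')) ((T \<odot> S) \<odot> p1)"
    by (rule paste_in) (fact assms)+
  have w: "?w \<in> Cells B (p2 \<odot> (S' \<odot> R')) ((S \<odot> R) \<odot> p0)"
    by (rule paste_in) (fact assms)+
  note [simp] = CellsD[OF u] CellsD[OF w]
  have TS: "T \<odot> S \<in> Arrs B Y W" "T' \<odot> S' \<in> Arrs B Y' W'" "S \<odot> R \<in> Arrs B X Z" "S' \<odot> R' \<in> Arrs B X' Z'"
    by (simp_all add: Arrs_def)
  let ?uu = "paste B p0 p1 p3 R' R (T' \<odot> S') (T \<odot> S) ?u x"
    and ?ww = "paste B p0 p2 p3 (S' \<odot> R') (S \<odot> R) T' T z ?w"
  have uu: "?uu \<in> Cells B (p3 \<odot> ((T' \<odot> S') \<odot> R')) (((T \<odot> S) \<odot> R) \<odot> p0)"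
    by (rule paste_in) (fact assms TS u)+
  have ww: "?ww \<in> Cells B (p3 \<odot> (T' \<odot> (S' \<odot> R'))) ((T \<odot> (S \<odot> R)) \<odot> p0)"
    by (rule paste_in) (fact assms TS w)+
  note [simp] = CellsD[OF uu] CellsD[OF ww]
  \<comment> \<open>The common value of both sides: z, y and x act in turn, starting from
    \<open>((p3 \<odot> T') \<odot> S') \<odot> R'\<close> and ending at
    \<open>T \<odot> (S \<odot> (R \<odot> p0))\<close>. The maps \<open>?pre\<close> and
    \<open>?post\<close> change the boundaries of a cell to these two bracketings.\<close>
  let ?M = "(CellId B T \<star> (CellId B S \<star> x)) \<cdot> (CellId B T \<star> Assoc B S p1 R')
    \<cdot> (CellId B T \<star> (y \<star> CellId B R')) \<cdot> Assoc B T (p2 \<odot> S') R'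
    \<cdot> (Assoc B T p2 S' \<star> CellId B R') \<cdot> ((z \<star> CellId B S') \<star> CellId B R')"
  let ?post = "\<lambda>c. (CellId B T \<star> Assoc B S R p0) \<cdot> Assoc B T (S \<odot> R) p0 \<cdot> c"
  let ?pre = "\<lambda>c. c \<cdot> Assoc B p3 (T' \<odot> S') R' \<cdot> (Assoc B p3 T' S' \<star> CellId B R')"

  have L1: "(CellId B T \<star> Assoc B S R p0) \<cdot> Assoc B T (S \<odot> R) p0 \<cdot> (Assoc B T S R \<star> CellId B p0)
      = Assoc B T S (R \<odot> p0) \<cdot> Assoc B (T \<odot> S) R p0"
    by (rule pentagon'[symmetric]) simp_all
  have L2: "Assoc B (T \<odot> S) R p0 \<cdot> ?uu \<cdot> Assoc B p3 (T' \<odot> S') R' =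
      (CellId B (T \<odot> S) \<star> x) \<cdot> Assoc B (T \<odot> S) p1 R' \<cdot> (?u \<star> CellId B R')"
    by (rule paste_Assoc) (fact assms TS u)+
  have L3: "Assoc B T S (R \<odot> p0) \<cdot> (CellId B (T \<odot> S) \<star> x)
      = (CellId B T \<star> (CellId B S \<star> x)) \<cdot> Assoc B T S (p1 \<odot> R')"
    using Assoc_natural[of x "CellId B S" "CellId B T", OF _ _ _ _ _ refl refl refl refl refl refl]
    by simp
  have L4: "Assoc B T S (p1 \<odot> R') \<cdot> Assoc B (T \<odot> S) p1 R'
      = (CellId B T \<star> Assoc B S p1 R') \<cdot> Assoc B T (S \<odot> p1) R' \<cdot> (Assoc B T S p1 \<star> CellId B R')"
    by (rule pentagon') simp_all
  have L5: "(Assoc B T S p1 \<star> CellId B R') \<cdot> (?u \<star> CellId B R') \<cdot> (Assoc B p3 T' S' \<star> CellId B R')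
      = ((CellId B T \<star> y) \<star> CellId B R') \<cdot> (Assoc B T p2 S' \<star> CellId B R')
        \<cdot> ((z \<star> CellId B S') \<star> CellId B R')"
  proof -
    have "Assoc B T S p1 \<cdot> ?u \<cdot> Assoc B p3 T' S' = (CellId B T \<star> y) \<cdot> Assoc B T p2 S' \<cdot> (z \<star> CellId B S')"
      by (rule paste_Assoc) (fact assms)+
    from arg_cong[OF this, of "\<lambda>c. c \<star> CellId B R'"] show ?thesis
      by (simp add: rwhisker_VComp)
  qed
  have L6: "Assoc B T (S \<odot> p1) R' \<cdot> ((CellId B T \<star> y) \<star> CellId B R')
      = (CellId B T \<star> (y \<star> CellId B R')) \<cdot> Assoc B T (p2 \<odot> S') R'"
    by (rule Assoc_natural) simp_all
  have "?post (?pre ?L) = ((CellId B T \<star> Assoc B S R p0) \<cdot> Assoc B T (S \<odot> R) p0 \<cdot> (Assoc B T S R \<star> CellId B p0))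
      \<cdot> (?uu \<cdot> Assoc B p3 (T' \<odot> S') R') \<cdot> (Assoc B p3 T' S' \<star> CellId B R')"
    by (simp add: VComp_assoc)
  also have "\<dots> = Assoc B T S (R \<odot> p0) \<cdot> (Assoc B (T \<odot> S) R p0 \<cdot> ?uu \<cdot> Assoc B p3 (T' \<odot> S') R')
      \<cdot> (Assoc B p3 T' S' \<star> CellId B R')"
    unfolding L1 by (simp add: VComp_assoc)
  also have "\<dots> = (Assoc B T S (R \<odot> p0) \<cdot> (CellId B (T \<odot> S) \<star> x)) \<cdot> Assoc B (T \<odot> S) p1 R'
      \<cdot> (?u \<star> CellId B R') \<cdot> (Assoc B p3 T' S' \<star> CellId B R')"
    unfolding L2 by (simp add: VComp_assoc)
  also have "\<dots> = (CellId B T \<star> (CellId B S \<star> x)) \<cdot> (Assoc B T S (p1 \<odot> R') \<cdot> Assoc B (T \<odot> S) p1 R')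
      \<cdot> (?u \<star> CellId B R') \<cdot> (Assoc B p3 T' S' \<star> CellId B R')"
    unfolding L3 by (simp add: VComp_assoc)
  also have "\<dots> = (CellId B T \<star> (CellId B S \<star> x)) \<cdot> (CellId B T \<star> Assoc B S p1 R') \<cdot> Assoc B T (S \<odot> p1) R'
      \<cdot> ((Assoc B T S p1 \<star> CellId B R') \<cdot> (?u \<star> CellId B R') \<cdot> (Assoc B p3 T' S' \<star> CellId B R'))"
    unfolding L4 by (simp add: VComp_assoc)
  also have "\<dots> = (CellId B T \<star> (CellId B S \<star> x)) \<cdot> (CellId B T \<star> Assoc B S p1 R')
      \<cdot> (Assoc B T (S \<odot> p1) R' \<cdot> ((CellId B T \<star> y) \<star> CellId B R')) \<cdot> (Assoc B T p2 S' \<star> CellId B R')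
        \<cdot> ((z \<star> CellId B S') \<star> CellId B R')"
    unfolding L5 by (simp add: VComp_assoc)
  also have "\<dots> = ?M"
    unfolding L6 by (simp add: VComp_assoc)
  finally have L: "?post (?pre ?L) = ?M" .

  have R1: "(CellId B p3 \<star> Assoc B T' S' R') \<cdot> Assoc B p3 (T' \<odot> S') R' \<cdot> (Assoc B p3 T' S' \<star> CellId B R')
      = Assoc B p3 T' (S' \<odot> R') \<cdot> Assoc B (p3 \<odot> T') S' R'"
    by (rule pentagon'[symmetric]) simp_all
  have R2: "Assoc B T (S \<odot> R) p0 \<cdot> ?ww \<cdot> Assoc B p3 T' (S' \<odot> R') =
      (CellId B T \<star> ?w) \<cdot> Assoc B T p2 (S' \<odot> R') \<cdot> (z \<star> CellId B (S' \<odot> R'))"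
    by (rule paste_Assoc) (fact assms TS w)+
  have R3: "(z \<star> CellId B (S' \<odot> R')) \<cdot> Assoc B (p3 \<odot> T') S' R'
      = Assoc B (T \<odot> p2) S' R' \<cdot> ((z \<star> CellId B S') \<star> CellId B R')"
    using Assoc_natural[of "CellId B R'" "CellId B S'" z, OF _ _ _ _ _ refl refl refl refl refl refl]
    by simp
  have R4: "Assoc B T p2 (S' \<odot> R') \<cdot> Assoc B (T \<odot> p2) S' R'
      = (CellId B T \<star> Assoc B p2 S' R') \<cdot> Assoc B T (p2 \<odot> S') R' \<cdot> (Assoc B T p2 S' \<star> CellId B R')"
    by (rule pentagon') simp_all
  have R5: "(CellId B T \<star> Assoc B S R p0) \<cdot> (CellId B T \<star> ?w) \<cdot> (CellId B T \<star> Assoc B p2 S' R')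
      = (CellId B T \<star> (CellId B S \<star> x)) \<cdot> (CellId B T \<star> Assoc B S p1 R') \<cdot> (CellId B T \<star> (y \<star> CellId B R'))"
  proof -
    have "Assoc B S R p0 \<cdot> ?w \<cdot> Assoc B p2 S' R' = (CellId B S \<star> x) \<cdot> Assoc B S p1 R' \<cdot> (y \<star> CellId B R')"
      by (rule paste_Assoc) (fact assms)+
    from arg_cong[OF this, of "\<lambda>c. CellId B T \<star> c"] show ?thesis
      by (simp add: lwhisker_VComp)
  qed
  have "?post (?pre ?R) = (CellId B T \<star> Assoc B S R p0) \<cdot> Assoc B T (S \<odot> R) p0 \<cdot> ?ww
      \<cdot> ((CellId B p3 \<star> Assoc B T' S' R') \<cdot> Assoc B p3 (T' \<odot> S') R' \<cdot> (Assoc B p3 T' S' \<star> CellId B R'))"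
    by (simp add: VComp_assoc)
  also have "\<dots> = (CellId B T \<star> Assoc B S R p0) \<cdot> (Assoc B T (S \<odot> R) p0 \<cdot> ?ww \<cdot> Assoc B p3 T' (S' \<odot> R'))
      \<cdot> Assoc B (p3 \<odot> T') S' R'"
    unfolding R1 by (simp add: VComp_assoc)
  also have "\<dots> = (CellId B T \<star> Assoc B S R p0) \<cdot> (CellId B T \<star> ?w) \<cdot> Assoc B T p2 (S' \<odot> R')
      \<cdot> ((z \<star> CellId B (S' \<odot> R')) \<cdot> Assoc B (p3 \<odot> T') S' R')"
    unfolding R2 by (simp add: VComp_assoc)
  also have "\<dots> = (CellId B T \<star> Assoc B S R p0) \<cdot> (CellId B T \<star> ?w)
      \<cdot> (Assoc B T p2 (S' \<odot> R') \<cdot> Assoc B (T \<odot> p2) S' R') \<cdot> ((z \<star> CellId B S') \<star> CellId B R')"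
    unfolding R3 by (simp add: VComp_assoc)
  also have "\<dots> = ((CellId B T \<star> Assoc B S R p0) \<cdot> (CellId B T \<star> ?w) \<cdot> (CellId B T \<star> Assoc B p2 S' R'))
      \<cdot> Assoc B T (p2 \<odot> S') R' \<cdot> (Assoc B T p2 S' \<star> CellId B R') \<cdot> ((z \<star> CellId B S') \<star> CellId B R')"
    unfolding R4 by (simp add: VComp_assoc)
  also have "\<dots> = ?M"
    unfolding R5 by (simp add: VComp_assoc)
  finally have R: "?post (?pre ?R) = ?M" .

  have post: "(CellId B T \<star> AssocInv B S R p0) \<cdot> (CellId B T \<star> Assoc B S R p0)
      = CellId B (T \<odot> ((S \<odot> R) \<odot> p0))"
    by (simp flip: lwhisker_VComp)
  have pre: "(Assoc B p3 T' S' \<star> CellId B R') \<cdot> (AssocInv B p3 T' S' \<star> CellId B R')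
      = CellId B ((p3 \<odot> (T' \<odot> S')) \<odot> R')"
    by (simp flip: rwhisker_VComp)
  \<comment> \<open>A left inverse of the conjugation, which is thereby injective on cells with
    these boundaries.\<close>
  have cancel: "c = AssocInv B T (S \<odot> R) p0 \<cdot> (CellId B T \<star> AssocInv B S R p0) \<cdot> ?post (?pre c)
      \<cdot> (AssocInv B p3 T' S' \<star> CellId B R') \<cdot> AssocInv B p3 (T' \<odot> S') R'"
    if c: "c \<in> Cells B (p3 \<odot> ((T' \<odot> S') \<odot> R')) ((T \<odot> (S \<odot> R)) \<odot> p0)" for c
  proof -
    note [simp] = CellsD[OF c]
    have "AssocInv B T (S \<odot> R) p0 \<cdot> (CellId B T \<star> AssocInv B S R p0) \<cdot> ?post (?pre c)
      \<cdot> (AssocInv B p3 T' S' \<star> CellId B R') \<cdot> AssocInv B p3 (T' \<odot> S') R'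
      = AssocInv B T (S \<odot> R) p0 \<cdot> ((CellId B T \<star> AssocInv B S R p0) \<cdot> (CellId B T \<star> Assoc B S R p0))
        \<cdot> Assoc B T (S \<odot> R) p0 \<cdot> c \<cdot> Assoc B p3 (T' \<odot> S') R'
        \<cdot> ((Assoc B p3 T' S' \<star> CellId B R') \<cdot> (AssocInv B p3 T' S' \<star> CellId B R'))
        \<cdot> AssocInv B p3 (T' \<odot> S') R'"
      by (simp add: VComp_assoc)
    also have "\<dots> = c"
      unfolding pre post by simp
    finally show ?thesis ..
  qed
  have "?L \<in> Cells B (p3 \<odot> ((T' \<odot> S') \<odot> R')) ((T \<odot> (S \<odot> R)) \<odot> p0)"
    "?R \<in> Cells B (p3 \<odot> ((T' \<odot> S') \<odot> R')) ((T \<odot> (S \<odot> R)) \<odot> p0)"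
    by (simp_all add: Cells_def)
  from cancel[OF this(1)] cancel[OF this(2)] show ?thesis
    unfolding L R by simp
qed

end

section \<open>Products of categories and bicategories\<close>

lemma category_prod_cat:
  assumes "category C" and "category D"
  shows "category (prod_cat C D)"
proof -
  interpret C: category C by fact
  interpret D: category D by fact
  show ?thesis
    by (intro category.intro; unfold split_paired_all)
      (auto simp: C.Id_left D.Id_left C.Id_right D.Id_right C.Comp_assoc D.Comp_assoc
        intro: C.Id_in D.Id_in C.Comp_in D.Comp_in,
       auto simp: prod_cat_def C.Dom_in D.Dom_in C.Cod_in D.Cod_in)
qed

lemma is_iso_prod_cat:
  assumes "is_iso C f" and "is_iso D f'"
  shows "is_iso (prod_cat C D) (f, f')"
proof -
  obtain g g' where "inverses C f g" "inverses D f' g'"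
    using assms by (auto simp: is_iso_def)
  then have "inverses (prod_cat C D) (f, f') (g, g')"
    by (auto simp: inverses_def prod_cat_def Hom_def)
  then show ?thesis
    unfolding is_iso_def by blast
qed

lemma cat_functor_comp:
  assumes "cat_functor C D Fo Fm" and "cat_functor D E Go Gm"
  shows "cat_functor C E (Go \<circ> Fo) (Gm \<circ> Fm)"
proof -
  interpret F: cat_functor C D Fo Fm by fact
  interpret G: cat_functor D E Go Gm by fact
  show ?thesis
    by standard (auto simp: F.Fo_in G.Fo_in F.Fm_Id G.Fm_Id F.Fm_Comp G.Fm_Comp[OF F.Fm_in F.Fm_in]
        intro: G.Fm_in F.Fm_in)
qed

lemma cat_functor_prod:
  assumes "cat_functor C D Fo Fm" and "cat_functor C' D' Go Gm"
  shows "cat_functor (prod_cat C C') (prod_cat D D') (map_prod Fo Go) (map_prod Fm Gm)"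
proof -
  interpret F: cat_functor C D Fo Fm by fact
  interpret G: cat_functor C' D' Go Gm by fact
  show ?thesis
    by (intro cat_functor.intro cat_functor_axioms.intro category_prod_cat
        F.C.category_axioms F.D.category_axioms G.C.category_axioms G.D.category_axioms; unfold split_paired_all)
      (auto simp: split_paired_all F.Fo_in G.Fo_in F.Fm_Id G.Fm_Id F.Fm_Comp G.Fm_Comp
        intro: F.Fm_in G.Fm_in)
qed

section \<open>The product of two normal bicategories\<close>

lemma prod_bicat_simps [simp]:
  "Obj (prod_bicat B C) = Obj B \<times> Obj C" "Arr (prod_bicat B C) = Arr B \<times> Arr C"
  "Src (prod_bicat B C) = map_prod (Src B) (Src C)" "Tgt (prod_bicat B C) = map_prod (Tgt B) (Tgt C)"
  "Cell (prod_bicat B C) = Cell B \<times> Cell C"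
  "Cdom (prod_bicat B C) = map_prod (Cdom B) (Cdom C)"
  "Ccod (prod_bicat B C) = map_prod (Ccod B) (Ccod C)"
  "One (prod_bicat B C) = map_prod (One B) (One C)"
  "CellId (prod_bicat B C) = map_prod (CellId B) (CellId C)"
  "ArrComp (prod_bicat B C) (S, S') (R, R') = (S \<odot>\<^bsub>B\<^esub> R, S' \<odot>\<^bsub>C\<^esub> R')"
  "VComp (prod_bicat B C) (\<beta>, \<beta>') (\<alpha>, \<alpha>') = (\<beta> \<cdot>\<^bsub>B\<^esub> \<alpha>, \<beta>' \<cdot>\<^bsub>C\<^esub> \<alpha>')"
  "HComp (prod_bicat B C) (\<beta>, \<beta>') (\<alpha>, \<alpha>') = (\<beta> \<star>\<^bsub>B\<^esub> \<alpha>, \<beta>' \<star>\<^bsub>C\<^esub> \<alpha>')"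
  "Assoc (prod_bicat B C) (T, T') (S, S') (R, R') = (Assoc B T S R, Assoc C T' S' R')"
  by (simp_all add: prod_bicat_def)

lemma Arrs_prod_bicat [simp]:
  "Arrs (prod_bicat B C) (X, X') (Y, Y') = Arrs B X Y \<times> Arrs C X' Y'"
  by (auto simp: Arrs_def)

lemma Cells_prod_bicat [simp]:
  "Cells (prod_bicat B C) (R, R') (S, S') = Cells B R S \<times> Cells C R' S'"
  by (auto simp: Cells_def)

text \<open>This is an equality of records, not merely an isomorphism, so conditions on
  hom-categories of the product bicategory become conditions on \<open>prod_cat\<close> by
  rewriting.\<close>

lemma hom_cat_prod_bicat [simp]:
  "hom_cat (prod_bicat B C) (X, X') (Y, Y') = prod_cat (hom_cat B X Y) (hom_cat C X' Y')"
  unfolding hom_cat_def full_hom_def prod_cat_def Arrs_prod_bicat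
  by (auto simp: fun_eq_iff)

text \<open>Every axiom holds componentwise. The care lies in regrouping: composition takes a pair
  of pairs grouped by position, while the two given functors take pairs grouped by
  bicategory.\<close>

lemma normal_bicategory_prod:
  assumes "normal_bicategory B" and "normal_bicategory C"
  shows "normal_bicategory (prod_bicat B C)"
proof -
  interpret B: normal_bicategory B by fact
  interpret C: normal_bicategory C by fact
  have hom: "category (prod_cat (hom_cat B X Y) (hom_cat C X' Y'))"
    if "X \<in> Obj B" "Y \<in> Obj B" "X' \<in> Obj C" "Y' \<in> Obj C" for X Y X' Y'
    using that by (simp add: category_prod_cat B.hom_category C.hom_category)
  \<comment> \<open>The domain is a product of products in the wrong order for the product of the
    two composition functors, so each functor law is checked on explicit tuples and split into its
    two components.\<close>
  have comp: "cat_functor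
      (prod_cat (prod_cat (hom_cat B Y Z) (hom_cat C Y' Z')) (prod_cat (hom_cat B X Y) (hom_cat C X' Y')))
      (prod_cat (hom_cat B X Z) (hom_cat C X' Z'))
      (\<lambda>(S, R). S \<odot>\<^bsub>prod_bicat B C\<^esub> R) (\<lambda>(\<beta>, \<alpha>). \<beta> \<star>\<^bsub>prod_bicat B C\<^esub> \<alpha>)"
    if [simp]: "X \<in> Obj B" "Y \<in> Obj B" "Z \<in> Obj B" "X' \<in> Obj C" "Y' \<in> Obj C" "Z' \<in> Obj C"
    for X Y Z X' Y' Z'
  proof -
    interpret F: cat_functor "prod_cat (hom_cat B Y Z) (hom_cat B X Y)" "hom_cat B X Z"
      "\<lambda>(S, R). S \<odot>\<^bsub>B\<^esub> R" "\<lambda>(\<beta>, \<alpha>). \<beta> \<star>\<^bsub>B\<^esub> \<alpha>"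
      by (rule B.comp_functor) simp_all
    interpret G: cat_functor "prod_cat (hom_cat C Y' Z') (hom_cat C X' Y')" "hom_cat C X' Z'"
      "\<lambda>(S, R). S \<odot>\<^bsub>C\<^esub> R" "\<lambda>(\<beta>, \<alpha>). \<beta> \<star>\<^bsub>C\<^esub> \<alpha>"
      by (rule C.comp_functor) simp_all
    show ?thesis
    proof (intro cat_functor.intro cat_functor_axioms.intro category_prod_cat hom
        B.hom_category C.hom_category that, unfold split_paired_all, goal_cases)
      case 1
      then show ?case
        by (auto intro!: F.Fo_in[of "(_, _)", simplified]
          G.Fo_in[of "(_, _)", simplified])
    next
      case 2
      then show ?case
        by (auto intro!: F.Fm_in[of "(_, _)" "(_, _)" "(_, _)", simplified]
          G.Fm_in[of "(_, _)" "(_, _)" "(_, _)", simplified])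
    next
      case 3
      then show ?case
        by (auto intro!: F.Fm_Id[of "(_, _)", simplified]
          G.Fm_Id[of "(_, _)", simplified])
    next
      case 4
      then show ?case
        by (auto intro!: F.Fm_Comp[of "(_, _)" "(_, _)" "(_, _)" "(_, _)" "(_, _)", simplified]
          G.Fm_Comp[of "(_, _)" "(_, _)" "(_, _)" "(_, _)" "(_, _)", simplified])
    qed
  qed
  have assoc: "nat_iso
      (prod_cat (prod_cat (hom_cat B Z W) (hom_cat C Z' W'))
        (prod_cat (prod_cat (hom_cat B Y Z) (hom_cat C Y' Z')) (prod_cat (hom_cat B X Y) (hom_cat C X' Y'))))
      (prod_cat (hom_cat B X W) (hom_cat C X' W'))
      (\<lambda>(T, S, R). (T \<odot>\<^bsub>prod_bicat B C\<^esub> S) \<odot>\<^bsub>prod_bicat B C\<^esub> R)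
      (\<lambda>(\<gamma>, \<beta>, \<alpha>). (\<gamma> \<star>\<^bsub>prod_bicat B C\<^esub> \<beta>) \<star>\<^bsub>prod_bicat B C\<^esub> \<alpha>)
      (\<lambda>(T, S, R). T \<odot>\<^bsub>prod_bicat B C\<^esub> (S \<odot>\<^bsub>prod_bicat B C\<^esub> R))
      (\<lambda>(\<gamma>, \<beta>, \<alpha>). \<gamma> \<star>\<^bsub>prod_bicat B C\<^esub> (\<beta> \<star>\<^bsub>prod_bicat B C\<^esub> \<alpha>))
      (\<lambda>(T, S, R). Assoc (prod_bicat B C) T S R)"
    if [simp]: "X \<in> Obj B" "Y \<in> Obj B" "Z \<in> Obj B" "W \<in> Obj B"
      "X' \<in> Obj C" "Y' \<in> Obj C" "Z' \<in> Obj C" "W' \<in> Obj C"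
    for X Y Z W X' Y' Z' W'
  proof -
    let ?C = "prod_cat (prod_cat (hom_cat B Z W) (hom_cat C Z' W'))
        (prod_cat (prod_cat (hom_cat B Y Z) (hom_cat C Y' Z')) (prod_cat (hom_cat B X Y) (hom_cat C X' Y')))"
      and ?D = "prod_cat (hom_cat B X W) (hom_cat C X' W')"
    interpret F: nat_iso "prod_cat (hom_cat B Z W) (prod_cat (hom_cat B Y Z) (hom_cat B X Y))"
      "hom_cat B X W"
      "\<lambda>(T, S, R). (T \<odot>\<^bsub>B\<^esub> S) \<odot>\<^bsub>B\<^esub> R" "\<lambda>(\<gamma>, \<beta>, \<alpha>). (\<gamma> \<star>\<^bsub>B\<^esub> \<beta>) \<star>\<^bsub>B\<^esub> \<alpha>"
      "\<lambda>(T, S, R). T \<odot>\<^bsub>B\<^esub> (S \<odot>\<^bsub>B\<^esub> R)" "\<lambda>(\<gamma>, \<beta>, \<alpha>). \<gamma> \<star>\<^bsub>B\<^esub> (\<beta> \<star>\<^bsub>B\<^esub> \<alpha>)"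
      "\<lambda>(T, S, R). Assoc B T S R"
      by (rule B.Assoc_nat_iso) simp_all
    interpret G: nat_iso "prod_cat (hom_cat C Z' W') (prod_cat (hom_cat C Y' Z') (hom_cat C X' Y'))"
      "hom_cat C X' W'"
      "\<lambda>(T, S, R). (T \<odot>\<^bsub>C\<^esub> S) \<odot>\<^bsub>C\<^esub> R" "\<lambda>(\<gamma>, \<beta>, \<alpha>). (\<gamma> \<star>\<^bsub>C\<^esub> \<beta>) \<star>\<^bsub>C\<^esub> \<alpha>"
      "\<lambda>(T, S, R). T \<odot>\<^bsub>C\<^esub> (S \<odot>\<^bsub>C\<^esub> R)" "\<lambda>(\<gamma>, \<beta>, \<alpha>). \<gamma> \<star>\<^bsub>C\<^esub> (\<beta> \<star>\<^bsub>C\<^esub> \<alpha>)"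
      "\<lambda>(T, S, R). Assoc C T S R"
      by (rule C.Assoc_nat_iso) simp_all
    have cats: "category ?C" "category ?D"
      by (simp_all add: category_prod_cat hom)
    have l: "cat_functor ?C ?D (\<lambda>(T, S, R). (T \<odot>\<^bsub>prod_bicat B C\<^esub> S) \<odot>\<^bsub>prod_bicat B C\<^esub> R)
        (\<lambda>(\<gamma>, \<beta>, \<alpha>). (\<gamma> \<star>\<^bsub>prod_bicat B C\<^esub> \<beta>) \<star>\<^bsub>prod_bicat B C\<^esub> \<alpha>)"
    proof (intro cat_functor.intro cat_functor_axioms.intro cats, unfold split_paired_all, goal_cases)
      case 1
      then show ?case
        by (auto intro!: F.F.Fo_in[of "(_, _, _)", simplified]
          G.F.Fo_in[of "(_, _, _)", simplified])
    next
      case 2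
      then show ?case
        by (auto intro!: F.F.Fm_in[of "(_, _, _)" "(_, _, _)" "(_, _, _)", simplified]
          G.F.Fm_in[of "(_, _, _)" "(_, _, _)" "(_, _, _)", simplified])
    next
      case 3
      then show ?case
        by (auto intro!: F.F.Fm_Id[of "(_, _, _)", simplified]
          G.F.Fm_Id[of "(_, _, _)", simplified])
    next
      case 4
      then show ?case
        by (auto intro!: F.F.Fm_Comp[of "(_, _, _)" "(_, _, _)" "(_, _, _)" "(_, _, _)" "(_, _, _)", simplified]
          G.F.Fm_Comp[of "(_, _, _)" "(_, _, _)" "(_, _, _)" "(_, _, _)" "(_, _, _)", simplified])
    qed
    have r: "cat_functor ?C ?D (\<lambda>(T, S, R). T \<odot>\<^bsub>prod_bicat B C\<^esub> (S \<odot>\<^bsub>prod_bicat B C\<^esub> R))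
        (\<lambda>(\<gamma>, \<beta>, \<alpha>). \<gamma> \<star>\<^bsub>prod_bicat B C\<^esub> (\<beta> \<star>\<^bsub>prod_bicat B C\<^esub> \<alpha>))"
    proof (intro cat_functor.intro cat_functor_axioms.intro cats, unfold split_paired_all, goal_cases)
      case 1
      then show ?case
        by (auto intro!: F.G.Fo_in[of "(_, _, _)", simplified]
          G.G.Fo_in[of "(_, _, _)", simplified])
    next
      case 2
      then show ?case
        by (auto intro!: F.G.Fm_in[of "(_, _, _)" "(_, _, _)" "(_, _, _)", simplified]
          G.G.Fm_in[of "(_, _, _)" "(_, _, _)" "(_, _, _)", simplified])
    next
      case 3
      then show ?case
        by (auto intro!: F.G.Fm_Id[of "(_, _, _)", simplified]
          G.G.Fm_Id[of "(_, _, _)", simplified])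
    next
      case 4
      then show ?case
        by (auto intro!: F.G.Fm_Comp[of "(_, _, _)" "(_, _, _)" "(_, _, _)" "(_, _, _)" "(_, _, _)", simplified]
          G.G.Fm_Comp[of "(_, _, _)" "(_, _, _)" "(_, _, _)" "(_, _, _)" "(_, _, _)", simplified])
    qed
    show ?thesis
    proof (intro nat_iso.intro nat_trans.intro l r nat_iso_axioms.intro nat_trans_axioms.intro, unfold split_paired_all, goal_cases)
      case 1
      then show ?case
        by (auto intro!: F.component_in[of "(_, _, _)", simplified]
          G.component_in[of "(_, _, _)", simplified])
    next
      case 2
      then show ?case
        by (auto intro!: F.natural[of "(_, _, _)" "(_, _, _)" "(_, _, _)", simplified]
          G.natural[of "(_, _, _)" "(_, _, _)" "(_, _, _)", simplified])
    next
      case 3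
      then show ?case
        by (auto intro!: is_iso_prod_cat F.component_iso[of "(_, _, _)", simplified]
          G.component_iso[of "(_, _, _)", simplified])
    qed
  qed
  show ?thesis
  proof (intro normal_bicategory.intro, unfold split_paired_all, goal_cases)
    \<comment> \<open>The numbers follow the axioms of \<open>normal_bicategory\<close>: 7 is the
      hom-categories, 9 the composition functor, 10 the associator and 11 the pentagon.\<close>
    case 7
    then show ?case by (clarsimp simp: hom)
  next
    case 9
    then show ?case by (clarsimp simp: comp)
  next
    case 10
    then show ?case by (clarsimp simp: assoc)
  next
    case 11
    then show ?case
      by (auto intro: B.pentagon C.pentagon)
  qed (auto simp: B.One_in C.One_in B.One_ArrComp C.One_ArrComp B.ArrComp_One C.ArrComp_One
      B.One_HComp C.One_HComp B.HComp_One C.HComp_One B.Assoc_unit C.Assoc_unit)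
qed

section \<open>The tensor product\<close>

locale tensor_context = precartesian B + precartesian_choices B K
  for B :: "('o, 'a, 'c) bicat" (structure) and K :: "('o, 'a, 'c) choices"
begin

abbreviation P where "P \<equiv> Prod K"
abbreviation p where "p \<equiv> p_arr K"
abbreviation r where "r \<equiv> r_arr K"
abbreviation tens  (infixr "\<otimes>" 80) where "R \<otimes> S \<equiv> tensor_arr B K R S"

section \<open>Projections, their right adjoints and local products\<close>

lemma projections:
  assumes "X \<in> Obj B" "Y \<in> Obj B"
  shows "P X Y \<in> Obj B" "p X Y \<in> Arrs B (P X Y) X" "r X Y \<in> Arrs B (P X Y) Y"
    "is_map B (p X Y)" "is_map B (r X Y)"
  using chosen_product[OF assms] unfolding is_map_product_def by blast+

lemma projection_adjoints:
  assumes "X \<in> Obj B" "Y \<in> Obj B"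
  shows "adjoint_pair B (p X Y) (radj K (p X Y)) (runit K (p X Y)) (rcounit K (p X Y)) (P X Y) X"
    and "adjoint_pair B (r X Y) (radj K (r X Y)) (runit K (r X Y)) (rcounit K (r X Y)) (P X Y) Y"
  by (intro adjoint_pair.intro adjoint_pair_axioms.intro normal_bicategory_axioms
      projections[OF assms] chosen_adjoint)+

lemma tensor_factors:
  assumes "R \<in> Arrs B X A" "S \<in> Arrs B Y D"
  shows "R \<odot> p X Y \<in> Arrs B (P X Y) A" "S \<odot> r X Y \<in> Arrs B (P X Y) D"
    and "tensor_fst B K R S = radj K (p A D) \<odot> (R \<odot> p X Y)"
    and "tensor_snd B K R S = radj K (r A D) \<odot> (S \<odot> r X Y)"
    and "tensor_fst B K R S \<in> Arrs B (P X Y) (P A D)" "tensor_snd B K R S \<in> Arrs B (P X Y) (P A D)"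
proof -
  note obj = ArrsD[OF assms(1)] ArrsD[OF assms(2)]
  interpret p: adjoint_pair B "p A D" "radj K (p A D)" "runit K (p A D)" "rcounit K (p A D)" "P A D" A
    using obj by (intro projection_adjoints)
  interpret r: adjoint_pair B "r A D" "radj K (r A D)" "runit K (r A D)" "rcounit K (r A D)" "P A D" D
    using obj by (intro projection_adjoints)
  note [simp] = obj ArrsD[OF projections(2)[OF obj(4,9)]] ArrsD[OF projections(3)[OF obj(4,9)]]
  show "R \<odot> p X Y \<in> Arrs B (P X Y) A" "S \<odot> r X Y \<in> Arrs B (P X Y) D"
    "tensor_fst B K R S = radj K (p A D) \<odot> (R \<odot> p X Y)"
    "tensor_snd B K R S = radj K (r A D) \<odot> (S \<odot> r X Y)"
    "tensor_fst B K R S \<in> Arrs B (P X Y) (P A D)" "tensor_snd B K R S \<in> Arrs B (P X Y) (P A D)"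
    by (simp_all add: Arrs_def tensor_fst_def tensor_snd_def)
qed

lemma wedge_facts:
  assumes "R \<in> Arrs B X Y" "S \<in> Arrs B X Y"
  shows "wedge K R S \<in> Arrs B X Y" "wpi K R S \<in> Cells B (wedge K R S) R"
    "wrho K R S \<in> Cells B (wedge K R S) S"
proof -
  have "wedge K R S \<in> Arrs B X Y \<and> wpi K R S \<in> Hom (hom_cat B X Y) (wedge K R S) R
      \<and> wrho K R S \<in> Hom (hom_cat B X Y) (wedge K R S) S"
    using chosen_wedge[OF assms] unfolding is_product_def hom_cat_simps by blast
  then show "wedge K R S \<in> Arrs B X Y" "wpi K R S \<in> Cells B (wedge K R S) R"
    "wrho K R S \<in> Cells B (wedge K R S) S"
    by (auto simp: Hom_hom_cat_iff Cells_def)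
qed

lemma wedge_universal:
  assumes "R \<in> Arrs B X Y" "S \<in> Arrs B X Y" "Q \<in> Arrs B X Y" "\<alpha> \<in> Cells B Q R" "\<beta> \<in> Cells B Q S"
  shows "\<exists>!\<gamma>. \<gamma> \<in> Cells B Q (wedge K R S) \<and> wpi K R S \<cdot> \<gamma> = \<alpha> \<and> wrho K R S \<cdot> \<gamma> = \<beta>"
proof -
  have "\<alpha> \<in> Hom (hom_cat B X Y) Q R" "\<beta> \<in> Hom (hom_cat B X Y) Q S"
    using assms by (auto simp: Hom_hom_cat_iff Cells_def)
  moreover have "Hom (hom_cat B X Y) Q (wedge K R S) = Cells B Q (wedge K R S)"
    using assms(3) wedge_facts(1)[OF assms(1,2)] by (auto simp: Hom_hom_cat_iff Cells_def)
  moreover have "\<forall>c\<in>Arrs B X Y. \<forall>f\<in>Hom (hom_cat B X Y) c R. \<forall>g\<in>Hom (hom_cat B X Y) c S.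
      \<exists>!h. h \<in> Hom (hom_cat B X Y) c (wedge K R S) \<and> wpi K R S \<cdot> h = f \<and> wrho K R S \<cdot> h = g"
    using chosen_wedge[OF assms(1,2)] unfolding is_product_def hom_cat_simps by blast
  ultimately show ?thesis
    using assms(3) by metis
qed

section \<open>The universal property of the tensor product\<close>

lemma tensor_arr_in:
  assumes "R \<in> Arrs B X A" "S \<in> Arrs B Y D"
  shows "R \<otimes> S \<in> Arrs B (P X Y) (P A D)"
  unfolding tensor_arr_def using wedge_facts(1)[OF tensor_factors(5,6)[OF assms]] .

text \<open>Holds by definition. Recognising the tilde cells as transposes of the product
  projections is what makes the adjunction lemmas available.\<close>

lemma tilde_transpose:
  assumes "R \<in> Arrs B X A" "S \<in> Arrs B Y D"
  shows "p_tilde B K R S = adj_transpose B (p A D) (radj K (p A D)) (rcounit K (p A D)) (R \<odot> p X Y)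
      (wpi K (tensor_fst B K R S) (tensor_snd B K R S))"
    and "r_tilde B K R S = adj_transpose B (r A D) (radj K (r A D)) (rcounit K (r A D)) (S \<odot> r X Y)
      (wrho K (tensor_fst B K R S) (tensor_snd B K R S))"
  using ArrsD[OF assms(1)] ArrsD[OF assms(2)]
  by (simp_all add: p_tilde_def r_tilde_def adj_transpose_def Let_def)

lemma tilde_VComp:
  assumes R: "R \<in> Arrs B X A" and S: "S \<in> Arrs B Y D" and Q: "Q \<in> Arrs B (P X Y) (P A D)"
    and \<gamma>: "\<gamma> \<in> Cells B Q (R \<otimes> S)"
  shows "p_tilde B K R S \<cdot> (CellId B (p A D) \<star> \<gamma>) = adj_transpose B (p A D) (radj K (p A D))
      (rcounit K (p A D)) (R \<odot> p X Y) (wpi K (tensor_fst B K R S) (tensor_snd B K R S) \<cdot> \<gamma>)"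
    and "r_tilde B K R S \<cdot> (CellId B (r A D) \<star> \<gamma>) = adj_transpose B (r A D) (radj K (r A D))
      (rcounit K (r A D)) (S \<odot> r X Y) (wrho K (tensor_fst B K R S) (tensor_snd B K R S) \<cdot> \<gamma>)"
proof -
  note obj = ArrsD[OF R] ArrsD[OF S]
  interpret p: adjoint_pair B "p A D" "radj K (p A D)" "runit K (p A D)" "rcounit K (p A D)" "P A D" A
    using obj by (intro projection_adjoints)
  interpret r: adjoint_pair B "r A D" "radj K (r A D)" "runit K (r A D)" "rcounit K (r A D)" "P A D" D
    using obj by (intro projection_adjoints)
  note f = tensor_factors[OF R S]
  note w = wedge_facts[OF f(5,6)]
  note [simp] = ArrsD[OF f(1)] ArrsD[OF f(2)] ArrsD[OF tensor_arr_in[OF R S]] ArrsD[OF Q] CellsD[OF \<gamma>]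
    CellsD[OF w(2), folded tensor_arr_def] CellsD[OF w(3), folded tensor_arr_def] f(3,4)[symmetric]
  show "p_tilde B K R S \<cdot> (CellId B (p A D) \<star> \<gamma>) = adj_transpose B (p A D) (radj K (p A D))
      (rcounit K (p A D)) (R \<odot> p X Y) (wpi K (tensor_fst B K R S) (tensor_snd B K R S) \<cdot> \<gamma>)"
    unfolding tilde_transpose(1)[OF R S] by (rule p.transpose_VComp[symmetric]) simp_all
  show "r_tilde B K R S \<cdot> (CellId B (r A D) \<star> \<gamma>) = adj_transpose B (r A D) (radj K (r A D))
      (rcounit K (r A D)) (S \<odot> r X Y) (wrho K (tensor_fst B K R S) (tensor_snd B K R S) \<cdot> \<gamma>)"
    unfolding tilde_transpose(2)[OF R S] by (rule r.transpose_VComp[symmetric]) simp_all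
qed

lemma tilde_in:
  assumes R: "R \<in> Arrs B X A" and S: "S \<in> Arrs B Y D"
  shows "p_tilde B K R S \<in> Cells B (p A D \<odot> (R \<otimes> S)) (R \<odot> p X Y)"
    and "r_tilde B K R S \<in> Cells B (r A D \<odot> (R \<otimes> S)) (S \<odot> r X Y)"
proof -
  note obj = ArrsD[OF R] ArrsD[OF S]
  interpret p: adjoint_pair B "p A D" "radj K (p A D)" "runit K (p A D)" "rcounit K (p A D)" "P A D" A
    using obj by (intro projection_adjoints)
  interpret r: adjoint_pair B "r A D" "radj K (r A D)" "runit K (r A D)" "rcounit K (r A D)" "P A D" D
    using obj by (intro projection_adjoints)
  note f = tensor_factors[OF R S]
  note w = wedge_facts[OF f(5,6)]
  note [simp] = ArrsD[OF f(1)] ArrsD[OF f(2)] ArrsD[OF tensor_arr_in[OF R S]]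
    CellsD[OF w(2), folded tensor_arr_def] CellsD[OF w(3), folded tensor_arr_def] f(3,4)[symmetric]
  show "p_tilde B K R S \<in> Cells B (p A D \<odot> (R \<otimes> S)) (R \<odot> p X Y)"
    "r_tilde B K R S \<in> Cells B (r A D \<odot> (R \<otimes> S)) (S \<odot> r X Y)"
    unfolding tilde_transpose[OF R S] by (simp_all add: Cells_def)
qed

text \<open>The two transposition bijections turn the prescribed cells d and e into a pair of cells
  from Q to the two factors of the local product, where existence and uniqueness are known.\<close>

lemma tensor_universal:
  assumes R: "R \<in> Arrs B X A" and S: "S \<in> Arrs B Y D" and Q: "Q \<in> Arrs B (P X Y) (P A D)"
    and d: "d \<in> Cells B (p A D \<odot> Q) (R \<odot> p X Y)" and e: "e \<in> Cells B (r A D \<odot> Q) (S \<odot> r X Y)"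
  shows "\<exists>!\<gamma>. \<gamma> \<in> Cells B Q (R \<otimes> S) \<and>
    p_tilde B K R S \<cdot> (CellId B (p A D) \<star> \<gamma>) = d \<and> r_tilde B K R S \<cdot> (CellId B (r A D) \<star> \<gamma>) = e"
proof -
  note obj = ArrsD[OF R] ArrsD[OF S]
  interpret p: adjoint_pair B "p A D" "radj K (p A D)" "runit K (p A D)" "rcounit K (p A D)" "P A D" A
    using obj by (intro projection_adjoints)
  interpret r: adjoint_pair B "r A D" "radj K (r A D)" "runit K (r A D)" "rcounit K (r A D)" "P A D" D
    using obj by (intro projection_adjoints)
  note f = tensor_factors[OF R S]
  note w = wedge_facts[OF f(5,6)]
  let ?tp = "adj_transpose B (p A D) (radj K (p A D)) (rcounit K (p A D)) (R \<odot> p X Y)"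
  let ?tr = "adj_transpose B (r A D) (radj K (r A D)) (rcounit K (r A D)) (S \<odot> r X Y)"
  let ?pi = "wpi K (tensor_fst B K R S) (tensor_snd B K R S)"
    and ?rho = "wrho K (tensor_fst B K R S) (tensor_snd B K R S)"
  have bp: "bij_betw ?tp (Cells B Q (tensor_fst B K R S)) (Cells B (p A D \<odot> Q) (R \<odot> p X Y))"
    unfolding f(3) by (rule p.transpose_bij[OF f(1) Q])
  have br: "bij_betw ?tr (Cells B Q (tensor_snd B K R S)) (Cells B (r A D \<odot> Q) (S \<odot> r X Y))"
    unfolding f(4) by (rule r.transpose_bij[OF f(2) Q])
  \<comment> \<open>Surjectivity of transposition provides the components that the local product can
    pair.\<close>
  obtain d' where d': "d' \<in> Cells B Q (tensor_fst B K R S)" "?tp d' = d"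
    using d unfolding bij_betw_imp_surj_on[OF bp, symmetric] by blast
  obtain e' where e': "e' \<in> Cells B Q (tensor_snd B K R S)" "?tr e' = e"
    using e unfolding bij_betw_imp_surj_on[OF br, symmetric] by blast
  have comp_in: "?pi \<cdot> \<gamma> \<in> Cells B Q (tensor_fst B K R S)" "?rho \<cdot> \<gamma> \<in> Cells B Q (tensor_snd B K R S)"
    if "\<gamma> \<in> Cells B Q (R \<otimes> S)" for \<gamma>
  proof -
    note [simp] = CellsD[OF that] CellsD[OF w(2), folded tensor_arr_def]
      CellsD[OF w(3), folded tensor_arr_def]
    show "?pi \<cdot> \<gamma> \<in> Cells B Q (tensor_fst B K R S)" "?rho \<cdot> \<gamma> \<in> Cells B Q (tensor_snd B K R S)"
      by (simp_all add: Cells_def)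
  qed
  \<comment> \<open>Injectivity of transposition makes the conditions on tilde composites equivalent
    to those on product components, so both describe the same cell.\<close>
  have *: "\<gamma> \<in> Cells B Q (R \<otimes> S) \<and>
      p_tilde B K R S \<cdot> (CellId B (p A D) \<star> \<gamma>) = d \<and> r_tilde B K R S \<cdot> (CellId B (r A D) \<star> \<gamma>) = e
    \<longleftrightarrow> \<gamma> \<in> Cells B Q (R \<otimes> S) \<and> ?pi \<cdot> \<gamma> = d' \<and> ?rho \<cdot> \<gamma> = e'" for \<gamma>
  proof (rule conj_cong)
    assume \<gamma>: "\<gamma> \<in> Cells B Q (R \<otimes> S)"
    show "p_tilde B K R S \<cdot> (CellId B (p A D) \<star> \<gamma>) = d \<and> r_tilde B K R S \<cdot> (CellId B (r A D) \<star> \<gamma>) = e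
      \<longleftrightarrow> ?pi \<cdot> \<gamma> = d' \<and> ?rho \<cdot> \<gamma> = e'"
      unfolding tilde_VComp[OF R S Q \<gamma>] d'(2)[symmetric] e'(2)[symmetric]
        inj_on_eq_iff[OF bij_betw_imp_inj_on[OF bp] comp_in(1)[OF \<gamma>] d'(1)]
        inj_on_eq_iff[OF bij_betw_imp_inj_on[OF br] comp_in(2)[OF \<gamma>] e'(1)] ..
  qed (rule refl)
  have "\<exists>!\<gamma>. \<gamma> \<in> Cells B Q (R \<otimes> S) \<and> ?pi \<cdot> \<gamma> = d' \<and> ?rho \<cdot> \<gamma> = e'"
    unfolding tensor_arr_def by (rule wedge_universal[OF f(5,6) Q d'(1) e'(1)])
  then show ?thesis
    unfolding * .
qed

text \<open>The tilde cells are jointly monic after whiskering with p and r. Every later equation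
  between cells into a tensor product is split by this rule into one equation of squares over p and
  one over r.\<close>

lemma tensor_eqI:
  assumes "R \<in> Arrs B X A" "S \<in> Arrs B Y D"
    and "\<gamma> \<in> Cells B Q (R \<otimes> S)" "\<gamma>' \<in> Cells B Q (R \<otimes> S)"
    and "p_tilde B K R S \<cdot> (CellId B (p A D) \<star> \<gamma>) = p_tilde B K R S \<cdot> (CellId B (p A D) \<star> \<gamma>')"
    and "r_tilde B K R S \<cdot> (CellId B (r A D) \<star> \<gamma>) = r_tilde B K R S \<cdot> (CellId B (r A D) \<star> \<gamma>')"
  shows "\<gamma> = \<gamma>'"
proof -
  note t = tensor_arr_in[OF assms(1,2)]
  note obj = ArrsD[OF assms(1)] ArrsD[OF assms(2)]
  note [simp] = ArrsD[OF t] CellsD[OF assms(3)] obj ArrsD[OF projections(2)[OF obj(5,10)]]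
    ArrsD[OF projections(3)[OF obj(5,10)]] CellsD[OF tilde_in(1)[OF assms(1,2)]]
    CellsD[OF tilde_in(2)[OF assms(1,2)]]
  \<comment> \<open>The endpoints of Q are those of \<open>R \<otimes> S\<close>, because the
    boundaries of \<open>\<gamma>\<close> are parallel.\<close>
  have Q: "Q \<in> Arrs B (P X Y) (P A D)"
    using Cdom_in[of \<gamma>] Src_parallel[of \<gamma>] Tgt_parallel[of \<gamma>] by (simp add: Arrs_def)
  have "p_tilde B K R S \<cdot> (CellId B (p A D) \<star> \<gamma>) \<in> Cells B (p A D \<odot> Q) (R \<odot> p X Y)"
    "r_tilde B K R S \<cdot> (CellId B (r A D) \<star> \<gamma>) \<in> Cells B (r A D \<odot> Q) (S \<odot> r X Y)"
    using ArrsD[OF Q] by (simp_all add: Cells_def)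
  from tensor_universal[OF assms(1,2) Q this] show ?thesis
    using assms(3-6) by metis
qed

section \<open>The tensor product on 2-cells\<close>

text \<open>The definition of \<open>tensor_cell\<close> speaks of untransposed components.
  Transposing them removes the whiskering by the right adjoints and leaves the naturality squares of
  the tilde cells, the form in which the tensor of cells is used from here on.\<close>

lemma tensor_cell_props:
  assumes R: "R \<in> Arrs B X A" and S: "S \<in> Arrs B Y D" and R': "R' \<in> Arrs B X A" and S': "S' \<in> Arrs B Y D"
    and \<alpha>: "\<alpha> \<in> Cells B R R'" and \<beta>: "\<beta> \<in> Cells B S S'"
  shows "tensor_cell B K \<alpha> \<beta> \<in> Cells B (R \<otimes> S) (R' \<otimes> S')" (is ?t1)
    and "p_tilde B K R' S' \<cdot> (CellId B (p A D) \<star> tensor_cell B K \<alpha> \<beta>)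
      = (\<alpha> \<star> CellId B (p X Y)) \<cdot> p_tilde B K R S" (is ?t2)
    and "r_tilde B K R' S' \<cdot> (CellId B (r A D) \<star> tensor_cell B K \<alpha> \<beta>)
      = (\<beta> \<star> CellId B (r X Y)) \<cdot> r_tilde B K R S" (is ?t3)
proof -
  note obj = ArrsD[OF R] ArrsD[OF S]
  interpret p: adjoint_pair B "p A D" "radj K (p A D)" "runit K (p A D)" "rcounit K (p A D)" "P A D" A
    using obj by (intro projection_adjoints)
  interpret r: adjoint_pair B "r A D" "radj K (r A D)" "runit K (r A D)" "rcounit K (r A D)" "P A D" D
    using obj by (intro projection_adjoints)
  note f = tensor_factors[OF R S] and f' = tensor_factors[OF R' S']
  note w = wedge_facts[OF f(5,6)] and w' = wedge_facts[OF f'(5,6)]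
  note [simp] = obj ArrsD[OF R'] ArrsD[OF S'] CellsD[OF \<alpha>] CellsD[OF \<beta>]
    ArrsD[OF projections(2)[OF obj(4,9)]] ArrsD[OF projections(3)[OF obj(4,9)]]
    CellsD[OF w(2), folded tensor_arr_def] CellsD[OF w(3), folded tensor_arr_def]
    ArrsD[OF tensor_arr_in[OF R S]]
  let ?pi = "wpi K (tensor_fst B K R S) (tensor_snd B K R S)"
    and ?rho = "wrho K (tensor_fst B K R S) (tensor_snd B K R S)"
    and ?pi' = "wpi K (tensor_fst B K R' S') (tensor_snd B K R' S')"
    and ?rho' = "wrho K (tensor_fst B K R' S') (tensor_snd B K R' S')"
  let ?a = "CellId B (radj K (p A D)) \<star> (\<alpha> \<star> CellId B (p X Y))"
    and ?b = "CellId B (radj K (r A D)) \<star> (\<beta> \<star> CellId B (r X Y))"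
  \<comment> \<open>\<open>wedge_cell\<close> reads the factors of its two products off the
    boundaries of the whiskered cells; these boundaries are identified with the factors of the
    tensor products here.\<close>
  have a: "Cdom B ?a = tensor_fst B K R S" "Ccod B ?a = tensor_fst B K R' S'"
    and b: "Cdom B ?b = tensor_snd B K R S" "Ccod B ?b = tensor_snd B K R' S'"
    unfolding f(3,4) f'(3,4) by simp_all
  have "?a \<cdot> ?pi \<in> Cells B (R \<otimes> S) (tensor_fst B K R' S')"
    "?b \<cdot> ?rho \<in> Cells B (R \<otimes> S) (tensor_snd B K R' S')"
    by (simp_all add: Cells_def f(3,4)[symmetric] f'(3,4)[symmetric])
  from wedge_universal[OF f'(5,6) tensor_arr_in[OF R S] this]
  have "\<exists>!\<gamma>. \<gamma> \<in> Cells B (R \<otimes> S) (R' \<otimes> S') \<and> ?pi' \<cdot> \<gamma> = ?a \<cdot> ?pi \<and> ?rho' \<cdot> \<gamma> = ?b \<cdot> ?rho"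
    unfolding tensor_arr_def .
  moreover have "tensor_cell B K \<alpha> \<beta> = (THE \<gamma>. \<gamma> \<in> Cells B (R \<otimes> S) (R' \<otimes> S') \<and>
      ?pi' \<cdot> \<gamma> = ?a \<cdot> ?pi \<and> ?rho' \<cdot> \<gamma> = ?b \<cdot> ?rho)"
    unfolding tensor_cell_def wedge_cell_def Let_def tensor_arr_def CellsD[OF \<alpha>] CellsD[OF \<beta>]
      ArrsD(2,3)[OF R] ArrsD(2,3)[OF S] a b ..
  ultimately have t: "tensor_cell B K \<alpha> \<beta> \<in> Cells B (R \<otimes> S) (R' \<otimes> S')"
    "?pi' \<cdot> tensor_cell B K \<alpha> \<beta> = ?a \<cdot> ?pi" "?rho' \<cdot> tensor_cell B K \<alpha> \<beta> = ?b \<cdot> ?rho"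
    using theI'[of "\<lambda>\<gamma>. \<gamma> \<in> Cells B (R \<otimes> S) (R' \<otimes> S') \<and> ?pi' \<cdot> \<gamma> = ?a \<cdot> ?pi \<and> ?rho' \<cdot> \<gamma> = ?b \<cdot> ?rho"]
    by simp_all
  show ?t1 by (fact t(1))
  \<comment> \<open>With \<open>\<zeta>\<close> taken to be \<open>\<alpha>\<close> whiskered by p,
    naturality of transposition in the codomain gives the square.\<close>
  show ?t2
    unfolding tilde_VComp(1)[OF R' S' tensor_arr_in[OF R S] t(1)] t(2)
      tilde_transpose(1)[OF R S]
    using p.transpose_natural[of "\<alpha> \<star> CellId B (p X Y)" ?pi] by (simp add: f(3)[symmetric])
  show ?t3
    unfolding tilde_VComp(2)[OF R' S' tensor_arr_in[OF R S] t(1)] t(3)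
      tilde_transpose(2)[OF R S]
    using r.transpose_natural[of "\<beta> \<star> CellId B (r X Y)" ?rho] by (simp add: f(4)[symmetric])
qed

lemma tensor_cell_CellId:
  assumes R: "R \<in> Arrs B X A" and S: "S \<in> Arrs B Y D"
  shows "tensor_cell B K (CellId B R) (CellId B S) = CellId B (R \<otimes> S)"
proof (rule tensor_eqI[OF R S])
  note obj = ArrsD[OF R] ArrsD[OF S]
  note [simp] = obj ArrsD[OF projections(2)[OF obj(4,9)]] ArrsD[OF projections(3)[OF obj(4,9)]]
    ArrsD[OF projections(2)[OF obj(5,10)]] ArrsD[OF projections(3)[OF obj(5,10)]]
    ArrsD[OF tensor_arr_in[OF R S]] CellsD[OF tilde_in(1)[OF R S]] CellsD[OF tilde_in(2)[OF R S]]
  have c: "CellId B R \<in> Cells B R R" "CellId B S \<in> Cells B S S"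
    by (simp_all add: Cells_def)
  note t = tensor_cell_props[OF R S R S c]
  show "tensor_cell B K (CellId B R) (CellId B S) \<in> Cells B (R \<otimes> S) (R \<otimes> S)"
    by (fact t(1))
  show "CellId B (R \<otimes> S) \<in> Cells B (R \<otimes> S) (R \<otimes> S)"
    by (simp add: Cells_def)
  show "p_tilde B K R S \<cdot> (CellId B (p A D) \<star> tensor_cell B K (CellId B R) (CellId B S)) =
      p_tilde B K R S \<cdot> (CellId B (p A D) \<star> CellId B (R \<otimes> S))"
    "r_tilde B K R S \<cdot> (CellId B (r A D) \<star> tensor_cell B K (CellId B R) (CellId B S)) =
      r_tilde B K R S \<cdot> (CellId B (r A D) \<star> CellId B (R \<otimes> S))"
    unfolding t by simp_all
qed

text \<open>Two naturality squares of a tilde cell composed vertically form the naturality square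
  for the composite cells.\<close>

lemma tensor_cell_VComp:
  assumes R: "R \<in> Arrs B X A" and S: "S \<in> Arrs B Y D" and R': "R' \<in> Arrs B X A" and S': "S' \<in> Arrs B Y D"
    and R'': "R'' \<in> Arrs B X A" and S'': "S'' \<in> Arrs B Y D"
    and \<alpha>: "\<alpha> \<in> Cells B R R'" and \<beta>: "\<beta> \<in> Cells B S S'"
    and \<alpha>': "\<alpha>' \<in> Cells B R' R''" and \<beta>': "\<beta>' \<in> Cells B S' S''"
  shows "tensor_cell B K (\<alpha>' \<cdot> \<alpha>) (\<beta>' \<cdot> \<beta>) = tensor_cell B K \<alpha>' \<beta>' \<cdot> tensor_cell B K \<alpha> \<beta>"
proof -
  note obj = ArrsD[OF R] ArrsD[OF S]
  note t = tensor_cell_props[OF R S R' S' \<alpha> \<beta>] and t' = tensor_cell_props[OF R' S' R'' S'' \<alpha>' \<beta>']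
  note [simp] = obj ArrsD[OF projections(2)[OF obj(4,9)]] ArrsD[OF projections(3)[OF obj(4,9)]]
    ArrsD[OF projections(2)[OF obj(5,10)]] ArrsD[OF projections(3)[OF obj(5,10)]]
    ArrsD[OF R'] ArrsD[OF S'] ArrsD[OF R''] ArrsD[OF S'']
    CellsD[OF \<alpha>] CellsD[OF \<beta>] CellsD[OF \<alpha>'] CellsD[OF \<beta>'] CellsD[OF t(1)] CellsD[OF t'(1)]
    ArrsD[OF tensor_arr_in[OF R S]] CellsD[OF tilde_in(1)[OF R S]] CellsD[OF tilde_in(2)[OF R S]]
    ArrsD[OF tensor_arr_in[OF R' S']] CellsD[OF tilde_in(1)[OF R' S']] CellsD[OF tilde_in(2)[OF R' S']]
    ArrsD[OF tensor_arr_in[OF R'' S'']] CellsD[OF tilde_in(1)[OF R'' S'']] CellsD[OF tilde_in(2)[OF R'' S'']]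
  have c: "\<alpha>' \<cdot> \<alpha> \<in> Cells B R R''" "\<beta>' \<cdot> \<beta> \<in> Cells B S S''"
    by (simp_all add: Cells_def)
  note t'' = tensor_cell_props[OF R S R'' S'' c]
  show ?thesis
  proof (rule tensor_eqI[OF R'' S''])
    show "tensor_cell B K (\<alpha>' \<cdot> \<alpha>) (\<beta>' \<cdot> \<beta>) \<in> Cells B (R \<otimes> S) (R'' \<otimes> S'')"
      by (fact t'')
    show "tensor_cell B K \<alpha>' \<beta>' \<cdot> tensor_cell B K \<alpha> \<beta> \<in> Cells B (R \<otimes> S) (R'' \<otimes> S'')"
      by (simp add: Cells_def)
    have "p_tilde B K R'' S'' \<cdot> (CellId B (p A D) \<star> (tensor_cell B K \<alpha>' \<beta>' \<cdot> tensor_cell B K \<alpha> \<beta>))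
        = (p_tilde B K R'' S'' \<cdot> (CellId B (p A D) \<star> tensor_cell B K \<alpha>' \<beta>'))
          \<cdot> (CellId B (p A D) \<star> tensor_cell B K \<alpha> \<beta>)"
      by (simp add: lwhisker_VComp VComp_assoc)
    also have "\<dots> = (\<alpha>' \<star> CellId B (p X Y)) \<cdot> p_tilde B K R' S' \<cdot> (CellId B (p A D) \<star> tensor_cell B K \<alpha> \<beta>)"
      unfolding t'(2) by (simp add: VComp_assoc)
    also have "\<dots> = p_tilde B K R'' S'' \<cdot> (CellId B (p A D) \<star> tensor_cell B K (\<alpha>' \<cdot> \<alpha>) (\<beta>' \<cdot> \<beta>))"
      unfolding t(2) t''(2) by (simp add: rwhisker_VComp VComp_assoc)
    finally show "p_tilde B K R'' S'' \<cdot> (CellId B (p A D) \<star> tensor_cell B K (\<alpha>' \<cdot> \<alpha>) (\<beta>' \<cdot> \<beta>))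
      = p_tilde B K R'' S'' \<cdot> (CellId B (p A D) \<star> (tensor_cell B K \<alpha>' \<beta>' \<cdot> tensor_cell B K \<alpha> \<beta>))" ..
    have "r_tilde B K R'' S'' \<cdot> (CellId B (r A D) \<star> (tensor_cell B K \<alpha>' \<beta>' \<cdot> tensor_cell B K \<alpha> \<beta>))
        = (r_tilde B K R'' S'' \<cdot> (CellId B (r A D) \<star> tensor_cell B K \<alpha>' \<beta>'))
          \<cdot> (CellId B (r A D) \<star> tensor_cell B K \<alpha> \<beta>)"
      by (simp add: lwhisker_VComp VComp_assoc)
    also have "\<dots> = (\<beta>' \<star> CellId B (r X Y)) \<cdot> r_tilde B K R' S' \<cdot> (CellId B (r A D) \<star> tensor_cell B K \<alpha> \<beta>)"
      unfolding t'(3) by (simp add: VComp_assoc)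
    also have "\<dots> = r_tilde B K R'' S'' \<cdot> (CellId B (r A D) \<star> tensor_cell B K (\<alpha>' \<cdot> \<alpha>) (\<beta>' \<cdot> \<beta>))"
      unfolding t(3) t''(3) by (simp add: rwhisker_VComp VComp_assoc)
    finally show "r_tilde B K R'' S'' \<cdot> (CellId B (r A D) \<star> tensor_cell B K (\<alpha>' \<cdot> \<alpha>) (\<beta>' \<cdot> \<beta>))
      = r_tilde B K R'' S'' \<cdot> (CellId B (r A D) \<star> (tensor_cell B K \<alpha>' \<beta>' \<cdot> tensor_cell B K \<alpha> \<beta>))" ..
  qed
qed

section \<open>The unit and composition constraints\<close>

text \<open>By normality p1 = p = 1p, so the identity cell of p is itself a square of the required
  type, and likewise for r. The universal property then yields the constraint.\<close>

lemma tensor_unit_props: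
  assumes X: "X \<in> Obj B" and Y: "Y \<in> Obj B"
  shows "tensor_unit B K X Y \<in> Cells B (One B (P X Y)) (One B X \<otimes> One B Y)"
    and "p_tilde B K (One B X) (One B Y) \<cdot> (CellId B (p X Y) \<star> tensor_unit B K X Y) = CellId B (p X Y)"
    and "r_tilde B K (One B X) (One B Y) \<cdot> (CellId B (r X Y) \<star> tensor_unit B K X Y) = CellId B (r X Y)"
proof -
  note pr = projections[OF X Y]
  note [simp] = X Y ArrsD[OF pr(2)] ArrsD[OF pr(3)]
  have "CellId B (p X Y) \<in> Cells B (p X Y \<odot> One B (P X Y)) (One B X \<odot> p X Y)"
    "CellId B (r X Y) \<in> Cells B (r X Y \<odot> One B (P X Y)) (One B Y \<odot> r X Y)"
    by (simp_all add: Cells_def)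
  from theI'[OF tensor_universal[OF One_in[OF X] One_in[OF Y] One_in[OF pr(1)] this]]
  show "tensor_unit B K X Y \<in> Cells B (One B (P X Y)) (One B X \<otimes> One B Y)"
    "p_tilde B K (One B X) (One B Y) \<cdot> (CellId B (p X Y) \<star> tensor_unit B K X Y) = CellId B (p X Y)"
    "r_tilde B K (One B X) (One B Y) \<cdot> (CellId B (r X Y) \<star> tensor_unit B K X Y) = CellId B (r X Y)"
    unfolding tensor_unit_def by auto
qed

lemma ArrComp_in: "R \<in> Arrs B X Y \<Longrightarrow> S \<in> Arrs B Y Z \<Longrightarrow> S \<odot> R \<in> Arrs B X Z"
  by (simp add: Arrs_def)

text \<open>The composites written out in the definition of \<open>tensor_comp\<close> are literally
  values of \<open>paste\<close>. These have the right boundaries, so the universal property applies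
  and the definite description denotes.\<close>

lemma tensor_comp_props:
  assumes R: "R \<in> Arrs B X A" and S: "S \<in> Arrs B Y D" and T: "T \<in> Arrs B A L" and U: "U \<in> Arrs B D M"
  shows "tensor_comp B K T U R S \<in> Cells B ((T \<otimes> U) \<odot> (R \<otimes> S)) ((T \<odot> R) \<otimes> (U \<odot> S))"
    and "p_tilde B K (T \<odot> R) (U \<odot> S) \<cdot> (CellId B (p L M) \<star> tensor_comp B K T U R S) =
      paste B (p X Y) (p A D) (p L M) (R \<otimes> S) R (T \<otimes> U) T (p_tilde B K T U) (p_tilde B K R S)"
    and "r_tilde B K (T \<odot> R) (U \<odot> S) \<cdot> (CellId B (r L M) \<star> tensor_comp B K T U R S) =
      paste B (r X Y) (r A D) (r L M) (R \<otimes> S) S (T \<otimes> U) U (r_tilde B K T U) (r_tilde B K R S)"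
proof -
  note obj = ArrsD[OF R] ArrsD[OF S] and obj' = ArrsD[OF T] ArrsD[OF U]
  note RS = tensor_arr_in[OF R S] and TU = tensor_arr_in[OF T U]
  note pr = projections[OF obj(4,9)] projections[OF obj(5,10)] projections[OF obj'(5,10)]
  have "paste B (p X Y) (p A D) (p L M) (R \<otimes> S) R (T \<otimes> U) T (p_tilde B K T U) (p_tilde B K R S)
      \<in> Cells B (p L M \<odot> ((T \<otimes> U) \<odot> (R \<otimes> S))) ((T \<odot> R) \<odot> p X Y)"
    by (rule paste_in) (fact pr R S T U RS TU tilde_in[OF R S] tilde_in[OF T U])+
  moreover have "paste B (r X Y) (r A D) (r L M) (R \<otimes> S) S (T \<otimes> U) U (r_tilde B K T U) (r_tilde B K R S)
      \<in> Cells B (r L M \<odot> ((T \<otimes> U) \<odot> (R \<otimes> S))) ((U \<odot> S) \<odot> r X Y)"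
    by (rule paste_in) (fact pr R S T U RS TU tilde_in[OF R S] tilde_in[OF T U])+
  ultimately have "\<exists>!\<gamma>. \<gamma> \<in> Cells B ((T \<otimes> U) \<odot> (R \<otimes> S)) ((T \<odot> R) \<otimes> (U \<odot> S)) \<and>
    p_tilde B K (T \<odot> R) (U \<odot> S) \<cdot> (CellId B (p L M) \<star> \<gamma>) =
      paste B (p X Y) (p A D) (p L M) (R \<otimes> S) R (T \<otimes> U) T (p_tilde B K T U) (p_tilde B K R S) \<and>
    r_tilde B K (T \<odot> R) (U \<odot> S) \<cdot> (CellId B (r L M) \<star> \<gamma>) =
      paste B (r X Y) (r A D) (r L M) (R \<otimes> S) S (T \<otimes> U) U (r_tilde B K T U) (r_tilde B K R S)"
    by (rule tensor_universal[OF ArrComp_in[OF R T] ArrComp_in[OF S U] ArrComp_in[OF RS TU]])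
  from theI'[OF this]
  show "tensor_comp B K T U R S \<in> Cells B ((T \<otimes> U) \<odot> (R \<otimes> S)) ((T \<odot> R) \<otimes> (U \<odot> S))"
    "p_tilde B K (T \<odot> R) (U \<odot> S) \<cdot> (CellId B (p L M) \<star> tensor_comp B K T U R S) =
      paste B (p X Y) (p A D) (p L M) (R \<otimes> S) R (T \<otimes> U) T (p_tilde B K T U) (p_tilde B K R S)"
    "r_tilde B K (T \<odot> R) (U \<odot> S) \<cdot> (CellId B (r L M) \<star> tensor_comp B K T U R S) =
      paste B (r X Y) (r A D) (r L M) (R \<otimes> S) S (T \<otimes> U) U (r_tilde B K T U) (r_tilde B K R S)"
    unfolding tensor_comp_def Let_def paste_def ArrsD(2,3)[OF R] ArrsD(2,3)[OF S]
      ArrsD(2,3)[OF T] ArrsD(2,3)[OF U]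
    by blast+
qed

section \<open>The axioms for the constraints\<close>

text \<open>Over each projection the constraint becomes a pasting. Cells entering on the domain side
  are absorbed into its squares, pass through them by naturality of the tilde cells, and leave on
  the codomain side as one horizontal composite.\<close>

lemma tensor_comp_natural:
  assumes R: "R \<in> Arrs B X A" and S: "S \<in> Arrs B Y D" and T: "T \<in> Arrs B A L" and U: "U \<in> Arrs B D M"
    and R': "R' \<in> Arrs B X A" and S': "S' \<in> Arrs B Y D" and T': "T' \<in> Arrs B A L" and U': "U' \<in> Arrs B D M"
    and \<alpha>: "\<alpha> \<in> Cells B R R'" and \<beta>: "\<beta> \<in> Cells B S S'"
    and \<gamma>: "\<gamma> \<in> Cells B T T'" and \<delta>: "\<delta> \<in> Cells B U U'"
  shows "tensor_comp B K T' U' R' S' \<cdot> (tensor_cell B K \<gamma> \<delta> \<star> tensor_cell B K \<alpha> \<beta>) =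
    tensor_cell B K (\<gamma> \<star> \<alpha>) (\<delta> \<star> \<beta>) \<cdot> tensor_comp B K T U R S"
proof -
  note obj = ArrsD[OF R] ArrsD[OF S] and obj' = ArrsD[OF T] ArrsD[OF U]
  note pr = projections[OF obj(4,9)] projections[OF obj(5,10)] projections[OF obj'(5,10)]
  note RS = tensor_arr_in[OF R S] and TU = tensor_arr_in[OF T U]
    and RS' = tensor_arr_in[OF R' S'] and TU' = tensor_arr_in[OF T' U']
  note TR = ArrComp_in[OF R T] and US = ArrComp_in[OF S U]
    and TR' = ArrComp_in[OF R' T'] and US' = ArrComp_in[OF S' U']
  note c = tensor_comp_props[OF R S T U] and c' = tensor_comp_props[OF R' S' T' U']
  note x = tilde_in[OF R S] tilde_in[OF T U] and x' = tilde_in[OF R' S'] tilde_in[OF T' U']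
  note t1 = tensor_cell_props[OF R S R' S' \<alpha> \<beta>] and t2 = tensor_cell_props[OF T U T' U' \<gamma> \<delta>]
  note ty = obj obj' ArrsD[OF R'] ArrsD[OF S'] ArrsD[OF T'] ArrsD[OF U']
    CellsD[OF \<alpha>] CellsD[OF \<beta>] CellsD[OF \<gamma>] CellsD[OF \<delta>]
  have "\<gamma> \<star> \<alpha> \<in> Cells B (T \<odot> R) (T' \<odot> R')" "\<delta> \<star> \<beta> \<in> Cells B (U \<odot> S) (U' \<odot> S')"
    by (simp_all add: Cells_def ty)
  note t3 = tensor_cell_props[OF TR US TR' US' this]
  note [simp] = ty CellsD[OF t1(1)] CellsD[OF t2(1)] CellsD[OF t3(1)] CellsD[OF c(1)] CellsD[OF c'(1)]
    ArrsD[OF pr(2)] ArrsD[OF pr(3)] ArrsD[OF pr(7)] ArrsD[OF pr(8)] ArrsD[OF pr(12)] ArrsD[OF pr(13)]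
    ArrsD[OF RS] ArrsD[OF TU] ArrsD[OF RS'] ArrsD[OF TU']
    ArrsD[OF tensor_arr_in[OF TR US]] ArrsD[OF tensor_arr_in[OF TR' US']]
    CellsD[OF x(1)] CellsD[OF x(2)] CellsD[OF x(3)] CellsD[OF x(4)]
    CellsD[OF tilde_in(1)[OF TR US]] CellsD[OF tilde_in(2)[OF TR US]]
    CellsD[OF tilde_in(1)[OF TR' US']] CellsD[OF tilde_in(2)[OF TR' US']]
  show ?thesis
  proof (rule tensor_eqI[OF TR' US'])
    show "tensor_comp B K T' U' R' S' \<cdot> (tensor_cell B K \<gamma> \<delta> \<star> tensor_cell B K \<alpha> \<beta>)
        \<in> Cells B ((T \<otimes> U) \<odot> (R \<otimes> S)) ((T' \<odot> R') \<otimes> (U' \<odot> S'))"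
      "tensor_cell B K (\<gamma> \<star> \<alpha>) (\<delta> \<star> \<beta>) \<cdot> tensor_comp B K T U R S
        \<in> Cells B ((T \<otimes> U) \<odot> (R \<otimes> S)) ((T' \<odot> R') \<otimes> (U' \<odot> S'))"
      by (simp_all add: Cells_def)
    have "p_tilde B K (T' \<odot> R') (U' \<odot> S') \<cdot> (CellId B (p L M) \<star>
          (tensor_comp B K T' U' R' S' \<cdot> (tensor_cell B K \<gamma> \<delta> \<star> tensor_cell B K \<alpha> \<beta>)))
      = (p_tilde B K (T' \<odot> R') (U' \<odot> S') \<cdot> (CellId B (p L M) \<star> tensor_comp B K T' U' R' S'))
        \<cdot> (CellId B (p L M) \<star> (tensor_cell B K \<gamma> \<delta> \<star> tensor_cell B K \<alpha> \<beta>))"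
      by (simp add: lwhisker_VComp VComp_assoc)
    also have "\<dots> = paste B (p X Y) (p A D) (p L M) (R \<otimes> S) R' (T \<otimes> U) T'
        (p_tilde B K T' U' \<cdot> (CellId B (p L M) \<star> tensor_cell B K \<gamma> \<delta>))
        (p_tilde B K R' S' \<cdot> (CellId B (p A D) \<star> tensor_cell B K \<alpha> \<beta>))"
      unfolding c'(2) by (rule paste_precomp) (fact pr R' S' T' U' RS TU RS' TU' x' t1 t2)+
    \<comment> \<open>The naturality squares put the original cells after the unprimed tilde cells,
      where \<open>paste_postcomp\<close> can collect them.\<close>
    also have "\<dots> = ((\<gamma> \<star> \<alpha>) \<star> CellId B (p X Y)) \<cdot>
        paste B (p X Y) (p A D) (p L M) (R \<otimes> S) R (T \<otimes> U) T (p_tilde B K T U) (p_tilde B K R S)"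
      unfolding t1(2) t2(2) by (rule paste_postcomp[symmetric])
        (fact pr R S T U R' S' T' U' RS TU x \<alpha> \<gamma>)+
    also have "\<dots> = (p_tilde B K (T' \<odot> R') (U' \<odot> S') \<cdot> (CellId B (p L M) \<star> tensor_cell B K (\<gamma> \<star> \<alpha>) (\<delta> \<star> \<beta>)))
        \<cdot> (CellId B (p L M) \<star> tensor_comp B K T U R S)"
      unfolding t3(2) c(2)[symmetric] by (simp add: VComp_assoc)
    also have "\<dots> = p_tilde B K (T' \<odot> R') (U' \<odot> S') \<cdot> (CellId B (p L M) \<star>
        (tensor_cell B K (\<gamma> \<star> \<alpha>) (\<delta> \<star> \<beta>) \<cdot> tensor_comp B K T U R S))"
      by (simp add: lwhisker_VComp VComp_assoc)
    finally show "p_tilde B K (T' \<odot> R') (U' \<odot> S') \<cdot> (CellId B (p L M) \<star>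
          (tensor_comp B K T' U' R' S' \<cdot> (tensor_cell B K \<gamma> \<delta> \<star> tensor_cell B K \<alpha> \<beta>))) =
        p_tilde B K (T' \<odot> R') (U' \<odot> S') \<cdot> (CellId B (p L M) \<star>
          (tensor_cell B K (\<gamma> \<star> \<alpha>) (\<delta> \<star> \<beta>) \<cdot> tensor_comp B K T U R S))" .
    have "r_tilde B K (T' \<odot> R') (U' \<odot> S') \<cdot> (CellId B (r L M) \<star>
          (tensor_comp B K T' U' R' S' \<cdot> (tensor_cell B K \<gamma> \<delta> \<star> tensor_cell B K \<alpha> \<beta>)))
      = (r_tilde B K (T' \<odot> R') (U' \<odot> S') \<cdot> (CellId B (r L M) \<star> tensor_comp B K T' U' R' S'))
        \<cdot> (CellId B (r L M) \<star> (tensor_cell B K \<gamma> \<delta> \<star> tensor_cell B K \<alpha> \<beta>))"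
      by (simp add: lwhisker_VComp VComp_assoc)
    also have "\<dots> = paste B (r X Y) (r A D) (r L M) (R \<otimes> S) S' (T \<otimes> U) U'
        (r_tilde B K T' U' \<cdot> (CellId B (r L M) \<star> tensor_cell B K \<gamma> \<delta>))
        (r_tilde B K R' S' \<cdot> (CellId B (r A D) \<star> tensor_cell B K \<alpha> \<beta>))"
      unfolding c'(3) by (rule paste_precomp) (fact pr R' S' T' U' RS TU RS' TU' x' t1 t2)+
    also have "\<dots> = ((\<delta> \<star> \<beta>) \<star> CellId B (r X Y)) \<cdot>
        paste B (r X Y) (r A D) (r L M) (R \<otimes> S) S (T \<otimes> U) U (r_tilde B K T U) (r_tilde B K R S)"
      unfolding t1(3) t2(3) by (rule paste_postcomp[symmetric])
        (fact pr R S T U R' S' T' U' RS TU x \<beta> \<delta>)+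
    also have "\<dots> = (r_tilde B K (T' \<odot> R') (U' \<odot> S') \<cdot> (CellId B (r L M) \<star> tensor_cell B K (\<gamma> \<star> \<alpha>) (\<delta> \<star> \<beta>)))
        \<cdot> (CellId B (r L M) \<star> tensor_comp B K T U R S)"
      unfolding t3(3) c(3)[symmetric] by (simp add: VComp_assoc)
    also have "\<dots> = r_tilde B K (T' \<odot> R') (U' \<odot> S') \<cdot> (CellId B (r L M) \<star>
        (tensor_cell B K (\<gamma> \<star> \<alpha>) (\<delta> \<star> \<beta>) \<cdot> tensor_comp B K T U R S))"
      by (simp add: lwhisker_VComp VComp_assoc)
    finally show "r_tilde B K (T' \<odot> R') (U' \<odot> S') \<cdot> (CellId B (r L M) \<star>
          (tensor_comp B K T' U' R' S' \<cdot> (tensor_cell B K \<gamma> \<delta> \<star> tensor_cell B K \<alpha> \<beta>))) =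
        r_tilde B K (T' \<odot> R') (U' \<odot> S') \<cdot> (CellId B (r L M) \<star>
          (tensor_cell B K (\<gamma> \<star> \<alpha>) (\<delta> \<star> \<beta>) \<cdot> tensor_comp B K T U R S))" .
  qed
qed

text \<open>Over each projection, absorbing the inner constraint into the outer pasting gives an
  iterated pasting on either side. The tensored associator becomes an associator of \<open>B\<close>
  whiskered with the projection, so the two sides differ exactly by associativity of
  pasting.\<close>

lemma tensor_comp_assoc:
  assumes R: "R \<in> Arrs B X0 X1" and R': "R' \<in> Arrs B Y0 Y1" and S: "S \<in> Arrs B X1 X2" and S': "S' \<in> Arrs B Y1 Y2"
    and T: "T \<in> Arrs B X2 X3" and T': "T' \<in> Arrs B Y2 Y3"
  shows "tensor_cell B K (Assoc B T S R) (Assoc B T' S' R') \<cdot> tensor_comp B K (T \<odot> S) (T' \<odot> S') R R'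
      \<cdot> (tensor_comp B K T T' S S' \<star> CellId B (R \<otimes> R')) =
    tensor_comp B K T T' (S \<odot> R) (S' \<odot> R') \<cdot> (CellId B (T \<otimes> T') \<star> tensor_comp B K S S' R R')
      \<cdot> Assoc B (T \<otimes> T') (S \<otimes> S') (R \<otimes> R')"
    (is "?A \<cdot> ?C1 \<cdot> (?C2 \<star> _) = ?C3 \<cdot> (_ \<star> ?C4) \<cdot> ?a")
proof -
  note o0 = ArrsD[OF R] ArrsD[OF R'] and o1 = ArrsD[OF S] ArrsD[OF S'] and o2 = ArrsD[OF T] ArrsD[OF T']
  note pr = projections[OF o0(4,9)] projections[OF o0(5,10)] projections[OF o1(5,10)] projections[OF o2(5,10)]
  note RR = tensor_arr_in[OF R R'] and SS = tensor_arr_in[OF S S'] and TT = tensor_arr_in[OF T T']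
  note SR = ArrComp_in[OF R S] and SR' = ArrComp_in[OF R' S']
    and TS = ArrComp_in[OF S T] and TS' = ArrComp_in[OF S' T']
  note T_SR = ArrComp_in[OF SR T] and T_SR' = ArrComp_in[OF SR' T']
    and TS_R = ArrComp_in[OF R TS] and TS_R' = ArrComp_in[OF R' TS']
  note SSRR = tensor_arr_in[OF SR SR'] and TTSS = tensor_arr_in[OF TS TS']
  note cc = ArrComp_in[OF RR SS] ArrComp_in[OF SS TT]
  note C1 = tensor_comp_props[OF R R' TS TS'] and C2 = tensor_comp_props[OF S S' T T']
    and C3 = tensor_comp_props[OF SR SR' T T'] and C4 = tensor_comp_props[OF R R' S S']
  note x = tilde_in[OF R R'] tilde_in[OF S S'] tilde_in[OF T T'] tilde_in[OF SR SR'] tilde_in[OF TS TS']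
  note ty = o0 o1 o2
  have "Assoc B T S R \<in> Cells B ((T \<odot> S) \<odot> R) (T \<odot> (S \<odot> R))"
    "Assoc B T' S' R' \<in> Cells B ((T' \<odot> S') \<odot> R') (T' \<odot> (S' \<odot> R'))"
    by (simp_all add: Cells_def ty)
  note A = tensor_cell_props[OF TS_R TS_R' T_SR T_SR' this]
  have ids: "CellId B (R \<otimes> R') \<in> Cells B (R \<otimes> R') (R \<otimes> R')" "CellId B (T \<otimes> T') \<in> Cells B (T \<otimes> T') (T \<otimes> T')"
    using ArrsD[OF RR] ArrsD[OF TT] by (simp_all add: Cells_def)
  note [simp] = ty CellsD[OF A(1)] CellsD[OF C1(1)] CellsD[OF C2(1)] CellsD[OF C3(1)] CellsD[OF C4(1)]
    ArrsD[OF pr(2)] ArrsD[OF pr(3)] ArrsD[OF pr(7)] ArrsD[OF pr(8)] ArrsD[OF pr(12)] ArrsD[OF pr(13)]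
    ArrsD[OF pr(17)] ArrsD[OF pr(18)]
    ArrsD[OF RR] ArrsD[OF SS] ArrsD[OF TT] ArrsD[OF SSRR] ArrsD[OF TTSS]
    ArrsD[OF tensor_arr_in[OF T_SR T_SR']] ArrsD[OF tensor_arr_in[OF TS_R TS_R']]
    CellsD[OF tilde_in(1)[OF T_SR T_SR']] CellsD[OF tilde_in(2)[OF T_SR T_SR']]
    CellsD[OF tilde_in(1)[OF TS_R TS_R']] CellsD[OF tilde_in(2)[OF TS_R TS_R']]
    CellsD[OF x(1)] CellsD[OF x(2)] CellsD[OF x(3)] CellsD[OF x(4)]
    CellsD[OF x(5)] CellsD[OF x(6)] CellsD[OF x(7)] CellsD[OF x(8)] CellsD[OF x(9)] CellsD[OF x(10)]
  let ?p = "p X3 Y3" and ?r = "r X3 Y3"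
  show ?thesis
  proof (rule tensor_eqI[OF T_SR T_SR'])
    show "?A \<cdot> ?C1 \<cdot> (?C2 \<star> CellId B (R \<otimes> R'))
        \<in> Cells B (((T \<otimes> T') \<odot> (S \<otimes> S')) \<odot> (R \<otimes> R')) ((T \<odot> S \<odot> R) \<otimes> (T' \<odot> S' \<odot> R'))"
      "?C3 \<cdot> (CellId B (T \<otimes> T') \<star> ?C4) \<cdot> ?a
        \<in> Cells B (((T \<otimes> T') \<odot> (S \<otimes> S')) \<odot> (R \<otimes> R')) ((T \<odot> S \<odot> R) \<otimes> (T' \<odot> S' \<odot> R'))"
      by (simp_all add: Cells_def)

    \<comment> \<open>Absorbing the constraint for T and S replaces the tilde cell of the composite
      by a pasting of the tilde cells of T and S, which is the inner pasting on the left.\<close>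
    have 1: "paste B (p X0 Y0) (p X1 Y1) ?p (R \<otimes> R') R ((T \<odot> S) \<otimes> (T' \<odot> S')) (T \<odot> S)
          (p_tilde B K (T \<odot> S) (T' \<odot> S')) (p_tilde B K R R') \<cdot> (CellId B ?p \<star> (?C2 \<star> CellId B (R \<otimes> R')))
      = paste B (p X0 Y0) (p X1 Y1) ?p (R \<otimes> R') R ((T \<otimes> T') \<odot> (S \<otimes> S')) (T \<odot> S)
          (p_tilde B K (T \<odot> S) (T' \<odot> S') \<cdot> (CellId B ?p \<star> ?C2))
          (p_tilde B K R R' \<cdot> (CellId B (p X1 Y1) \<star> CellId B (R \<otimes> R')))"
      by (rule paste_precomp) (fact pr R S T RR SS TT TS TTSS cc C2 x ids)+
    \<comment> \<open>The same absorption on the other side of the axiom, where the inner constraint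
      is that of S and R and enters the second square.\<close>
    have 2: "paste B (p X0 Y0) (p X2 Y2) ?p ((S \<odot> R) \<otimes> (S' \<odot> R')) (S \<odot> R) (T \<otimes> T') T
          (p_tilde B K T T') (p_tilde B K (S \<odot> R) (S' \<odot> R')) \<cdot> (CellId B ?p \<star> (CellId B (T \<otimes> T') \<star> ?C4))
      = paste B (p X0 Y0) (p X2 Y2) ?p ((S \<otimes> S') \<odot> (R \<otimes> R')) (S \<odot> R) (T \<otimes> T') T
          (p_tilde B K T T' \<cdot> (CellId B ?p \<star> CellId B (T \<otimes> T')))
          (p_tilde B K (S \<odot> R) (S' \<odot> R') \<cdot> (CellId B (p X2 Y2) \<star> ?C4))"
      by (rule paste_precomp) (fact pr R S T RR SS TT SR SSRR cc C4 x ids)+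
    have "p_tilde B K (T \<odot> S \<odot> R) (T' \<odot> S' \<odot> R') \<cdot> (CellId B ?p \<star> (?A \<cdot> ?C1 \<cdot> (?C2 \<star> CellId B (R \<otimes> R'))))
      = (p_tilde B K (T \<odot> S \<odot> R) (T' \<odot> S' \<odot> R') \<cdot> (CellId B ?p \<star> ?A))
        \<cdot> (CellId B ?p \<star> ?C1) \<cdot> (CellId B ?p \<star> (?C2 \<star> CellId B (R \<otimes> R')))"
      by (simp add: lwhisker_VComp VComp_assoc)
    also have "\<dots> = (Assoc B T S R \<star> CellId B (p X0 Y0))
        \<cdot> (p_tilde B K ((T \<odot> S) \<odot> R) ((T' \<odot> S') \<odot> R') \<cdot> (CellId B ?p \<star> ?C1))
        \<cdot> (CellId B ?p \<star> (?C2 \<star> CellId B (R \<otimes> R')))"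
      unfolding A(2) by (simp add: VComp_assoc)
    also have "\<dots> = (Assoc B T S R \<star> CellId B (p X0 Y0))
        \<cdot> paste B (p X0 Y0) (p X1 Y1) ?p (R \<otimes> R') R ((T \<otimes> T') \<odot> (S \<otimes> S')) (T \<odot> S)
          (paste B (p X1 Y1) (p X2 Y2) ?p (S \<otimes> S') S (T \<otimes> T') T (p_tilde B K T T') (p_tilde B K S S'))
          (p_tilde B K R R')"
      unfolding C1(2) 1 C2(2) by simp
    also have "\<dots> = paste B (p X0 Y0) (p X2 Y2) ?p ((S \<otimes> S') \<odot> (R \<otimes> R')) (S \<odot> R) (T \<otimes> T') T (p_tilde B K T T')
        (paste B (p X0 Y0) (p X1 Y1) (p X2 Y2) (R \<otimes> R') R (S \<otimes> S') S (p_tilde B K S S') (p_tilde B K R R'))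
        \<cdot> (CellId B ?p \<star> ?a)"
      by (rule paste_assoc) (fact pr R S T RR SS TT x)+
    also have "\<dots> = (paste B (p X0 Y0) (p X2 Y2) ?p ((S \<odot> R) \<otimes> (S' \<odot> R')) (S \<odot> R) (T \<otimes> T') T
          (p_tilde B K T T') (p_tilde B K (S \<odot> R) (S' \<odot> R')) \<cdot> (CellId B ?p \<star> (CellId B (T \<otimes> T') \<star> ?C4)))
        \<cdot> (CellId B ?p \<star> ?a)"
      unfolding 2 C4(2) by simp
    also have "\<dots> = p_tilde B K (T \<odot> S \<odot> R) (T' \<odot> S' \<odot> R') \<cdot> (CellId B ?p \<star> (?C3 \<cdot> (CellId B (T \<otimes> T') \<star> ?C4) \<cdot> ?a))"
      unfolding C3(2)[symmetric] by (simp add: lwhisker_VComp VComp_assoc)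
    finally show "p_tilde B K (T \<odot> S \<odot> R) (T' \<odot> S' \<odot> R') \<cdot> (CellId B ?p \<star> (?A \<cdot> ?C1 \<cdot> (?C2 \<star> CellId B (R \<otimes> R')))) =
        p_tilde B K (T \<odot> S \<odot> R) (T' \<odot> S' \<odot> R') \<cdot> (CellId B ?p \<star> (?C3 \<cdot> (CellId B (T \<otimes> T') \<star> ?C4) \<cdot> ?a))" .

    \<comment> \<open>The second coordinate: the same chain with r for p, the squares now belonging
      to the primed arrows.\<close>
    have 1: "paste B (r X0 Y0) (r X1 Y1) ?r (R \<otimes> R') R' ((T \<odot> S) \<otimes> (T' \<odot> S')) (T' \<odot> S')
          (r_tilde B K (T \<odot> S) (T' \<odot> S')) (r_tilde B K R R') \<cdot> (CellId B ?r \<star> (?C2 \<star> CellId B (R \<otimes> R')))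
      = paste B (r X0 Y0) (r X1 Y1) ?r (R \<otimes> R') R' ((T \<otimes> T') \<odot> (S \<otimes> S')) (T' \<odot> S')
          (r_tilde B K (T \<odot> S) (T' \<odot> S') \<cdot> (CellId B ?r \<star> ?C2))
          (r_tilde B K R R' \<cdot> (CellId B (r X1 Y1) \<star> CellId B (R \<otimes> R')))"
      by (rule paste_precomp) (fact pr R' S' T' RR SS TT TS' TTSS cc C2 x ids)+
    have 2: "paste B (r X0 Y0) (r X2 Y2) ?r ((S \<odot> R) \<otimes> (S' \<odot> R')) (S' \<odot> R') (T \<otimes> T') T'
          (r_tilde B K T T') (r_tilde B K (S \<odot> R) (S' \<odot> R')) \<cdot> (CellId B ?r \<star> (CellId B (T \<otimes> T') \<star> ?C4))
      = paste B (r X0 Y0) (r X2 Y2) ?r ((S \<otimes> S') \<odot> (R \<otimes> R')) (S' \<odot> R') (T \<otimes> T') T'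
          (r_tilde B K T T' \<cdot> (CellId B ?r \<star> CellId B (T \<otimes> T')))
          (r_tilde B K (S \<odot> R) (S' \<odot> R') \<cdot> (CellId B (r X2 Y2) \<star> ?C4))"
      by (rule paste_precomp) (fact pr R' S' T' RR SS TT SR' SSRR cc C4 x ids)+
    have "r_tilde B K (T \<odot> S \<odot> R) (T' \<odot> S' \<odot> R') \<cdot> (CellId B ?r \<star> (?A \<cdot> ?C1 \<cdot> (?C2 \<star> CellId B (R \<otimes> R'))))
      = (r_tilde B K (T \<odot> S \<odot> R) (T' \<odot> S' \<odot> R') \<cdot> (CellId B ?r \<star> ?A))
        \<cdot> (CellId B ?r \<star> ?C1) \<cdot> (CellId B ?r \<star> (?C2 \<star> CellId B (R \<otimes> R')))"
      by (simp add: lwhisker_VComp VComp_assoc)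
    also have "\<dots> = (Assoc B T' S' R' \<star> CellId B (r X0 Y0))
        \<cdot> (r_tilde B K ((T \<odot> S) \<odot> R) ((T' \<odot> S') \<odot> R') \<cdot> (CellId B ?r \<star> ?C1))
        \<cdot> (CellId B ?r \<star> (?C2 \<star> CellId B (R \<otimes> R')))"
      unfolding A(3) by (simp add: VComp_assoc)
    also have "\<dots> = (Assoc B T' S' R' \<star> CellId B (r X0 Y0))
        \<cdot> paste B (r X0 Y0) (r X1 Y1) ?r (R \<otimes> R') R' ((T \<otimes> T') \<odot> (S \<otimes> S')) (T' \<odot> S')
          (paste B (r X1 Y1) (r X2 Y2) ?r (S \<otimes> S') S' (T \<otimes> T') T' (r_tilde B K T T') (r_tilde B K S S'))
          (r_tilde B K R R')"
      unfolding C1(3) 1 C2(3) by simp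
    also have "\<dots> = paste B (r X0 Y0) (r X2 Y2) ?r ((S \<otimes> S') \<odot> (R \<otimes> R')) (S' \<odot> R') (T \<otimes> T') T' (r_tilde B K T T')
        (paste B (r X0 Y0) (r X1 Y1) (r X2 Y2) (R \<otimes> R') R' (S \<otimes> S') S' (r_tilde B K S S') (r_tilde B K R R'))
        \<cdot> (CellId B ?r \<star> ?a)"
      by (rule paste_assoc) (fact pr R' S' T' RR SS TT x)+
    also have "\<dots> = (paste B (r X0 Y0) (r X2 Y2) ?r ((S \<odot> R) \<otimes> (S' \<odot> R')) (S' \<odot> R') (T \<otimes> T') T'
          (r_tilde B K T T') (r_tilde B K (S \<odot> R) (S' \<odot> R')) \<cdot> (CellId B ?r \<star> (CellId B (T \<otimes> T') \<star> ?C4)))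
        \<cdot> (CellId B ?r \<star> ?a)"
      unfolding 2 C4(3) by simp
    also have "\<dots> = r_tilde B K (T \<odot> S \<odot> R) (T' \<odot> S' \<odot> R') \<cdot> (CellId B ?r \<star> (?C3 \<cdot> (CellId B (T \<otimes> T') \<star> ?C4) \<cdot> ?a))"
      unfolding C3(3)[symmetric] by (simp add: lwhisker_VComp VComp_assoc)
    finally show "r_tilde B K (T \<odot> S \<odot> R) (T' \<odot> S' \<odot> R') \<cdot> (CellId B ?r \<star> (?A \<cdot> ?C1 \<cdot> (?C2 \<star> CellId B (R \<otimes> R')))) =
        r_tilde B K (T \<odot> S \<odot> R) (T' \<odot> S' \<odot> R') \<cdot> (CellId B ?r \<star> (?C3 \<cdot> (CellId B (T \<otimes> T') \<star> ?C4) \<cdot> ?a))" .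
  qed
qed

text \<open>Absorbing the unit constraint turns one tilde cell of the pasting into an identity
  square, and pasting with an identity square changes nothing.\<close>

lemma tensor_comp_unit_left:
  assumes R: "R \<in> Arrs B X A" and S: "S \<in> Arrs B Y D"
  shows "tensor_comp B K (One B A) (One B D) R S \<cdot> (tensor_unit B K A D \<star> CellId B (R \<otimes> S)) = CellId B (R \<otimes> S)"
proof -
  note obj = ArrsD[OF R] ArrsD[OF S]
  note pr = projections[OF obj(4,9)] projections[OF obj(5,10)]
  note one = One_in[OF obj(5)] One_in[OF obj(10)] One_in[OF pr(6)]
  note RS = tensor_arr_in[OF R S] and TU = tensor_arr_in[OF one(1,2)]
  note c = tensor_comp_props[OF R S one(1,2)] and u = tensor_unit_props[OF obj(5,10)]
  note x = tilde_in[OF R S] tilde_in[OF one(1,2)]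
  \<comment> \<open>The constraint has codomain
    \<open>(One B A \<odot> R) \<otimes> (One B D \<odot> S)\<close>; normality rewrites its type so
    that it ends at \<open>R \<otimes> S\<close>.\<close>
  note [simp] = obj One_ArrComp[OF R] One_ArrComp[OF S] ArrsD[OF one(1)] ArrsD[OF one(2)] CellsD[OF u(1)]
    ArrsD[OF pr(2)] ArrsD[OF pr(3)] ArrsD[OF pr(7)] ArrsD[OF pr(8)] ArrsD[OF RS] ArrsD[OF TU]
    CellsD[OF c(1)[unfolded One_ArrComp[OF R] One_ArrComp[OF S]]]
    CellsD[OF x(1)] CellsD[OF x(2)] CellsD[OF x(3)] CellsD[OF x(4)]
  have id: "CellId B (R \<otimes> S) \<in> Cells B (R \<otimes> S) (R \<otimes> S)"
    by (simp add: Cells_def)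
  show ?thesis
  proof (rule tensor_eqI[OF R S])
    show "tensor_comp B K (One B A) (One B D) R S \<cdot> (tensor_unit B K A D \<star> CellId B (R \<otimes> S))
        \<in> Cells B (R \<otimes> S) (R \<otimes> S)"
      by (simp add: Cells_def)
    show "CellId B (R \<otimes> S) \<in> Cells B (R \<otimes> S) (R \<otimes> S)" by (fact id)
    have 1: "paste B (p X Y) (p A D) (p A D) (R \<otimes> S) R (One B A \<otimes> One B D) (One B A)
          (p_tilde B K (One B A) (One B D)) (p_tilde B K R S)
          \<cdot> (CellId B (p A D) \<star> (tensor_unit B K A D \<star> CellId B (R \<otimes> S)))
      = paste B (p X Y) (p A D) (p A D) (R \<otimes> S) R (One B (P A D)) (One B A)
          (p_tilde B K (One B A) (One B D) \<cdot> (CellId B (p A D) \<star> tensor_unit B K A D))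
          (p_tilde B K R S \<cdot> (CellId B (p A D) \<star> CellId B (R \<otimes> S)))"
      by (rule paste_precomp) (fact pr R one RS TU u x id)+
    have "p_tilde B K R S \<cdot> (CellId B (p A D) \<star>
          (tensor_comp B K (One B A) (One B D) R S \<cdot> (tensor_unit B K A D \<star> CellId B (R \<otimes> S))))
      = (p_tilde B K R S \<cdot> (CellId B (p A D) \<star> tensor_comp B K (One B A) (One B D) R S))
        \<cdot> (CellId B (p A D) \<star> (tensor_unit B K A D \<star> CellId B (R \<otimes> S)))"
      by (simp add: lwhisker_VComp VComp_assoc)
    also have "\<dots> = paste B (p X Y) (p A D) (p A D) (R \<otimes> S) R (One B (P A D)) (One B A)
        (CellId B (p A D)) (p_tilde B K R S)"
      unfolding c(2)[unfolded One_ArrComp[OF R] One_ArrComp[OF S]] 1 u(2) by simp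
    also have "\<dots> = p_tilde B K R S"
      by (rule paste_unit_left) (fact pr R RS x)+
    finally show "p_tilde B K R S \<cdot> (CellId B (p A D) \<star>
          (tensor_comp B K (One B A) (One B D) R S \<cdot> (tensor_unit B K A D \<star> CellId B (R \<otimes> S))))
      = p_tilde B K R S \<cdot> (CellId B (p A D) \<star> CellId B (R \<otimes> S))"
      by simp
    have 1: "paste B (r X Y) (r A D) (r A D) (R \<otimes> S) S (One B A \<otimes> One B D) (One B D)
          (r_tilde B K (One B A) (One B D)) (r_tilde B K R S)
          \<cdot> (CellId B (r A D) \<star> (tensor_unit B K A D \<star> CellId B (R \<otimes> S)))
      = paste B (r X Y) (r A D) (r A D) (R \<otimes> S) S (One B (P A D)) (One B D)
          (r_tilde B K (One B A) (One B D) \<cdot> (CellId B (r A D) \<star> tensor_unit B K A D))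
          (r_tilde B K R S \<cdot> (CellId B (r A D) \<star> CellId B (R \<otimes> S)))"
      by (rule paste_precomp) (fact pr S one RS TU u x id)+
    have "r_tilde B K R S \<cdot> (CellId B (r A D) \<star>
          (tensor_comp B K (One B A) (One B D) R S \<cdot> (tensor_unit B K A D \<star> CellId B (R \<otimes> S))))
      = (r_tilde B K R S \<cdot> (CellId B (r A D) \<star> tensor_comp B K (One B A) (One B D) R S))
        \<cdot> (CellId B (r A D) \<star> (tensor_unit B K A D \<star> CellId B (R \<otimes> S)))"
      by (simp add: lwhisker_VComp VComp_assoc)
    also have "\<dots> = paste B (r X Y) (r A D) (r A D) (R \<otimes> S) S (One B (P A D)) (One B D)
        (CellId B (r A D)) (r_tilde B K R S)"
      unfolding c(3)[unfolded One_ArrComp[OF R] One_ArrComp[OF S]] 1 u(3) by simp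
    also have "\<dots> = r_tilde B K R S"
      by (rule paste_unit_left) (fact pr S RS x)+
    finally show "r_tilde B K R S \<cdot> (CellId B (r A D) \<star>
          (tensor_comp B K (One B A) (One B D) R S \<cdot> (tensor_unit B K A D \<star> CellId B (R \<otimes> S))))
      = r_tilde B K R S \<cdot> (CellId B (r A D) \<star> CellId B (R \<otimes> S))"
      by simp
  qed
qed

text \<open>Here the unit constraint is whiskered on the other side, so the identity square is the
  one applied last in the pasting.\<close>

lemma tensor_comp_unit_right:
  assumes R: "R \<in> Arrs B X A" and S: "S \<in> Arrs B Y D"
  shows "tensor_comp B K R S (One B X) (One B Y) \<cdot> (CellId B (R \<otimes> S) \<star> tensor_unit B K X Y) = CellId B (R \<otimes> S)"
proof -
  note obj = ArrsD[OF R] ArrsD[OF S]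
  note pr = projections[OF obj(4,9)] projections[OF obj(5,10)]
  note one = One_in[OF obj(4)] One_in[OF obj(9)] One_in[OF pr(1)]
  note RS = tensor_arr_in[OF R S] and TU = tensor_arr_in[OF one(1,2)]
  note c = tensor_comp_props[OF one(1,2) R S] and u = tensor_unit_props[OF obj(4,9)]
  note x = tilde_in[OF R S] tilde_in[OF one(1,2)]
  note [simp] = obj ArrComp_One[OF R] ArrComp_One[OF S] ArrsD[OF one(1)] ArrsD[OF one(2)] CellsD[OF u(1)]
    ArrsD[OF pr(2)] ArrsD[OF pr(3)] ArrsD[OF pr(7)] ArrsD[OF pr(8)] ArrsD[OF RS] ArrsD[OF TU]
    CellsD[OF c(1)[unfolded ArrComp_One[OF R] ArrComp_One[OF S]]]
    CellsD[OF x(1)] CellsD[OF x(2)] CellsD[OF x(3)] CellsD[OF x(4)]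
  have id: "CellId B (R \<otimes> S) \<in> Cells B (R \<otimes> S) (R \<otimes> S)"
    by (simp add: Cells_def)
  show ?thesis
  proof (rule tensor_eqI[OF R S])
    show "tensor_comp B K R S (One B X) (One B Y) \<cdot> (CellId B (R \<otimes> S) \<star> tensor_unit B K X Y)
        \<in> Cells B (R \<otimes> S) (R \<otimes> S)"
      by (simp add: Cells_def)
    show "CellId B (R \<otimes> S) \<in> Cells B (R \<otimes> S) (R \<otimes> S)" by (fact id)
    have 1: "paste B (p X Y) (p X Y) (p A D) (One B X \<otimes> One B Y) (One B X) (R \<otimes> S) R
          (p_tilde B K R S) (p_tilde B K (One B X) (One B Y))
          \<cdot> (CellId B (p A D) \<star> (CellId B (R \<otimes> S) \<star> tensor_unit B K X Y))
      = paste B (p X Y) (p X Y) (p A D) (One B (P X Y)) (One B X) (R \<otimes> S) R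
          (p_tilde B K R S \<cdot> (CellId B (p A D) \<star> CellId B (R \<otimes> S)))
          (p_tilde B K (One B X) (One B Y) \<cdot> (CellId B (p X Y) \<star> tensor_unit B K X Y))"
      by (rule paste_precomp) (fact pr R one RS TU u x id)+
    have "p_tilde B K R S \<cdot> (CellId B (p A D) \<star>
          (tensor_comp B K R S (One B X) (One B Y) \<cdot> (CellId B (R \<otimes> S) \<star> tensor_unit B K X Y)))
      = (p_tilde B K R S \<cdot> (CellId B (p A D) \<star> tensor_comp B K R S (One B X) (One B Y)))
        \<cdot> (CellId B (p A D) \<star> (CellId B (R \<otimes> S) \<star> tensor_unit B K X Y))"
      by (simp add: lwhisker_VComp VComp_assoc)
    also have "\<dots> = paste B (p X Y) (p X Y) (p A D) (One B (P X Y)) (One B X) (R \<otimes> S) R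
        (p_tilde B K R S) (CellId B (p X Y))"
      unfolding c(2)[unfolded ArrComp_One[OF R] ArrComp_One[OF S]] 1 u(2) by simp
    also have "\<dots> = p_tilde B K R S"
      by (rule paste_unit_right) (fact pr R RS x)+
    finally show "p_tilde B K R S \<cdot> (CellId B (p A D) \<star>
          (tensor_comp B K R S (One B X) (One B Y) \<cdot> (CellId B (R \<otimes> S) \<star> tensor_unit B K X Y)))
      = p_tilde B K R S \<cdot> (CellId B (p A D) \<star> CellId B (R \<otimes> S))"
      by simp
    have 1: "paste B (r X Y) (r X Y) (r A D) (One B X \<otimes> One B Y) (One B Y) (R \<otimes> S) S
          (r_tilde B K R S) (r_tilde B K (One B X) (One B Y))
          \<cdot> (CellId B (r A D) \<star> (CellId B (R \<otimes> S) \<star> tensor_unit B K X Y))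
      = paste B (r X Y) (r X Y) (r A D) (One B (P X Y)) (One B Y) (R \<otimes> S) S
          (r_tilde B K R S \<cdot> (CellId B (r A D) \<star> CellId B (R \<otimes> S)))
          (r_tilde B K (One B X) (One B Y) \<cdot> (CellId B (r X Y) \<star> tensor_unit B K X Y))"
      by (rule paste_precomp) (fact pr S one RS TU u x id)+
    have "r_tilde B K R S \<cdot> (CellId B (r A D) \<star>
          (tensor_comp B K R S (One B X) (One B Y) \<cdot> (CellId B (R \<otimes> S) \<star> tensor_unit B K X Y)))
      = (r_tilde B K R S \<cdot> (CellId B (r A D) \<star> tensor_comp B K R S (One B X) (One B Y)))
        \<cdot> (CellId B (r A D) \<star> (CellId B (R \<otimes> S) \<star> tensor_unit B K X Y))"
      by (simp add: lwhisker_VComp VComp_assoc)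
    also have "\<dots> = paste B (r X Y) (r X Y) (r A D) (One B (P X Y)) (One B Y) (R \<otimes> S) S
        (r_tilde B K R S) (CellId B (r X Y))"
      unfolding c(3)[unfolded ArrComp_One[OF R] ArrComp_One[OF S]] 1 u(3) by simp
    also have "\<dots> = r_tilde B K R S"
      by (rule paste_unit_right) (fact pr S RS x)+
    finally show "r_tilde B K R S \<cdot> (CellId B (r A D) \<star>
          (tensor_comp B K R S (One B X) (One B Y) \<cdot> (CellId B (R \<otimes> S) \<star> tensor_unit B K X Y)))
      = r_tilde B K R S \<cdot> (CellId B (r A D) \<star> CellId B (R \<otimes> S))"
      by simp
  qed
qed

section \<open>Assembly of the lax functor\<close>

lemma tensor_simps [simp]:
  "on_obj (tensor B K) (X, Y) = P X Y" "on_arr (tensor B K) (R, S) = R \<otimes> S"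
  "on_cell (tensor B K) (\<alpha>, \<beta>) = tensor_cell B K \<alpha> \<beta>"
  "lax_comp (tensor B K) (T, U) (R, S) = tensor_comp B K T U R S"
  "lax_unit (tensor B K) (X, Y) = tensor_unit B K X Y"
  by (simp_all add: tensor_def)

lemma Hom_hom_cat_Cells:
  "\<alpha> \<in> Hom (hom_cat B X Y) R S \<longleftrightarrow> \<alpha> \<in> Cells B R S \<and> R \<in> Arrs B X Y \<and> S \<in> Arrs B X Y"
  by (auto simp: Hom_hom_cat_iff Cells_def)

lemma tensor_functor:
  assumes "X \<in> Obj B" "Y \<in> Obj B" "A \<in> Obj B" "D \<in> Obj B"
  shows "cat_functor (prod_cat (hom_cat B X A) (hom_cat B Y D)) (hom_cat B (P X Y) (P A D))
    (on_arr (tensor B K)) (on_cell (tensor B K))"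
proof (intro cat_functor.intro cat_functor_axioms.intro category_prod_cat hom_category assms projections(1);
    unfold split_paired_all)
qed (auto simp: Hom_hom_cat_Cells tensor_cell_CellId
    intro: tensor_arr_in tensor_cell_props(1) tensor_cell_VComp)

lemma tensor_lax_functor: "lax_functor (prod_bicat B B) B (tensor B K)"
proof (intro lax_functor.intro normal_bicategory_prod normal_bicategory_axioms lax_functor_axioms.intro;
    unfold split_paired_all)
  fix X X' Y Y' Z Z'
  assume *: "(X, X') \<in> Obj (prod_bicat B B)" "(Y, Y') \<in> Obj (prod_bicat B B)" "(Z, Z') \<in> Obj (prod_bicat B B)"
  let ?BB = "prod_bicat B B" and ?F = "tensor B K"
  have o: "X \<in> Obj B" "X' \<in> Obj B" "Y \<in> Obj B" "Y' \<in> Obj B" "Z \<in> Obj B" "Z' \<in> Obj B"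
    using * by auto
  note f = tensor_functor[OF o(1,2,3,4)] tensor_functor[OF o(3,4,5,6)] tensor_functor[OF o(1,2,5,6)]
  note comp = comp_functor[OF projections(1)[OF o(1,2)] projections(1)[OF o(3,4)] projections(1)[OF o(5,6)]]
  interpret BB: normal_bicategory ?BB
    by (intro normal_bicategory_prod normal_bicategory_axioms)
  have comp': "cat_functor (prod_cat (hom_cat ?BB (Y, Y') (Z, Z')) (hom_cat ?BB (X, X') (Y, Y')))
      (hom_cat ?BB (X, X') (Z, Z')) (\<lambda>(S, R). S \<odot>\<^bsub>?BB\<^esub> R) (\<lambda>(\<beta>, \<alpha>). \<beta> \<star>\<^bsub>?BB\<^esub> \<alpha>)"
    using * by (rule BB.comp_functor)
  \<comment> \<open>A natural transformation presupposes that both its ends are functors. This one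
    tensors two pairs and then composes in \<open>B\<close>; the next composes in the product
    bicategory and then tensors. Each is a composite of functors already known.\<close>
  have l: "cat_functor (prod_cat (hom_cat ?BB (Y, Y') (Z, Z')) (hom_cat ?BB (X, X') (Y, Y')))
      (hom_cat B (P X X') (P Z Z'))
      (\<lambda>(S, R). on_arr ?F S \<odot> on_arr ?F R) (\<lambda>(\<beta>, \<alpha>). on_cell ?F \<beta> \<star> on_cell ?F \<alpha>)"
    using cat_functor_comp[OF cat_functor_prod[OF f(2,1)] comp]
    by (simp add: comp_def case_prod_beta' map_prod_def)
  have r: "cat_functor (prod_cat (hom_cat ?BB (Y, Y') (Z, Z')) (hom_cat ?BB (X, X') (Y, Y')))
      (hom_cat B (P X X') (P Z Z'))
      (\<lambda>(S, R). on_arr ?F (S \<odot>\<^bsub>?BB\<^esub> R)) (\<lambda>(\<beta>, \<alpha>). on_cell ?F (\<beta> \<star>\<^bsub>?BB\<^esub> \<alpha>))"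
    using cat_functor_comp[OF comp'[unfolded hom_cat_prod_bicat] f(3)]
    by (simp add: comp_def case_prod_beta')
  show "nat_trans (prod_cat (hom_cat ?BB (Y, Y') (Z, Z')) (hom_cat ?BB (X, X') (Y, Y')))
      (hom_cat B (on_obj ?F (X, X')) (on_obj ?F (Z, Z')))
      (\<lambda>(S, R). on_arr ?F S \<odot> on_arr ?F R) (\<lambda>(\<beta>, \<alpha>). on_cell ?F \<beta> \<star> on_cell ?F \<alpha>)
      (\<lambda>(S, R). on_arr ?F (S \<odot>\<^bsub>?BB\<^esub> R)) (\<lambda>(\<beta>, \<alpha>). on_cell ?F (\<beta> \<star>\<^bsub>?BB\<^esub> \<alpha>))
      (\<lambda>(S, R). lax_comp ?F S R)"
    unfolding tensor_simps
    by (intro nat_trans.intro l r nat_trans_axioms.intro; unfold split_paired_all)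
      (auto simp: Hom_hom_cat_Cells intro: tensor_arr_in ArrComp_in tensor_comp_props(1) tensor_comp_natural)
qed (auto simp: tensor_functor projections(1) tensor_unit_props(1) tensor_comp_unit_left tensor_comp_unit_right
    intro: tensor_comp_assoc)

end

theorem theorem3p15:
  fixes B :: "('o, 'a, 'c) bicat" and K :: "('o, 'a, 'c) choices"
  assumes "precartesian B" and "precartesian_choices B K"
  shows "lax_functor (prod_bicat B B) B (tensor B K)"
  using tensor_context.tensor_lax_functor[OF tensor_context.intro[OF assms]] .

end
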